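(* Let $(H,R)$ be a quasitriangular quasi-Hopf algebra over a field $k$ and let $u=S(R^2x^2\beta S(x^3))\alpha R^1x^1\in H$. Let $f\in H\otimes H$ be the Drinfeld twist of $H$. Then $l\mapsto ul$ defines a one-to-one correspondence between the set $$R(H):=\{l\in H\mid l^2=u^{-1}S(u),\ \Delta(l)=(l\otimes l)(S\otimes S)(f_{21}^{-1})f\ \text{ and }\ lS^2(h)=hl\ \text{ for all } h\in H\}$$ and the set of ribbon elements of $(H,R)$, i.e. the set of central elements $\nu\in H$ such that $\Delta(\nu)=(\nu\otimes\nu)(R_{21}R)^{-1}$, $S(\nu)=\nu$ and $\nu^2=uS(u)$.
   Context: All vector spaces and algebras are over a field $k$, $\otimes=\otimes_k$, and summation over tensor components is implicit. A quasi-bialgebra $(H,\Delta,\varepsilon,\Phi)$ consists of an associative unital algebra $H$, algebra maps $\Delta:H\to H\otimes H$, $\Delta(h)=h_1\otimes h_2$, and $\varepsilon:H\to k$, and an invertible $\Phi=X^1\otimes X^2\otimes X^3\in H^{\otimes 3}$ with inverse $\Phi^{-1}=x^1\otimes x^2\otimes x^3$, such that $(\mathrm{id}\otimes\Delta)(\Delta(h))=\Phi(\Delta\otimes\mathrm{id})(\Delta(h))\Phi^{-1}$, $(\mathrm{id}\otimes\varepsilon)\Delta(h)=h=(\varepsilon\otimes\mathrm{id})\Delta(h)$ for all $h\in H$, $(1\otimes\Phi)(\mathrm{id}\otimes\Delta\otimes\mathrm{id})(\Phi)(\Phi\otimes1)=(\mathrm{id}\otimes\mathrm{id}\otimes\Delta)(\Phi)(\Delta\otimes\mathrm{id}\otimes\mathrm{id})(\Phi)$,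 and $(\mathrm{id}\otimes\varepsilon\otimes\mathrm{id})(\Phi)=1\otimes1$. It is a quasi-Hopf algebra if there are an algebra anti-morphism $S:H\to H$ and $\alpha,\beta\in H$ with $S(h_1)\alpha h_2=\varepsilon(h)\alpha$, $h_1\beta S(h_2)=\varepsilon(h)\beta$ for all $h\in H$, $X^1\beta S(X^2)\alpha X^3=1$ and $S(x^1)\alpha x^2\beta S(x^3)=1$. Bijectivity of $S$ is not part of the definition, but is implicitly understood whenever $S^{-1}$ is used. It is quasitriangular, denoted $(H,R)$, if there is an invertible $R=R^1\otimes R^2\in H\otimes H$ with (writing $r^1\otimes r^2$ for a second copy of $R$, and $Y^1\otimes Y^2\otimes Y^3$, $y^1\otimes y^2\otimes y^3$ for second copies of $\Phi$, $\Phi^{-1}$) $\Delta^{\rm cop}(h)R=R\Delta(h)$ for all $h$, where $\Delta^{\rm cop}(h)=h_2\otimes h_1$; $(\Delta\otimes\mathrm{id})(R)=X^2R^1x^1Y^1\otimes X^3x^3r^1Y^2\otimes X^1R^2x^2r^2Y^3$; $(\mathrm{id}\otimes\Delta)(R)=x^3R^1X^2r^1y^1\otimes x^1X^1r^2y^2\otimes x^2R^2X^3y^3$; and $\varepsilon(R^1)R^2=\varepsilon(R^2)R^1=1$. Write $R_{21}=R^2\otimes R^1$. It is known that $u$ is invertible. Drinfeld twist: put $\gamma=S(X^2x^1_2)\alpha X^3x^2\otimes S(X^1x^1_1)\alpha x^3\in H\otimes H$, where $x^1_1\otimes x^1_2=\Delta(x^1)$. Then $f=f^1\otimes f^2:=(S\otimes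 S)(\Delta^{\rm cop}(x^1))\,\gamma\,\Delta(x^2\beta S(x^3))$. It is invertible, satisfies $\varepsilon(f^1)f^2=\varepsilon(f^2)f^1=1$ and $f\Delta(S(h))f^{-1}=(S\otimes S)(\Delta^{\rm cop}(h))$ for all $h\in H$. Write $f_{21}=f^2\otimes f^1$ and $f_{21}^{-1}$ for its inverse. *)

theory Defs
  imports Complex_Main "HOL-Library.Poly_Mapping" "HOL-Algebra.Ring"
begin

section \<open>Tensor powers of an algebra\<close>

definition free_scale :: "'k::field \<Rightarrow> ('w \<Rightarrow>\<^sub>0 'k) \<Rightarrow> ('w \<Rightarrow>\<^sub>0 'k)"
  where "free_scale c = Poly_Mapping.map ((*) c)"

lemma lookup_free_scale: "Poly_Mapping.lookup (free_scale c x) w = c * Poly_Mapping.lookup x w"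
  unfolding free_scale_def by transfer (simp add: when_def)

lemma vector_space_free_scale: "vector_space free_scale"
  by unfold_locales
    (auto intro!: poly_mapping_eqI simp: lookup_free_scale lookup_add algebra_simps)

text \<open>The algebra \<open>H\<close> is the whole type \<^typ>\<open>'h\<close>. The class \<^class>\<open>ring_1\<close> demands \<open>1 \<noteq> 0\<close>; this
  excludes nothing here, since the counit of a quasi-bialgebra forces \<open>1 \<noteq> 0\<close> in \<open>H\<close>.\<close>

locale unital_algebra = vector_space scale
  for scale :: "'k::field \<Rightarrow> 'h::ring_1 \<Rightarrow> 'h" (infixr \<open>*s\<close> 75) +
  assumes scale_mult_left: "(c *s a) * b = c *s (a * b)"
    and scale_mult_right: "a * (c *s b) = c *s (a * b)"
begin

text \<open>A word \<open>[a\<^sub>1, \<dots>, a\<^sub>n]\<close> over \<open>H\<close> stands for the pure tensor \<open>a\<^sub>1 \<otimes> \<dots> \<otimes> a\<^sub>n\<close>. The \<open>n\<close>-th tensor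
  power of \<open>H\<close> is the free vector space on words of length \<open>n\<close> modulo the span of the relations
  expressing multilinearity.\<close>

definition multilinear_relations :: "nat \<Rightarrow> ('h list \<Rightarrow>\<^sub>0 'k) set"
  where "multilinear_relations n =
    {Poly_Mapping.single (v @ [a + b] @ w) 1 - Poly_Mapping.single (v @ [a] @ w) 1
        - Poly_Mapping.single (v @ [b] @ w) 1 | v w a b. length v + 1 + length w = n} \<union>
    {Poly_Mapping.single (v @ [c *s a] @ w) 1 - free_scale c (Poly_Mapping.single (v @ [a] @ w) 1)
        | v w a c. length v + 1 + length w = n}"

text \<open>For \<open>n \<ge> 1\<close> every tensor is a sum of pure tensors, scalars being absorbed into a factor. So a
  tensor is represented by the list of its pure summands, and the tensor power is the set of lists of
  words of length \<open>n\<close>, two lists being identified if their formal sums agree modulo the relations.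
  (Only \<open>n \<ge> 1\<close> is used.)\<close>

definition formal_sum :: "'h list list \<Rightarrow> ('h list \<Rightarrow>\<^sub>0 'k)"
  where "formal_sum xs = sum_list [Poly_Mapping.single w 1. w \<leftarrow> xs]"

definition tensor_words :: "nat \<Rightarrow> 'h list list set"
  where "tensor_words n = {xs. \<forall>w \<in> set xs. length w = n}"

definition tensor_rel :: "nat \<Rightarrow> ('h list list \<times> 'h list list) set"
  where "tensor_rel n = {(xs, ys). xs \<in> tensor_words n \<and> ys \<in> tensor_words n \<and>
    formal_sum xs - formal_sum ys \<in> module.span free_scale (multilinear_relations n)}"

definition tensor :: "nat \<Rightarrow> 'h list list \<Rightarrow> 'h list list set"
  where "tensor n xs = tensor_rel n `` {xs}"

text \<open>Sweedler notation, with implicit summation over the components of a tensor \<open>t\<close>, is rendered by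
  list comprehensions over \<open>summands t\<close>. Everything below is multilinear in these components, hence
  independent of the choice made here.\<close>

definition summands :: "'h list list set \<Rightarrow> 'h list list"
  where "summands t = (SOME xs. xs \<in> t)"

text \<open>The algebra \<open>H \<otimes> \<dots> \<otimes> H\<close> (\<open>n\<close> factors). In this ring record the library's symbol \<open>\<otimes>\<close> with a
  subscript denotes the componentwise multiplication of tensors.\<close>

definition tensor_power :: "nat \<Rightarrow> 'h list list set ring" (\<open>\<T>\<close>)
  where "\<T> n =
    \<lparr>carrier = tensor_words n // tensor_rel n,
     monoid.mult = (\<lambda>s t. tensor n [map2 (*) v w. v \<leftarrow> summands s, w \<leftarrow> summands t]),
     one = tensor n [replicate n 1],
     zero = tensor n [],
     add = (\<lambda>s t. tensor n (summands s @ summands t))\<rparr>"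

definition tensor_sum :: "nat \<Rightarrow> 'h list list set list \<Rightarrow> 'h list list set"
  where "tensor_sum n ts = tensor n (concat (map summands ts))"

text \<open>\<open>on_factor n i \<phi>\<close> is \<open>id \<otimes> \<dots> \<otimes> \<phi> \<otimes> \<dots> \<otimes> id\<close> with \<open>\<phi>\<close> acting on the factor with index \<open>i\<close>
  (counted from \<open>0\<close>); \<open>n\<close> is the number of factors of the result.\<close>

definition on_factor ::
  "nat \<Rightarrow> nat \<Rightarrow> ('h \<Rightarrow> 'h list list set) \<Rightarrow> 'h list list set \<Rightarrow> 'h list list set"
  where "on_factor n i \<phi> t =
    tensor n [take i w @ v @ drop (Suc i) w. w \<leftarrow> summands t, v \<leftarrow> summands (\<phi> (w ! i))]"

definition flip :: "'h list list set \<Rightarrow> 'h list list set"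
  where "flip t = tensor 2 [[b, a]. [a, b] \<leftarrow> summands t]"

definition map_both :: "('h \<Rightarrow> 'h) \<Rightarrow> 'h list list set \<Rightarrow> 'h list list set"
  where "map_both \<phi> t = tensor 2 [[\<phi> a, \<phi> b]. [a, b] \<leftarrow> summands t]"

definition inverse_elem :: "'h \<Rightarrow> 'h"
  where "inverse_elem a = (THE b. a * b = 1 \<and> b * a = 1)"

end

section \<open>Quasitriangular quasi-Hopf algebras\<close>

locale quasi_bialgebra = unital_algebra scale
  for scale :: "'k::field \<Rightarrow> 'h::ring_1 \<Rightarrow> 'h" (infixr \<open>*s\<close> 75) +
  fixes \<Delta> :: "'h \<Rightarrow> 'h list list set"
    and \<epsilon> :: "'h \<Rightarrow> 'k"
    and \<Phi> :: "'h list list set"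
  assumes \<Delta>_closed: "\<Delta> h \<in> carrier (\<T> 2)"
    and \<Delta>_add: "\<Delta> (g + h) = \<Delta> g \<oplus>\<^bsub>\<T> 2\<^esub> \<Delta> h"
    and \<Delta>_scale: "\<Delta> (c *s h) = tensor 2 [[c *s a, b]. [a, b] \<leftarrow> summands (\<Delta> h)]"
    and \<Delta>_mult: "\<Delta> (g * h) = \<Delta> g \<otimes>\<^bsub>\<T> 2\<^esub> \<Delta> h"
    and \<Delta>_one: "\<Delta> 1 = \<one>\<^bsub>\<T> 2\<^esub>"
    and \<epsilon>_linear: "Vector_Spaces.linear scale (*) \<epsilon>"
    and \<epsilon>_mult: "\<epsilon> (g * h) = \<epsilon> g * \<epsilon> h"
    and \<epsilon>_one: "\<epsilon> 1 = 1"
    and \<Phi>_unit: "\<Phi> \<in> Units (\<T> 3)"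
    and quasi_coassoc:
      "on_factor 3 1 \<Delta> (\<Delta> h) = \<Phi> \<otimes>\<^bsub>\<T> 3\<^esub> on_factor 3 0 \<Delta> (\<Delta> h) \<otimes>\<^bsub>\<T> 3\<^esub> inv\<^bsub>\<T> 3\<^esub> \<Phi>"
    and counit_right: "sum_list [\<epsilon> b *s a. [a, b] \<leftarrow> summands (\<Delta> h)] = h"
    and counit_left: "sum_list [\<epsilon> a *s b. [a, b] \<leftarrow> summands (\<Delta> h)] = h"
    and pentagon:
      "tensor 4 [1 # w. w \<leftarrow> summands \<Phi>] \<otimes>\<^bsub>\<T> 4\<^esub> on_factor 4 1 \<Delta> \<Phi> \<otimes>\<^bsub>\<T> 4\<^esub> tensor 4 [w @ [1]. w \<leftarrow> summands \<Phi>]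
        = on_factor 4 2 \<Delta> \<Phi> \<otimes>\<^bsub>\<T> 4\<^esub> on_factor 4 0 \<Delta> \<Phi>"
    and counit_\<Phi>: "tensor 2 [[\<epsilon> b *s a, c]. [a, b, c] \<leftarrow> summands \<Phi>] = \<one>\<^bsub>\<T> 2\<^esub>"
begin

abbreviation \<Phi>_inv :: "'h list list set"
  where "\<Phi>_inv \<equiv> inv\<^bsub>\<T> 3\<^esub> \<Phi>"

end

locale quasi_hopf_algebra = quasi_bialgebra scale \<Delta> \<epsilon> \<Phi>
  for scale :: "'k::field \<Rightarrow> 'h::ring_1 \<Rightarrow> 'h" (infixr \<open>*s\<close> 75)
    and \<Delta> :: "'h \<Rightarrow> 'h list list set"
    and \<epsilon> :: "'h \<Rightarrow> 'k"
    and \<Phi> :: "'h list list set" +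
  fixes S :: "'h \<Rightarrow> 'h" and \<alpha> \<beta> :: 'h
  assumes S_linear: "Vector_Spaces.linear scale scale S"
    and S_mult: "S (g * h) = S h * S g"
    and S_one: "S 1 = 1"
    and antipode_\<alpha>: "sum_list [S a * \<alpha> * b. [a, b] \<leftarrow> summands (\<Delta> h)] = \<epsilon> h *s \<alpha>"
    and antipode_\<beta>: "sum_list [a * \<beta> * S b. [a, b] \<leftarrow> summands (\<Delta> h)] = \<epsilon> h *s \<beta>"
    and antipode_\<Phi>: "sum_list [X1 * \<beta> * S X2 * \<alpha> * X3. [X1, X2, X3] \<leftarrow> summands \<Phi>] = 1"
    and antipode_\<Phi>_inv: "sum_list [S x1 * \<alpha> * x2 * \<beta> * S x3. [x1, x2, x3] \<leftarrow> summands \<Phi>_inv] = 1"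
begin

definition \<gamma> :: "'h list list set"
  where "\<gamma> = tensor 2
    [[S (X2 * x12) * \<alpha> * X3 * x2, S (X1 * x11) * \<alpha> * x3].
      [X1, X2, X3] \<leftarrow> summands \<Phi>, [x1, x2, x3] \<leftarrow> summands \<Phi>_inv, [x11, x12] \<leftarrow> summands (\<Delta> x1)]"

definition drinfeld_twist :: "'h list list set"
  where "drinfeld_twist = tensor_sum 2
    [map_both S (flip (\<Delta> x1)) \<otimes>\<^bsub>\<T> 2\<^esub> \<gamma> \<otimes>\<^bsub>\<T> 2\<^esub> \<Delta> (x2 * \<beta> * S x3). [x1, x2, x3] \<leftarrow> summands \<Phi>_inv]"

end

locale quasitriangular_quasi_hopf_algebra = quasi_hopf_algebra scale \<Delta> \<epsilon> \<Phi> S \<alpha> \<beta>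
  for scale :: "'k::field \<Rightarrow> 'h::ring_1 \<Rightarrow> 'h" (infixr \<open>*s\<close> 75)
    and \<Delta> :: "'h \<Rightarrow> 'h list list set"
    and \<epsilon> :: "'h \<Rightarrow> 'k"
    and \<Phi> :: "'h list list set"
    and S :: "'h \<Rightarrow> 'h" and \<alpha> \<beta> :: 'h +
  fixes R :: "'h list list set"
  assumes R_unit: "R \<in> Units (\<T> 2)"
    and R_\<Delta>: "flip (\<Delta> h) \<otimes>\<^bsub>\<T> 2\<^esub> R = R \<otimes>\<^bsub>\<T> 2\<^esub> \<Delta> h"
    and hexagon_left: "on_factor 3 0 \<Delta> R = tensor 3
      [[X2 * R1 * x1 * Y1, X3 * x3 * r1 * Y2, X1 * R2 * x2 * r2 * Y3].
        [X1, X2, X3] \<leftarrow> summands \<Phi>, [R1, R2] \<leftarrow> summands R, [x1, x2, x3] \<leftarrow> summands \<Phi>_inv,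
        [r1, r2] \<leftarrow> summands R, [Y1, Y2, Y3] \<leftarrow> summands \<Phi>]"
    and hexagon_right: "on_factor 3 1 \<Delta> R = tensor 3
      [[x3 * R1 * X2 * r1 * y1, x1 * X1 * r2 * y2, x2 * R2 * X3 * y3].
        [x1, x2, x3] \<leftarrow> summands \<Phi>_inv, [R1, R2] \<leftarrow> summands R, [X1, X2, X3] \<leftarrow> summands \<Phi>,
        [r1, r2] \<leftarrow> summands R, [y1, y2, y3] \<leftarrow> summands \<Phi>_inv]"
    and counit_R_left: "sum_list [\<epsilon> R1 *s R2. [R1, R2] \<leftarrow> summands R] = 1"
    and counit_R_right: "sum_list [\<epsilon> R2 *s R1. [R1, R2] \<leftarrow> summands R] = 1"
begin

definition u :: 'h
  where "u = sum_list [S (R2 * x2 * \<beta> * S x3) * \<alpha> * R1 * x1.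
    [R1, R2] \<leftarrow> summands R, [x1, x2, x3] \<leftarrow> summands \<Phi>_inv]"

definition R_set :: "'h set"
  where "R_set = {l. l ^ 2 = inverse_elem u * S u \<and>
    \<Delta> l = tensor 2 [[l, l]] \<otimes>\<^bsub>\<T> 2\<^esub> map_both S (inv\<^bsub>\<T> 2\<^esub> (flip drinfeld_twist)) \<otimes>\<^bsub>\<T> 2\<^esub> drinfeld_twist \<and>
    (\<forall>h. l * S (S h) = h * l)}"

definition ribbon_elements :: "'h set"
  where "ribbon_elements = {\<nu>. (\<forall>h. \<nu> * h = h * \<nu>) \<and>
    \<Delta> \<nu> = tensor 2 [[\<nu>, \<nu>]] \<otimes>\<^bsub>\<T> 2\<^esub> inv\<^bsub>\<T> 2\<^esub> (flip R \<otimes>\<^bsub>\<T> 2\<^esub> R) \<and>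
    S \<nu> = \<nu> \<and> \<nu> ^ 2 = u * S u}"

end

end

theory Submission
  imports Defs
begin

text \<open>Let \<open>Q = R\<^sub>2\<^sub>1R\<close> and let \<open>f\<close> be the Drinfeld twist. Three facts about \<open>u\<close> carry the theorem: \<open>u\<close> is invertible,
\<open>S\<^sup>2(h) = uhu\<^sup>-\<^sup>1\<close>, and \<open>\<Delta>(u) = f\<^sup>-\<^sup>1 (S \<otimes> S)(f\<^sub>2\<^sub>1) (u \<otimes> u) Q\<^sup>-\<^sup>1\<close> (\<open>\<Delta>_u\<close>). Assume these. The condition
\<open>lS\<^sup>2(h) = hl\<close> says that \<open>lu\<close> is central, and then \<open>ul = lu\<close>. In \<open>\<Delta>(lu) = \<Delta>(l)\<Delta>(u)\<close> the twist factors cancel,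
which turns the condition on \<open>\<Delta>(l)\<close> into the one on \<open>\<Delta>(\<nu>)\<close> for \<open>\<nu> = ul\<close> and back, and \<open>l\<^sup>2 = u\<^sup>-\<^sup>1S(u)\<close>
becomes \<open>\<nu>\<^sup>2 = uS(u)\<close>. Only \<open>S(\<nu>) = \<nu>\<close> is left. It follows from the other conditions: apply
\<open>a \<otimes> b \<mapsto> S(a)\<alpha>b\<close> to \<open>\<Delta>(\<nu>) = (\<nu> \<otimes> \<nu>)Q\<^sup>-\<^sup>1\<close>. The left-hand side gives \<open>\<epsilon>(\<nu>)\<alpha> = \<alpha>\<close>, the right-hand side gives
\<open>S(\<nu>)\<nu>(uS(u))\<^sup>-\<^sup>1\<alpha> = S(\<nu>)\<nu>\<^sup>-\<^sup>1\<alpha>\<close> (\<open>monodromy_cap\<close>), and a central element that fixes \<open>\<alpha>\<close> is \<open>1\<close> because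
\<open>X\<^sup>1\<beta>S(X\<^sup>2)\<alpha>X\<^sup>3 = 1\<close>.

The facts about \<open>f\<close> and \<open>u\<close> have one source: a dual is unique up to a unique isomorphism. In elements,
let \<open>M\<close> be a bilinear expression with \<open>M(h\<^sub>1a, h\<^sub>2b) = \<epsilon>(h)M(a, b)\<close>. Then \<open>M(x\<^sup>1, x\<^sup>2\<beta>S(x\<^sup>3)\<alpha>) = M(1, 1)\<close> and
\<open>M(x\<^sup>1h, x\<^sup>2\<beta>S(x\<^sup>3)) = M(x\<^sup>1, x\<^sup>2\<beta>S(hx\<^sup>3))\<close> (\<open>invariant_form_\<Phi>_inv_\<alpha>\<close>, \<open>invariant_form_\<Phi>_inv_move\<close>). With
\<open>M(a, b) = (S \<otimes> S)(\<Delta>\<^sup>c\<^sup>o\<^sup>p(a))\<gamma>\<Delta>(b)\<close> this yields \<open>f\<Delta>(\<alpha>) = \<gamma>\<close> and \<open>f\<Delta>(S(h)) = (S \<otimes> S)(\<Delta>\<^sup>c\<^sup>o\<^sup>p(h))f\<close>, and with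
\<open>M(a, b) = S(b)S(R\<^sup>2)\<alpha>R\<^sup>1a\<close> it yields \<open>S(\<alpha>)u = S(R\<^sup>2)\<alpha>R\<^sup>1\<close> and \<open>S\<^sup>2(h)u = uh\<close>. The twist is invertible since
\<open>\<gamma>\<close> and its companion \<open>\<delta>\<close> satisfy both snake identities of a dual (\<open>snake_\<Phi>\<close>, \<open>snake_\<Phi>_inv\<close>). For \<open>u\<close>, the crossing
that it contains is undone below the cap \<open>\<alpha>\<close>, which gives a left inverse, and above the cup \<open>\<beta>\<close>, which gives a right
inverse; the second step slides a cup through a crossing (\<open>cup_slides_through_crossing\<close>). The formula for
\<open>\<Delta>(u)\<close> holds because both sides conjugate \<open>\<Delta>(h)\<close> to \<open>\<Delta>(S\<^sup>2(h))\<close> and agree after multiplication by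
\<open>\<Delta>(S(\<alpha>))\<close> from the left, and two such elements are equal (\<open>intertwiners_equal\<close>). The agreement amounts to a braid
identity, \<open>double_crossing_under_caps\<close>.

All identities between tensors are tested by multilinear forms, which separate the points of a tensor
power (\<open>tensor_eqI\<close>). A form \<open>F\<close> has its arguments in labelled slots, and tensors act on forms from the right:
in \<open>F \<lhd> X \<lhd> Y\<close> the arguments are multiplied from the left by the components of the product \<open>XY\<close>. A binary tree whose
leaves are slots prescribes how a component is distributed over several slots by iterated coproducts. So
\<open>assoc A B C\<close> is \<open>\<Phi>\<close> acting on three strands, each of which may be a bundle, and the axioms become the familiar
rules for strings: associators are natural and satisfy the pentagon, braidings are natural and satisfy the
hexagons, and whatever passes over a cap or a cup disappears.\<close>

section \<open>Trees of slots and words of fixed length\<close>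

text \<open>A leaf names one slot of a form; an inner node stands for a coproduct whose two components are sent to the
subtrees.\<close>

datatype 'i tree = Leaf 'i | Node "'i tree" "'i tree" (infix \<open>\<bullet>\<close> 75)

fun leaves :: "'i tree \<Rightarrow> 'i set"
  where
    "leaves (Leaf i) = {i}"
  | "leaves (Node A B) = leaves A \<union> leaves B"

fun distinct_leaves :: "'i tree \<Rightarrow> bool"
  where
    "distinct_leaves (Leaf i) = True"
  | "distinct_leaves (Node A B) \<longleftrightarrow> distinct_leaves A \<and> distinct_leaves B \<and> leaves A \<inter> leaves B = {}"

fun disjoint_trees :: "'i tree list \<Rightarrow> bool"
  where
    "disjoint_trees [] = True"
  | "disjoint_trees (A # As) \<longleftrightarrow>
      distinct_leaves A \<and> (\<forall>B\<in>set As. leaves A \<inter> leaves B = {}) \<and> disjoint_trees As"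

text \<open>Sweedler-style comprehensions match on words of fixed length; on a tensor of that degree the default branch is
never taken.\<close>

lemma comprehension_2:
  assumes "\<And>v. v \<in> set xs \<Longrightarrow> length v = 2"
  shows "concat (map (\<lambda>v. case v of [a, b] \<Rightarrow> g a b | _ \<Rightarrow> []) xs) = concat (map (\<lambda>v. g (v ! 0) (v ! 1)) xs)"
proof -
  have "(case v of [a, b] \<Rightarrow> g a b | _ \<Rightarrow> []) = g (v ! 0) (v ! 1)" if "v \<in> set xs" for v
    using assms[OF that] by (auto simp: length_Suc_conv numeral_2_eq_2)
  then show ?thesis by (metis (no_types, lifting) map_eq_conv)
qed

lemma comprehension_3:
  assumes "\<And>v. v \<in> set xs \<Longrightarrow> length v = 3"
  shows "concat (map (\<lambda>v. case v of [a, b, c] \<Rightarrow> g a b c | _ \<Rightarrow> []) xs)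
    = concat (map (\<lambda>v. g (v ! 0) (v ! 1) (v ! 2)) xs)"
proof -
  have "(case v of [a, b, c] \<Rightarrow> g a b c | _ \<Rightarrow> []) = g (v ! 0) (v ! 1) (v ! 2)" if "v \<in> set xs" for v
    using assms[OF that] by (auto simp: length_Suc_conv numeral_3_eq_3 numeral_2_eq_2)
  then show ?thesis by (metis (no_types, lifting) map_eq_conv)
qed

text \<open>Forms are multilinear in all slots at once, so the slots of a form with four or six arguments are the elements of
a type of that size.\<close>

datatype slot4 = A4 | B4 | C4 | D4

abbreviation "a4 \<equiv> Leaf A4"
abbreviation "b4 \<equiv> Leaf B4"
abbreviation "c4 \<equiv> Leaf C4"
abbreviation "d4 \<equiv> Leaf D4"

datatype slot6 = A6 | B6 | C6 | D6 | E6 | F6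

abbreviation "a6 \<equiv> Leaf A6"
abbreviation "b6 \<equiv> Leaf B6"
abbreviation "c6 \<equiv> Leaf C6"
abbreviation "d6 \<equiv> Leaf D6"
abbreviation "e6 \<equiv> Leaf E6"
abbreviation "f6 \<equiv> Leaf F6"

section \<open>Testing tensors by multilinear forms\<close>

context unital_algebra
begin

definition linform :: "('h \<Rightarrow> 'k) \<Rightarrow> bool"
  where "linform l \<longleftrightarrow> (\<forall>a b. l (a + b) = l a + l b) \<and> (\<forall>c a. l (c *s a) = c * l a)"

definition multiform :: "nat \<Rightarrow> ('h list \<Rightarrow> 'k) \<Rightarrow> bool"
  where "multiform n f \<longleftrightarrow> (\<forall>v w. length v + 1 + length w = n \<longrightarrow> linform (\<lambda>a. f (v @ [a] @ w)))"

definition sweedler :: "'h list list set \<Rightarrow> ('h list \<Rightarrow> 'b::comm_monoid_add) \<Rightarrow> 'b"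
  where "sweedler t f = (\<Sum>v\<leftarrow>summands t. f v)"

lemma linformD:
  assumes "linform l"
  shows "l (a + b) = l a + l b" "l (c *s a) = c * l a"
  using assms by (auto simp: linform_def)

lemma linform_zero: "linform l \<Longrightarrow> l 0 = 0"
  using linformD(2)[of l 0 0] by simp

lemma linform_sum_list: "linform l \<Longrightarrow> l (sum_list xs) = (\<Sum>x\<leftarrow>xs. l x)"
  by (induction xs) (auto simp: linformD linform_zero)

lemma linform_sweedler: "linform l \<Longrightarrow> l (sweedler t f) = sweedler t (\<lambda>v. l (f v))"
  by (simp add: sweedler_def linform_sum_list o_def)

interpretation free: vector_space free_scale
  by (rule vector_space_free_scale)

text \<open>The linear extension of a function on words to the free vector space.\<close>

definition free_extension :: "('h list \<Rightarrow> 'k) \<Rightarrow> ('h list \<Rightarrow>\<^sub>0 'k) \<Rightarrow> 'k"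
  where "free_extension f p = (\<Sum>w\<in>Poly_Mapping.keys p. Poly_Mapping.lookup p w * f w)"

lemma free_extension_superset:
  assumes "finite A" "Poly_Mapping.keys p \<subseteq> A"
  shows "free_extension f p = (\<Sum>w\<in>A. Poly_Mapping.lookup p w * f w)"
  unfolding free_extension_def
  by (rule sum.mono_neutral_left) (use assms in \<open>auto simp: in_keys_iff\<close>)

lemma free_extension_add: "free_extension f (p + q) = free_extension f p + free_extension f q"
proof -
  let ?A = "Poly_Mapping.keys p \<union> Poly_Mapping.keys q"
  have "free_extension f (p + q) = (\<Sum>w\<in>?A. Poly_Mapping.lookup (p + q) w * f w)"
    by (rule free_extension_superset) (auto simp: keys_add)
  also have "\<dots> = (\<Sum>w\<in>?A. Poly_Mapping.lookup p w * f w) + (\<Sum>w\<in>?A. Poly_Mapping.lookup q w * f w)"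
    by (simp add: lookup_add distrib_right sum.distrib)
  also have "\<dots> = free_extension f p + free_extension f q"
    by (simp add: free_extension_superset[of ?A])
  finally show ?thesis .
qed

lemma free_extension_scale: "free_extension f (free_scale c p) = c * free_extension f p"
proof -
  have "free_extension f (free_scale c p)
      = (\<Sum>w\<in>Poly_Mapping.keys p. Poly_Mapping.lookup (free_scale c p) w * f w)"
    by (rule free_extension_superset) (auto simp: in_keys_iff lookup_free_scale)
  then show ?thesis
    by (simp add: free_extension_def lookup_free_scale sum_distrib_left mult.assoc)
qed

lemma free_extension_single: "free_extension f (Poly_Mapping.single w c) = c * f w"
  by (subst free_extension_superset[of "{w}"]) auto

lemma free_extension_diff: "free_extension f (p - q) = free_extension f p - free_extension f q"
  using free_extension_add[of f "p - q" q] by simp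

lemma free_extension_zero: "free_extension f 0 = 0"
  by (simp add: free_extension_def)

lemma free_extension_formal_sum: "free_extension f (formal_sum xs) = (\<Sum>v\<leftarrow>xs. f v)"
  unfolding formal_sum_def
  by (induction xs)
    (simp_all add: free_extension_add free_extension_single free_extension_zero)

lemma free_extension_vanishes:
  assumes "multiform n f" "p \<in> free.span (multilinear_relations n)"
  shows "free_extension f p = 0"
  using assms(2)
proof (induction rule: free.span_induct)
  case base
  show ?case
    by (auto simp: free.subspace_def free_extension_add free_extension_scale free_extension_zero)
next
  case (step p)
  note * = assms(1)[unfolded multiform_def, rule_format]
  from step consider
    (a) v w a b where "length v + 1 + length w = n"
      "p = Poly_Mapping.single (v @ [a + b] @ w) 1 - Poly_Mapping.single (v @ [a] @ w) 1
        - Poly_Mapping.single (v @ [b] @ w) 1"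
    | (b) v w a c where "length v + 1 + length w = n"
      "p = Poly_Mapping.single (v @ [c *s a] @ w) 1
        - free_scale c (Poly_Mapping.single (v @ [a] @ w) 1)"
    unfolding multilinear_relations_def by blast
  then show ?case
  proof cases
    case a
    then show ?thesis using linformD(1)[OF *[OF a(1)], of a b]
      by (simp add: free_extension_diff free_extension_single)
  next
    case b
    then show ?thesis using linformD(2)[OF *[OF b(1)], of c a]
      by (simp add: free_extension_diff free_extension_single free_extension_scale)
  qed
qed

text \<open>Extend a basis of the span of \<open>X\<close> by \<open>p\<close> and prescribe the values on it.\<close>

lemma separating_functional:
  assumes "p \<notin> free.span X"
  obtains g where "Vector_Spaces.linear free_scale ((*) :: 'k \<Rightarrow> 'k \<Rightarrow> 'k) g"
    "\<And>x. x \<in> X \<Longrightarrow> g x = 0" "g p = 1"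
proof -
  interpret pair: vector_space_pair free_scale "(*) :: 'k \<Rightarrow> 'k \<Rightarrow> 'k"
    by unfold_locales (auto simp: algebra_simps)
  obtain B where B: "B \<subseteq> X" "free.independent B" "X \<subseteq> free.span B"
    using free.maximal_independent_subset[of X] by blast
  have sp: "free.span B = free.span X"
    using B by (metis free.span_mono free.span_span subset_antisym)
  have "free.independent (insert p B)"
    using B assms sp by (simp add: free.independent_insert)
  then obtain g where g: "Vector_Spaces.linear free_scale ((*) :: 'k \<Rightarrow> 'k \<Rightarrow> 'k) g"
    "\<forall>x\<in>insert p B. g x = (if x = p then 1 else 0)"
    using pair.linear_independent_extend[of "insert p B" "\<lambda>x. if x = p then 1 else 0"] by blast
  have pB: "p \<notin> B" using assms sp free.span_base by blast
  have "g x = 0" if "x \<in> X" for x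
  proof -
    have x: "x \<in> free.span B" using B that by blast
    show ?thesis
      by (rule pair.linear_eq_0_on_span[OF g(1) _ x]) (use g(2) pB in auto)
  qed
  moreover have "g p = 1" using g(2) by simp
  ultimately show ?thesis using that g(1) by blast
qed

text \<open>Multilinear forms are the linear functionals on the free space that vanish on the relations, so they detect
equality modulo the span of the relations.\<close>

lemma tensor_rel_iff:
  assumes "xs \<in> tensor_words n" "ys \<in> tensor_words n"
  shows "(xs, ys) \<in> tensor_rel n \<longleftrightarrow> (\<forall>f. multiform n f \<longrightarrow> (\<Sum>v\<leftarrow>xs. f v) = (\<Sum>v\<leftarrow>ys. f v))"
proof
  assume "(xs, ys) \<in> tensor_rel n"
  then have *: "formal_sum xs - formal_sum ys \<in> free.span (multilinear_relations n)"
    by (simp add: tensor_rel_def)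
  show "\<forall>f. multiform n f \<longrightarrow> (\<Sum>v\<leftarrow>xs. f v) = (\<Sum>v\<leftarrow>ys. f v)"
    using free_extension_vanishes[OF _ *]
    by (simp add: free_extension_diff free_extension_formal_sum)
next
  assume eq: "\<forall>f. multiform n f \<longrightarrow> (\<Sum>v\<leftarrow>xs. f v) = (\<Sum>v\<leftarrow>ys. f v)"
  show "(xs, ys) \<in> tensor_rel n"
  proof (rule ccontr)
    assume "(xs, ys) \<notin> tensor_rel n"
    then have "formal_sum xs - formal_sum ys \<notin> free.span (multilinear_relations n)"
      using assms by (simp add: tensor_rel_def)
    then obtain g where g: "Vector_Spaces.linear free_scale ((*) :: 'k \<Rightarrow> 'k \<Rightarrow> 'k) g"
      "\<And>x. x \<in> multilinear_relations n \<Longrightarrow> g x = 0" "g (formal_sum xs - formal_sum ys) = 1"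
      by (rule separating_functional) blast
    interpret g: Vector_Spaces.linear free_scale "(*) :: 'k \<Rightarrow> 'k \<Rightarrow> 'k" g
      by (rule g(1))
    let ?f = "\<lambda>w. g (Poly_Mapping.single w 1)"
    have "multiform n ?f"
      unfolding multiform_def linform_def
    proof (intro allI impI conjI)
      fix v w :: "'h list" and a b assume l: "length v + 1 + length w = n"
      have "Poly_Mapping.single (v @ [a + b] @ w) 1 - Poly_Mapping.single (v @ [a] @ w) 1
        - Poly_Mapping.single (v @ [b] @ w) 1 \<in> multilinear_relations n"
        unfolding multilinear_relations_def using l by blast
      from g(2)[OF this] show "?f (v @ [a + b] @ w) = ?f (v @ [a] @ w) + ?f (v @ [b] @ w)"
        by (simp add: g.diff diff_eq_eq add.commute)
    next
      fix v w :: "'h list" and a c assume l: "length v + 1 + length w = n"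
      have "Poly_Mapping.single (v @ [c *s a] @ w) 1
        - free_scale c (Poly_Mapping.single (v @ [a] @ w) 1) \<in> multilinear_relations n"
        unfolding multilinear_relations_def using l by blast
      from g(2)[OF this] show "?f (v @ [c *s a] @ w) = c * ?f (v @ [a] @ w)"
        by (simp add: g.diff g.scale)
    qed
    moreover have "g (formal_sum zs) = (\<Sum>v\<leftarrow>zs. ?f v)" for zs
      unfolding formal_sum_def by (induction zs) (auto simp: g.add g.zero)
    ultimately show False using eq g(3) by (auto simp: g.diff)
  qed
qed

lemma tensor_rel_equiv: "equiv (tensor_words n) (tensor_rel n)"
proof (rule equivI)
  show "refl_on (tensor_words n) (tensor_rel n)"
    by (auto simp: refl_on_def tensor_rel_iff)
  show "tensor_rel n \<subseteq> tensor_words n \<times> tensor_words n"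
    by (auto simp: tensor_rel_def)
  have w: "(xs, ys) \<in> tensor_rel n \<Longrightarrow> xs \<in> tensor_words n \<and> ys \<in> tensor_words n" for xs ys
    by (simp add: tensor_rel_def)
  show "sym (tensor_rel n)"
    by (rule symI) (metis w tensor_rel_iff)
  show "trans (tensor_rel n)"
    by (rule transI) (metis w tensor_rel_iff)
qed

lemma tensor_eq_iff:
  assumes "xs \<in> tensor_words n" "ys \<in> tensor_words n"
  shows "tensor n xs = tensor n ys
    \<longleftrightarrow> (\<forall>f. multiform n f \<longrightarrow> (\<Sum>v\<leftarrow>xs. f v) = (\<Sum>v\<leftarrow>ys. f v))"
  using eq_equiv_class_iff[OF tensor_rel_equiv assms] tensor_rel_iff[OF assms]
  by (simp add: tensor_def)

lemma tensor_carrier [simp]: "xs \<in> tensor_words n \<Longrightarrow> tensor n xs \<in> carrier (\<T> n)"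
  by (simp add: tensor_power_def tensor_def quotientI)

lemma summands_tensor:
  assumes "t \<in> carrier (\<T> n)"
  shows "summands t \<in> tensor_words n" "tensor n (summands t) = t"
proof -
  from assms obtain xs where xs: "xs \<in> tensor_words n" "t = tensor n xs"
    by (auto simp: tensor_power_def tensor_def quotient_def)
  have "xs \<in> t"
    using xs equiv_class_self[OF tensor_rel_equiv] by (simp add: tensor_def)
  then have "summands t \<in> t"
    unfolding summands_def by (rule someI)
  then have "(xs, summands t) \<in> tensor_rel n"
    using xs by (simp add: tensor_def)
  then show "summands t \<in> tensor_words n"
    by (simp add: tensor_rel_def)
  show "tensor n (summands t) = t"
    using equiv_class_eq[OF tensor_rel_equiv \<open>(xs, summands t) \<in> tensor_rel n\<close>] xs
    by (simp add: tensor_def)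
qed

lemma summands_length: "t \<in> carrier (\<T> n) \<Longrightarrow> v \<in> set (summands t) \<Longrightarrow> length v = n"
  using summands_tensor(1) by (auto simp: tensor_words_def)

text \<open>The value of a multilinear form does not depend on the summands that the choice operator picks.\<close>

lemma sweedler_tensor:
  assumes "xs \<in> tensor_words n" "multiform n f"
  shows "sweedler (tensor n xs) f = (\<Sum>v\<leftarrow>xs. f v)"
  using summands_tensor[OF tensor_carrier[OF assms(1)]] assms
  unfolding sweedler_def by (metis tensor_eq_iff)

lemma tensor_eqI:
  assumes "s \<in> carrier (\<T> n)" "t \<in> carrier (\<T> n)"
    and "\<And>f. multiform n f \<Longrightarrow> sweedler s f = sweedler t f"
  shows "s = t"
  using assms summands_tensor[of s n] summands_tensor[of t n] unfolding sweedler_def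
  by (metis tensor_eq_iff)

lemma sweedler_cong:
  assumes "t \<in> carrier (\<T> n)" "\<And>v. length v = n \<Longrightarrow> f v = g v"
  shows "sweedler t f = sweedler t g"
  unfolding sweedler_def using assms summands_length
  by (metis (mono_tags, lifting) map_eq_conv)

lemma linform_linear_comb:
  assumes "\<And>v. v \<in> set xs \<Longrightarrow> linform (f v)"
  shows "linform (\<lambda>a. \<Sum>v\<leftarrow>xs. f v a)"
  using assms by (induction xs) (auto simp: linform_def algebra_simps)

lemma linform_sweedlerI:
  assumes "\<And>v. linform (f v)"
  shows "linform (\<lambda>a. sweedler t (\<lambda>v. f v a))"
  unfolding sweedler_def by (rule linform_linear_comb) (use assms in auto)

lemma sweedler_swap: "sweedler s (\<lambda>v. sweedler t (\<lambda>w. f v w)) = sweedler t (\<lambda>w. sweedler s (\<lambda>v. f v w))"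
proof -
  have "(\<Sum>v\<leftarrow>xs. \<Sum>w\<leftarrow>ys. f v w) = (\<Sum>w\<leftarrow>ys. \<Sum>v\<leftarrow>xs. f v w)" for xs ys
    by (induction xs) (auto simp: sum_list_addf)
  then show ?thesis by (simp add: sweedler_def)
qed

lemma multiformD: "multiform n f \<Longrightarrow> length v + 1 + length w = n \<Longrightarrow> linform (\<lambda>a. f (v @ a # w))"
  by (auto simp: multiform_def)

lemma multiform_mult_left:
  assumes "multiform n f" "length v = n"
  shows "multiform n (\<lambda>w. f (map2 (*) v w))"
  unfolding multiform_def
proof (intro allI impI)
  fix x y :: "'h list" assume l: "length x + 1 + length y = n"
  define v1 v2 b where v: "v1 = take (length x) v" "v2 = drop (Suc (length x)) v" "b = v ! length x"
  have e: "v = v1 @ b # v2" "length v1 = length x" "length v2 = length y"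
    using l assms(2) by (auto simp: v id_take_nth_drop)
  have "linform (\<lambda>a. f (map2 (*) v1 x @ a # map2 (*) v2 y))"
    using multiformD[OF assms(1)] l e by simp
  then have "linform (\<lambda>a. f (map2 (*) v1 x @ (b * a) # map2 (*) v2 y))"
    by (auto simp: linform_def distrib_left scale_mult_right)
  then show "linform (\<lambda>a. f (map2 (*) v (x @ [a] @ y)))"
    using e by simp
qed

lemma multiform_mult_right:
  assumes "multiform n f" "length v = n"
  shows "multiform n (\<lambda>w. f (map2 (*) w v))"
  unfolding multiform_def
proof (intro allI impI)
  fix x y :: "'h list" assume l: "length x + 1 + length y = n"
  define v1 v2 b where v: "v1 = take (length x) v" "v2 = drop (Suc (length x)) v" "b = v ! length x"
  have e: "v = v1 @ b # v2" "length v1 = length x" "length v2 = length y"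
    using l assms(2) by (auto simp: v id_take_nth_drop)
  have "linform (\<lambda>a. f (map2 (*) x v1 @ a # map2 (*) y v2))"
    using multiformD[OF assms(1)] l e by simp
  then have "linform (\<lambda>a. f (map2 (*) x v1 @ (a * b) # map2 (*) y v2))"
    by (auto simp: linform_def distrib_right scale_mult_left)
  then show "linform (\<lambda>a. f (map2 (*) (x @ [a] @ y) v))"
    using e by simp
qed

lemma sum_list_concat_map: "(\<Sum>x\<leftarrow>concat (map g xs). f x) = (\<Sum>y\<leftarrow>xs. \<Sum>x\<leftarrow>g y. f x)"
  by (induction xs) auto

lemma tensor_mult_words:
  assumes "s \<in> carrier (\<T> n)" "t \<in> carrier (\<T> n)"
  shows "[map2 (*) v w. v \<leftarrow> summands s, w \<leftarrow> summands t] \<in> tensor_words n"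
  using assms summands_length by (auto simp: tensor_words_def)

lemma tensor_mult_closed:
  "s \<in> carrier (\<T> n) \<Longrightarrow> t \<in> carrier (\<T> n) \<Longrightarrow> s \<otimes>\<^bsub>\<T> n\<^esub> t \<in> carrier (\<T> n)"
  using tensor_carrier[OF tensor_mult_words] by (simp add: tensor_power_def)

lemma sweedler_mult:
  assumes "s \<in> carrier (\<T> n)" "t \<in> carrier (\<T> n)" "multiform n f"
  shows "sweedler (s \<otimes>\<^bsub>\<T> n\<^esub> t) f = sweedler s (\<lambda>v. sweedler t (\<lambda>w. f (map2 (*) v w)))"
proof -
  have "s \<otimes>\<^bsub>\<T> n\<^esub> t = tensor n [map2 (*) v w. v \<leftarrow> summands s, w \<leftarrow> summands t]"
    by (simp add: tensor_power_def)
  then show ?thesis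
    using sweedler_tensor[OF tensor_mult_words[OF assms(1,2)] assms(3)]
    by (simp add: sum_list_concat_map sweedler_def o_def)
qed

lemma sweedler_one: "multiform n f \<Longrightarrow> sweedler \<one>\<^bsub>\<T> n\<^esub> f = f (replicate n 1)"
  by (simp add: tensor_power_def sweedler_tensor tensor_words_def)

lemma sweedler_add:
  assumes "s \<in> carrier (\<T> n)" "t \<in> carrier (\<T> n)" "multiform n f"
  shows "sweedler (s \<oplus>\<^bsub>\<T> n\<^esub> t) f = sweedler s f + sweedler t f"
proof -
  have "summands s @ summands t \<in> tensor_words n"
    using summands_length assms by (auto simp: tensor_words_def)
  from sweedler_tensor[OF this assms(3)] show ?thesis
    by (simp add: tensor_power_def sweedler_def)
qed

lemma multiform_sweedler_mult:
  assumes "s \<in> carrier (\<T> n)" "multiform n f"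
  shows "multiform n (\<lambda>w. sweedler s (\<lambda>v. f (map2 (*) v w)))"
    "multiform n (\<lambda>w. sweedler s (\<lambda>v. f (map2 (*) w v)))"
  using multiform_mult_left[OF assms(2)] multiform_mult_right[OF assms(2)]
    summands_length[OF assms(1)]
  by (auto simp: multiform_def sweedler_def intro!: linform_linear_comb)

lemma map2_mult_assoc:
  "map2 (*) (map2 (*) u v) w = map2 (*) u (map2 (*) v (w :: 'h list))"
proof (induction u arbitrary: v w)
  case (Cons a u)
  then show ?case by (cases v; cases w) (auto simp: mult.assoc)
qed simp

lemma map2_mult_one:
  "length v = n \<Longrightarrow> map2 (*) v (replicate n 1) = (v :: 'h list)"
  "length v = n \<Longrightarrow> map2 (*) (replicate n 1) v = (v :: 'h list)"
  by (induction v arbitrary: n; force)+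

lemma one_carrier: "\<one>\<^bsub>\<T> n\<^esub> \<in> carrier (\<T> n)"
  using tensor_carrier[of "[replicate n 1]" n] by (simp add: tensor_power_def tensor_words_def)

text \<open>Against a form, a product is a double sum over products of words, so the laws reduce to those of componentwise
multiplication.\<close>

lemma tensor_power_monoid: "monoid (\<T> n)"
proof (rule monoidI)
  show one: "\<one>\<^bsub>\<T> n\<^esub> \<in> carrier (\<T> n)"
    by (rule one_carrier)
  show "x \<otimes>\<^bsub>\<T> n\<^esub> y \<in> carrier (\<T> n)" if "x \<in> carrier (\<T> n)" "y \<in> carrier (\<T> n)" for x y
    using that by (rule tensor_mult_closed)
  show "x \<otimes>\<^bsub>\<T> n\<^esub> y \<otimes>\<^bsub>\<T> n\<^esub> z = x \<otimes>\<^bsub>\<T> n\<^esub> (y \<otimes>\<^bsub>\<T> n\<^esub> z)"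
    if c: "x \<in> carrier (\<T> n)" "y \<in> carrier (\<T> n)" "z \<in> carrier (\<T> n)" for x y z
  proof (rule tensor_eqI)
    fix f :: "'h list \<Rightarrow> 'k" assume f: "multiform n f"
    have "sweedler (x \<otimes>\<^bsub>\<T> n\<^esub> y \<otimes>\<^bsub>\<T> n\<^esub> z) f
      = sweedler x (\<lambda>v. sweedler y (\<lambda>w. sweedler z (\<lambda>u. f (map2 (*) (map2 (*) v w) u))))"
      using c f by (simp add: sweedler_mult tensor_mult_closed multiform_sweedler_mult)
    also have "\<dots> = sweedler x (\<lambda>v. sweedler y (\<lambda>w. sweedler z (\<lambda>u. f (map2 (*) v (map2 (*) w u)))))"
      by (simp only: map2_mult_assoc)
    also have "\<dots> = sweedler (x \<otimes>\<^bsub>\<T> n\<^esub> (y \<otimes>\<^bsub>\<T> n\<^esub> z)) f"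
      unfolding sweedler_mult[OF c(1) tensor_mult_closed[OF c(2,3)] f]
      by (rule sweedler_cong[OF c(1)])
        (simp add: sweedler_mult[OF c(2,3)] multiform_mult_left f)
    finally show "sweedler (x \<otimes>\<^bsub>\<T> n\<^esub> y \<otimes>\<^bsub>\<T> n\<^esub> z) f = sweedler (x \<otimes>\<^bsub>\<T> n\<^esub> (y \<otimes>\<^bsub>\<T> n\<^esub> z)) f" .
  qed (use c in \<open>simp_all add: tensor_mult_closed\<close>)
  show "\<one>\<^bsub>\<T> n\<^esub> \<otimes>\<^bsub>\<T> n\<^esub> x = x" "x \<otimes>\<^bsub>\<T> n\<^esub> \<one>\<^bsub>\<T> n\<^esub> = x" if c: "x \<in> carrier (\<T> n)" for x
  proof -
    show "\<one>\<^bsub>\<T> n\<^esub> \<otimes>\<^bsub>\<T> n\<^esub> x = x"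
    proof (rule tensor_eqI)
      fix f :: "'h list \<Rightarrow> 'k" assume f: "multiform n f"
      have "sweedler (\<one>\<^bsub>\<T> n\<^esub> \<otimes>\<^bsub>\<T> n\<^esub> x) f = sweedler x (\<lambda>w. f (map2 (*) (replicate n 1) w))"
        using c one f by (simp add: sweedler_mult sweedler_swap[of "\<one>\<^bsub>\<T> n\<^esub>" x] sweedler_cong[OF c, of "\<lambda>w. sweedler \<one>\<^bsub>\<T> n\<^esub> (\<lambda>v. f (map2 (*) v w))"] sweedler_one multiform_mult_right)
      then show "sweedler (\<one>\<^bsub>\<T> n\<^esub> \<otimes>\<^bsub>\<T> n\<^esub> x) f = sweedler x f"
        using sweedler_cong[OF c] by (metis (no_types, lifting) map2_mult_one(2))
    qed (use c one in \<open>simp_all add: tensor_mult_closed\<close>)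
    show "x \<otimes>\<^bsub>\<T> n\<^esub> \<one>\<^bsub>\<T> n\<^esub> = x"
    proof (rule tensor_eqI)
      fix f :: "'h list \<Rightarrow> 'k" assume f: "multiform n f"
      have "sweedler (x \<otimes>\<^bsub>\<T> n\<^esub> \<one>\<^bsub>\<T> n\<^esub>) f = sweedler x (\<lambda>v. sweedler \<one>\<^bsub>\<T> n\<^esub> (\<lambda>w. f (map2 (*) v w)))"
        using c one f by (simp add: sweedler_mult)
      also have "\<dots> = sweedler x f"
        by (rule sweedler_cong[OF c]) (simp add: sweedler_one multiform_mult_left f map2_mult_one)
      finally show "sweedler (x \<otimes>\<^bsub>\<T> n\<^esub> \<one>\<^bsub>\<T> n\<^esub>) f = sweedler x f" .
    qed (use c one in \<open>simp_all add: tensor_mult_closed\<close>)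
  qed
qed

section \<open>Forms with labelled slots\<close>

definition multilinear :: "(('i \<Rightarrow> 'h) \<Rightarrow> 'k) \<Rightarrow> bool"
  where "multilinear F \<longleftrightarrow> (\<forall>w i. linform (\<lambda>a. F (w(i := a))))"

text \<open>Written this way, operators on forms appear in the order of the corresponding product of tensors.\<close>

abbreviation (input) apply_on :: "'x \<Rightarrow> ('x \<Rightarrow> 'y) \<Rightarrow> 'y" (infixl \<open>\<lhd>\<close> 55)
  where "F \<lhd> X \<equiv> X F"

lemma linform_mult_arg: "linform l \<Longrightarrow> linform (\<lambda>a. l (b * a))" "linform l \<Longrightarrow> linform (\<lambda>a. l (a * b))"
  by (auto simp: linform_def distrib_left distrib_right scale_mult_left scale_mult_right)

lemma multiform_2I:
  assumes "\<And>b. linform (\<lambda>a. f [a, b])" "\<And>a. linform (\<lambda>b. f [a, b])"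
  shows "multiform 2 f"
  unfolding multiform_def
proof (intro allI impI)
  fix v w :: "'h list" assume "length v + 1 + length w = 2"
  then consider b where "v = []" "w = [b]" | a where "v = [a]" "w = []"
    by (cases v; cases w) auto
  then show "linform (\<lambda>a. f (v @ [a] @ w))"
    by cases (use assms in auto)
qed

lemma sum_comprehension_2:
  assumes "t \<in> carrier (\<T> 2)"
  shows "(\<Sum>x\<leftarrow>concat (map (\<lambda>v. case v of [a, b] \<Rightarrow> g a b | _ \<Rightarrow> []) (summands t)). f x)
      = sweedler t (\<lambda>v. \<Sum>x\<leftarrow>g (v ! 0) (v ! 1). f x)"
    "sum_list (concat (map (\<lambda>v. case v of [a, b] \<Rightarrow> k a b | _ \<Rightarrow> []) (summands t)))
      = sweedler t (\<lambda>v. sum_list (k (v ! 0) (v ! 1)))"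
proof -
  note l = summands_length[OF assms]
  show "(\<Sum>x\<leftarrow>concat (map (\<lambda>v. case v of [a, b] \<Rightarrow> g a b | _ \<Rightarrow> []) (summands t)). f x)
      = sweedler t (\<lambda>v. \<Sum>x\<leftarrow>g (v ! 0) (v ! 1). f x)"
    by (subst comprehension_2) (use l in \<open>simp_all add: sum_list_concat_map sweedler_def\<close>)
  show "sum_list (concat (map (\<lambda>v. case v of [a, b] \<Rightarrow> k a b | _ \<Rightarrow> []) (summands t)))
      = sweedler t (\<lambda>v. sum_list (k (v ! 0) (v ! 1)))"
    by (subst comprehension_2) (use l sum_list_concat_map[of "\<lambda>x. x"] in \<open>simp_all add: sweedler_def\<close>)
qed

lemma sum_comprehension_3:
  assumes "t \<in> carrier (\<T> 3)"
  shows "(\<Sum>x\<leftarrow>concat (map (\<lambda>v. case v of [a, b, c] \<Rightarrow> g a b c | _ \<Rightarrow> []) (summands t)). f x)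
      = sweedler t (\<lambda>v. \<Sum>x\<leftarrow>g (v ! 0) (v ! 1) (v ! 2). f x)"
    "sum_list (concat (map (\<lambda>v. case v of [a, b, c] \<Rightarrow> k a b c | _ \<Rightarrow> []) (summands t)))
      = sweedler t (\<lambda>v. sum_list (k (v ! 0) (v ! 1) (v ! 2)))"
proof -
  note l = summands_length[OF assms]
  show "(\<Sum>x\<leftarrow>concat (map (\<lambda>v. case v of [a, b, c] \<Rightarrow> g a b c | _ \<Rightarrow> []) (summands t)). f x)
      = sweedler t (\<lambda>v. \<Sum>x\<leftarrow>g (v ! 0) (v ! 1) (v ! 2). f x)"
    by (subst comprehension_3) (use l in \<open>simp_all add: sum_list_concat_map sweedler_def\<close>)
  show "sum_list (concat (map (\<lambda>v. case v of [a, b, c] \<Rightarrow> k a b c | _ \<Rightarrow> []) (summands t)))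
      = sweedler t (\<lambda>v. sum_list (k (v ! 0) (v ! 1) (v ! 2)))"
    by (subst comprehension_3) (use l sum_list_concat_map[of "\<lambda>x. x"] in \<open>simp_all add: sweedler_def\<close>)
qed

definition bilinear_form :: "('h \<Rightarrow> 'h \<Rightarrow> 'k) \<Rightarrow> bool"
  where "bilinear_form B \<longleftrightarrow> (\<forall>a. linform (B a)) \<and> (\<forall>b. linform (\<lambda>a. B a b))"

lemma bilinear_formD:
  assumes "bilinear_form B"
  shows "linform (B a)" "linform (\<lambda>a. B a b)"
  using assms by (auto simp: bilinear_form_def)

lemma bilinear_formI:
  assumes "\<And>a. linform (B a)" "\<And>b. linform (\<lambda>a. B a b)"
  shows "bilinear_form B"
  using assms by (auto simp: bilinear_form_def)

lemma multiform_bilinear: "bilinear_form B \<Longrightarrow> multiform 2 (\<lambda>v. B (v ! 0) (v ! 1))"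
  by (rule multiform_2I) (auto simp: bilinear_form_def)

lemma replicate_2: "replicate 2 a = [a, a]"
  by (simp add: numeral_2_eq_2)

lemma linform_scaled: "linform l \<Longrightarrow> linform (\<lambda>a. c * l a)" "linform l \<Longrightarrow> linform (\<lambda>a. l a * c)"
  by (auto simp: linform_def algebra_simps)

lemma sweedler_scale: "sweedler t (\<lambda>v. c * f v) = (c :: 'k) * sweedler t f"
  by (simp add: sweedler_def sum_list_const_mult)

section \<open>Tensors of degree two\<close>

definition eval2 :: "('h \<Rightarrow> 'h \<Rightarrow> 'k) \<Rightarrow> 'h list list set \<Rightarrow> 'k"
  where "eval2 B t = sweedler t (\<lambda>v. B (v ! 0) (v ! 1))"

abbreviation tensor2_mult (infixl \<open>\<star>\<close> 70)
  where "s \<star> t \<equiv> s \<otimes>\<^bsub>\<T> 2\<^esub> t"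

lemma tensor2_eqI:
  assumes "s \<in> carrier (\<T> 2)" "t \<in> carrier (\<T> 2)" "\<And>B. bilinear_form B \<Longrightarrow> eval2 B s = eval2 B t"
  shows "s = t"
proof (rule tensor_eqI[OF assms(1,2)])
  fix f :: "'h list \<Rightarrow> 'k" assume f: "multiform 2 f"
  have "bilinear_form (\<lambda>a b. f [a, b])"
    using multiformD[OF f, of "[]" "[b]" for b] multiformD[OF f, of "[a]" "[]" for a]
    by (auto intro!: bilinear_formI)
  from assms(3)[OF this] have "sweedler s (\<lambda>v. f [v ! 0, v ! 1]) = sweedler t (\<lambda>v. f [v ! 0, v ! 1])"
    by (simp add: eval2_def)
  moreover have "f [v ! 0, v ! 1] = f v" if "length v = 2" for v
    using that by (auto simp: length_Suc_conv numeral_2_eq_2)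
  ultimately show "sweedler s f = sweedler t f"
    using sweedler_cong[OF assms(1), of "\<lambda>v. f [v ! 0, v ! 1]" f] sweedler_cong[OF assms(2), of "\<lambda>v. f [v ! 0, v ! 1]" f]
    by simp
qed

lemma eval2_tensor:
  assumes "bilinear_form B" "xs \<in> tensor_words 2"
  shows "eval2 B (tensor 2 xs) = (\<Sum>v\<leftarrow>xs. B (v ! 0) (v ! 1))"
  unfolding eval2_def by (rule sweedler_tensor[OF assms(2) multiform_bilinear[OF assms(1)]])

lemma eval2_pure [simp]: "bilinear_form B \<Longrightarrow> eval2 B (tensor 2 [[a, b]]) = B a b"
  by (simp add: eval2_tensor tensor_words_def)

lemma eval2_one [simp]: "bilinear_form B \<Longrightarrow> eval2 B \<one>\<^bsub>\<T> 2\<^esub> = B 1 1"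
  unfolding eval2_def by (simp only: sweedler_one[OF multiform_bilinear] replicate_2) simp

lemma bilinear_form_compose:
  assumes "bilinear_form B"
  shows "bilinear_form (\<lambda>a b. B (c * a * d) (e * b * f))"
  using bilinear_formD[OF assms]
  by (intro bilinear_formI) (auto simp: linform_def distrib_left distrib_right scale_mult_left scale_mult_right)

lemma bilinear_form_mult:
  assumes "bilinear_form B"
  shows "bilinear_form (\<lambda>a b. B (c * a) (e * b))" "bilinear_form (\<lambda>a b. B (a * c) (b * e))"
  using bilinear_form_compose[OF assms, of c 1 e 1] bilinear_form_compose[OF assms, of 1 c 1 e] by simp_all

lemma bilinear_form_sweedler: "(\<And>v. bilinear_form (B v)) \<Longrightarrow> bilinear_form (\<lambda>a b. sweedler t (\<lambda>v. B v a b))"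
  by (auto simp: bilinear_form_def intro!: linform_sweedlerI)

lemma bilinear_form_eval2:
  assumes "bilinear_form B"
  shows "bilinear_form (\<lambda>a b. eval2 (\<lambda>c d. B (a * c) (b * d)) t)" "bilinear_form (\<lambda>a b. eval2 (\<lambda>c d. B (c * a) (d * b)) t)"
  unfolding eval2_def using bilinear_form_mult[OF assms] by (auto intro: bilinear_form_sweedler)

lemma eval2_mult:
  assumes "s \<in> carrier (\<T> 2)" "t \<in> carrier (\<T> 2)" "bilinear_form B"
  shows "eval2 B (s \<star> t) = eval2 (\<lambda>a b. eval2 (\<lambda>c d. B (a * c) (b * d)) t) s"
  unfolding eval2_def sweedler_mult[OF assms(1,2) multiform_bilinear[OF assms(3)]]
  by (intro sweedler_cong[OF assms(1)] sweedler_cong[OF assms(2)]) simp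

lemma eval2_mult_right:
  assumes "s \<in> carrier (\<T> 2)" "t \<in> carrier (\<T> 2)" "bilinear_form B"
  shows "eval2 B (s \<star> t) = eval2 (\<lambda>c d. eval2 (\<lambda>a b. B (a * c) (b * d)) s) t"
  unfolding eval2_mult[OF assms] unfolding eval2_def by (rule sweedler_swap)

lemma flip_comprehension:
  assumes "t \<in> carrier (\<T> 2)"
  shows "[[b, a]. [a, b] \<leftarrow> summands t] = map (\<lambda>v. [v ! 1, v ! 0]) (summands t)"
  by (subst comprehension_2) (use summands_length[OF assms] in auto)

lemma flip_closed [simp]: "t \<in> carrier (\<T> 2) \<Longrightarrow> flip t \<in> carrier (\<T> 2)"
  unfolding flip_def by (rule tensor_carrier) (simp add: flip_comprehension tensor_words_def)

lemma eval2_flip [simp]: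
  "t \<in> carrier (\<T> 2) \<Longrightarrow> bilinear_form B \<Longrightarrow> eval2 B (flip t) = eval2 (\<lambda>a b. B b a) t"
  unfolding flip_def flip_comprehension
  by (subst eval2_tensor) (auto simp: tensor_words_def eval2_def sweedler_def o_def)

lemma bilinear_form_flip: "bilinear_form B \<Longrightarrow> bilinear_form (\<lambda>a b. B b a)"
  by (auto simp: bilinear_form_def)

lemma flip_flip: "t \<in> carrier (\<T> 2) \<Longrightarrow> flip (flip t) = t"
  by (rule tensor2_eqI) (auto simp: bilinear_form_flip)

lemma flip_mult:
  "s \<in> carrier (\<T> 2) \<Longrightarrow> t \<in> carrier (\<T> 2) \<Longrightarrow> flip (s \<star> t) = flip s \<star> flip t"
proof -
  interpret T2: monoid "\<T> 2" by (rule tensor_power_monoid)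
  assume c: "s \<in> carrier (\<T> 2)" "t \<in> carrier (\<T> 2)"
  show ?thesis
  proof (rule tensor2_eqI)
    fix B assume B: "bilinear_form B"
    have [simp]: "bilinear_form (\<lambda>a b. eval2 (\<lambda>c d. B (a * d) (b * c)) t)"
      unfolding eval2_def by (intro bilinear_form_sweedler bilinear_form_mult B)
    note [simp] = B bilinear_form_flip[OF B] bilinear_form_eval2[OF B] bilinear_form_mult[OF B] c
    show "eval2 B (flip (s \<star> t)) = eval2 B (flip s \<star> flip t)"
      by (simp add: eval2_mult)
  qed (use c in auto)
qed

lemma flip_one: "flip \<one>\<^bsub>\<T> 2\<^esub> = \<one>\<^bsub>\<T> 2\<^esub>"
  by (rule tensor2_eqI) (auto simp: bilinear_form_flip one_carrier)

definition linear_endo :: "('h \<Rightarrow> 'h) \<Rightarrow> bool"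
  where "linear_endo \<phi> \<longleftrightarrow> (\<forall>a b. \<phi> (a + b) = \<phi> a + \<phi> b) \<and> (\<forall>c a. \<phi> (c *s a) = c *s \<phi> a)"

lemma linform_endo: "linform l \<Longrightarrow> linear_endo \<phi> \<Longrightarrow> linform (\<lambda>a. l (\<phi> a))"
  by (auto simp: linform_def linear_endo_def)

lemma bilinear_form_endo: "bilinear_form B \<Longrightarrow> linear_endo \<phi> \<Longrightarrow> bilinear_form (\<lambda>a b. B (\<phi> a) (\<phi> b))"
  by (simp add: bilinear_form_def linform_def linear_endo_def)

lemma map_both_comprehension:
  assumes "t \<in> carrier (\<T> 2)"
  shows "[[\<phi> a, \<phi> b]. [a, b] \<leftarrow> summands t] = map (\<lambda>v. [\<phi> (v ! 0), \<phi> (v ! 1)]) (summands t)"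
  by (subst comprehension_2) (use summands_length[OF assms] in auto)

lemma map_both_closed [simp]: "t \<in> carrier (\<T> 2) \<Longrightarrow> map_both \<phi> t \<in> carrier (\<T> 2)"
  unfolding map_both_def by (rule tensor_carrier) (simp add: map_both_comprehension tensor_words_def)

lemma eval2_map_both [simp]:
  "t \<in> carrier (\<T> 2) \<Longrightarrow> bilinear_form B \<Longrightarrow> eval2 B (map_both \<phi> t) = eval2 (\<lambda>a b. B (\<phi> a) (\<phi> b)) t"
  unfolding map_both_def map_both_comprehension
  by (subst eval2_tensor) (auto simp: tensor_words_def eval2_def sweedler_def o_def)

text \<open>A nonzero vector extends to a basis, so some linear form takes the value \<open>1\<close> on it.\<close>

lemma linform_separates: "(\<And>l. linform l \<Longrightarrow> l a = l b) \<Longrightarrow> a = b"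
proof -
  assume *: "\<And>l. linform l \<Longrightarrow> l a = l b"
  interpret pair: vector_space_pair scale "(*) :: 'k \<Rightarrow> 'k \<Rightarrow> 'k"
    by unfold_locales (auto simp: algebra_simps)
  show "a = b"
  proof (rule ccontr)
    assume "a \<noteq> b"
    then have "independent {a - b}" by simp
    then obtain g where g: "Vector_Spaces.linear scale ((*) :: 'k \<Rightarrow> 'k \<Rightarrow> 'k) g" "\<forall>x\<in>{a - b}. g x = 1"
      using pair.linear_independent_extend[of "{a - b}" "\<lambda>_. 1"] by blast
    interpret g: Vector_Spaces.linear scale "(*) :: 'k \<Rightarrow> 'k \<Rightarrow> 'k" g by (rule g(1))
    have "linform g" by (auto simp: linform_def g.add g.scale)
    from *[OF this] g(2) show False by (simp add: g.diff)
  qed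
qed

text \<open>Both orders of the sums over the outer factors are stated; each matches one way of reading off a product.\<close>

lemma eval2_sandwich:
  assumes "s \<in> carrier (\<T> 2)" "r \<in> carrier (\<T> 2)" "t \<in> carrier (\<T> 2)" and B: "bilinear_form B"
  shows "eval2 B (s \<star> r \<star> t) = eval2 (\<lambda>p q. eval2 (\<lambda>a b. eval2 (\<lambda>c d. B (a * p * c) (b * q * d)) t) s) r"
    "eval2 B (s \<star> r \<star> t) = eval2 (\<lambda>p q. eval2 (\<lambda>c d. eval2 (\<lambda>a b. B (a * p * c) (b * q * d)) s) t) r"
proof -
  interpret T2: monoid "\<T> 2" by (rule tensor_power_monoid)
  show *: "eval2 B (s \<star> r \<star> t) = eval2 (\<lambda>p q. eval2 (\<lambda>a b. eval2 (\<lambda>c d. B (a * p * c) (b * q * d)) t) s) r"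
    using assms by (simp add: eval2_mult bilinear_form_eval2) (simp add: eval2_def sweedler_swap[of s r])
  show "eval2 B (s \<star> r \<star> t) = eval2 (\<lambda>p q. eval2 (\<lambda>c d. eval2 (\<lambda>a b. B (a * p * c) (b * q * d)) s) t) r"
    unfolding * unfolding eval2_def sweedler_swap[of s t] ..
qed

lemma bilinear_form_sandwich:
  assumes "bilinear_form B"
  shows "bilinear_form (\<lambda>p q. eval2 (\<lambda>a b. eval2 (\<lambda>c d. B (a * p * c) (b * q * d)) t) s)"
  unfolding eval2_def by (intro bilinear_form_sweedler bilinear_form_compose assms)

lemma eval2_tensor_sum:
  assumes "\<And>t. t \<in> set ts \<Longrightarrow> t \<in> carrier (\<T> 2)" "bilinear_form B"
  shows "eval2 B (tensor_sum 2 ts) = (\<Sum>t\<leftarrow>ts. eval2 B t)"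
proof -
  have "concat (map summands ts) \<in> tensor_words 2"
    using assms(1) summands_tensor(1) by (fastforce simp: tensor_words_def)
  then show ?thesis
    unfolding tensor_sum_def
    by (simp add: eval2_tensor assms(2) sum_list_concat_map) (simp add: eval2_def sweedler_def)
qed

lemma tensor_sum_closed:
  assumes "\<And>t. t \<in> set ts \<Longrightarrow> t \<in> carrier (\<T> 2)"
  shows "tensor_sum 2 ts \<in> carrier (\<T> 2)"
proof -
  have "concat (map summands ts) \<in> tensor_words 2"
    using assms(1) summands_tensor(1) by (fastforce simp: tensor_words_def)
  then show ?thesis unfolding tensor_sum_def by (rule tensor_carrier)
qed

end

section \<open>The action of tensors on forms\<close>

context quasi_bialgebra
begin

lemma \<Delta>_length: "v \<in> set (summands (\<Delta> h)) \<Longrightarrow> length v = 2"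
  using summands_length[OF \<Delta>_closed] .

lemma linform_\<Delta>:
  assumes f: "multiform 2 f"
  shows "linform (\<lambda>h. sweedler (\<Delta> h) f)"
  unfolding linform_def
proof (intro conjI allI)
  fix a b show "sweedler (\<Delta> (a + b)) f = sweedler (\<Delta> a) f + sweedler (\<Delta> b) f"
    by (simp add: \<Delta>_add sweedler_add[OF \<Delta>_closed \<Delta>_closed f])
next
  fix c a
  let ?xs = "[[c *s a, b]. [a, b] \<leftarrow> summands (\<Delta> a)]"
  have v: "v = [v ! 0, v ! 1]" if "v \<in> set (summands (\<Delta> a))" for v
    using \<Delta>_length[OF that] by (auto simp: length_Suc_conv numeral_2_eq_2)
  have xs: "?xs = map (\<lambda>v. [c *s (v ! 0), v ! 1]) (summands (\<Delta> a))"
    by (subst comprehension_2) (use \<Delta>_length in auto)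
  have "?xs \<in> tensor_words 2"
    using xs \<Delta>_length by (auto simp: tensor_words_def)
  then have "sweedler (\<Delta> (c *s a)) f = (\<Sum>v\<leftarrow>summands (\<Delta> a). f [c *s (v ! 0), v ! 1])"
    using \<Delta>_length by (simp add: \<Delta>_scale sweedler_tensor[OF _ f] xs o_def)
  also have "\<dots> = (\<Sum>v\<leftarrow>summands (\<Delta> a). c * f v)"
  proof (rule arg_cong[where f = sum_list], rule map_cong[OF refl])
    fix x assume "x \<in> set (summands (\<Delta> a))"
    then have x: "x = [x ! 0, x ! 1]" by (rule v)
    show "f [c *s (x ! 0), x ! 1] = c * f x"
      by (subst (3) x) (use linformD(2)[OF multiformD[OF f, of "[]" "[x ! 1]"]] in simp)
  qed
  also have "\<dots> = c * sweedler (\<Delta> a) f"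
    by (simp add: sweedler_def sum_list_const_mult)
  finally show "sweedler (\<Delta> (c *s a)) f = c * sweedler (\<Delta> a) f" .
qed

text \<open>A leaf multiplies its slot from the left by \<open>h\<close>; a node distributes \<open>h\<^sub>1 \<otimes> h\<^sub>2\<close> over its subtrees.\<close>

fun tree_act :: "'i tree \<Rightarrow> 'h \<Rightarrow> (('i \<Rightarrow> 'h) \<Rightarrow> 'k) \<Rightarrow> ('i \<Rightarrow> 'h) \<Rightarrow> 'k"
  where
    "tree_act (Leaf i) h F = (\<lambda>w. F (w(i := h * w i)))"
  | "tree_act (Node A B) h F =
      (\<lambda>w. sweedler (\<Delta> h) (\<lambda>v. (F \<lhd> tree_act A (v ! 0) \<lhd> tree_act B (v ! 1)) w))"

fun trees_act :: "'i tree list \<Rightarrow> 'h list \<Rightarrow> (('i \<Rightarrow> 'h) \<Rightarrow> 'k) \<Rightarrow> ('i \<Rightarrow> 'h) \<Rightarrow> 'k"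
  where
    "trees_act [] v F = F"
  | "trees_act (A # As) v F = trees_act As (tl v) (tree_act A (hd v) F)"

definition tensor_act :: "'h list list set \<Rightarrow> 'i tree list \<Rightarrow> (('i \<Rightarrow> 'h) \<Rightarrow> 'k) \<Rightarrow> ('i \<Rightarrow> 'h) \<Rightarrow> 'k"
  where "tensor_act t As F = (\<lambda>w. sweedler t (\<lambda>v. trees_act As v F w))"

lemma tree_act_sweedler:
  "tree_act A h (\<lambda>w. sweedler t (\<lambda>v. G v w)) = (\<lambda>w. sweedler t (\<lambda>v. tree_act A h (G v) w))"
proof (induction A arbitrary: h G)
  case (Node A B)
  then show ?case
    by (simp add: Node fun_eq_iff) (subst sweedler_swap, simp)
qed simp

lemma trees_act_sweedler:
  "trees_act As v (\<lambda>w. sweedler t (\<lambda>u. G u w)) = (\<lambda>w. sweedler t (\<lambda>u. trees_act As v (G u) w))"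
  by (induction As arbitrary: v G) (simp_all add: tree_act_sweedler)

lemma tensor_act_sweedler:
  "tensor_act s As (\<lambda>w. sweedler t (\<lambda>u. G u w)) = (\<lambda>w. sweedler t (\<lambda>u. tensor_act s As (G u) w))"
  unfolding tensor_act_def trees_act_sweedler by (subst sweedler_swap) simp

lemma multilinear_sweedler: "(\<And>v. multilinear (G v)) \<Longrightarrow> multilinear (\<lambda>w. sweedler t (\<lambda>v. G v w))"
  unfolding multilinear_def by (auto intro!: linform_sweedlerI)

lemma multilinear_tree_act [simp]: "multilinear F \<Longrightarrow> multilinear (tree_act A h F)"
proof (induction A arbitrary: h F)
  case (Leaf i)
  show ?case
    unfolding multilinear_def
  proof (intro allI)
    fix w j
    show "linform (\<lambda>a. tree_act (Leaf i) h F (w(j := a)))"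
    proof (cases "j = i")
      case True
      have "linform (\<lambda>a. F (w(i := a)))" using Leaf by (simp add: multilinear_def)
      from linform_mult_arg(1)[OF this] show ?thesis using True by simp
    next
      case False
      have "linform (\<lambda>a. F (w(i := h * w i, j := a)))" using Leaf by (simp add: multilinear_def)
      then show ?thesis using False by (simp add: fun_upd_twist)
    qed
  qed
next
  case (Node A B)
  then show ?case by (auto intro!: multilinear_sweedler)
qed

lemma multilinear_trees_act [simp]: "multilinear F \<Longrightarrow> multilinear (trees_act As v F)"
  by (induction As arbitrary: v F) auto

lemma multilinear_tensor_act [simp]: "multilinear F \<Longrightarrow> multilinear (tensor_act t As F)"
  unfolding tensor_act_def by (auto intro!: multilinear_sweedler)

lemma tree_act_add: "tree_act A h (\<lambda>w. F w + G w) = (\<lambda>w. tree_act A h F w + tree_act A h G w)"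
  by (induction A arbitrary: h F G) (simp_all add: sweedler_def sum_list_addf)

lemma tree_act_scale: "tree_act A h (\<lambda>w. c * F w) = (\<lambda>w. c * tree_act A h F w)"
  by (induction A arbitrary: h F) (simp_all add: sweedler_def sum_list_const_mult)

lemma trees_act_add: "trees_act As v (\<lambda>w. F w + G w) = (\<lambda>w. trees_act As v F w + trees_act As v G w)"
  by (induction As arbitrary: v F G) (simp_all add: tree_act_add)

lemma trees_act_scale: "trees_act As v (\<lambda>w. c * F w) = (\<lambda>w. c * trees_act As v F w)"
  by (induction As arbitrary: v F) (simp_all add: tree_act_scale)

lemma tensor_act_scale: "tensor_act t As (\<lambda>w. c * F w) = (\<lambda>w. c * tensor_act t As F w)"
  by (simp add: tensor_act_def trees_act_scale sweedler_def sum_list_const_mult)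

lemma linform_tree_act:
  assumes "multilinear F"
  shows "linform (\<lambda>h. tree_act A h F w)"
  using assms
proof (induction A arbitrary: F w)
  case (Leaf i)
  have "linform (\<lambda>a. F (w(i := a)))" using Leaf by (simp add: multilinear_def)
  from linform_mult_arg(2)[OF this] show ?case by simp
next
  case (Node A B)
  have 1: "tree_act A (a + b) F = (\<lambda>w. tree_act A a F w + tree_act A b F w)"
    "tree_act A (c *s a) F = (\<lambda>w. c * tree_act A a F w)" for a b c
    using linformD[OF Node.IH(1)[OF Node.prems]] by auto
  show ?case unfolding tree_act.simps
    by (intro linform_\<Delta> multiform_2I)
      (use Node in \<open>auto simp: linform_def 1 tree_act_add tree_act_scale linformD[OF Node.IH(2)]\<close>)
qed

lemma tree_act_plus: "multilinear F \<Longrightarrow> tree_act A (a + b) F = (\<lambda>w. tree_act A a F w + tree_act A b F w)"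
  using linformD(1)[OF linform_tree_act] by fast

lemma tree_act_smult: "multilinear F \<Longrightarrow> tree_act A (c *s a) F = (\<lambda>w. c * tree_act A a F w)"
  using linformD(2)[OF linform_tree_act] by fast

lemma multiform_trees_act:
  assumes "multilinear F" "length As = n"
  shows "multiform n (\<lambda>v. trees_act As v F w)"
  unfolding multiform_def
proof (intro allI impI)
  fix x y :: "'h list" assume "length x + 1 + length y = n"
  then show "linform (\<lambda>a. trees_act As (x @ [a] @ y) F w)"
    using assms
  proof (induction As arbitrary: x n F)
    case (Cons A As)
    show ?case
    proof (cases x)
      case Nil
      then show ?thesis using Cons.prems
        by (auto simp: linform_def tree_act_plus tree_act_smult trees_act_add trees_act_scale)
    next
      case [simp]: (Cons b x')
      show ?thesis
        using Cons.prems by (auto intro!: Cons.IH[OF refl, simplified])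
    qed
  qed simp
qed

text \<open>Disjoint trees multiply different slots.\<close>

lemma tree_act_commute:
  assumes "leaves A \<inter> leaves B = {}"
  shows "F \<lhd> tree_act A g \<lhd> tree_act B h = F \<lhd> tree_act B h \<lhd> tree_act A g"
  using assms
proof (induction A arbitrary: g F)
  case (Leaf i)
  then show ?case
  proof (induction B arbitrary: h F)
    case (Leaf j)
    then show ?case by (auto simp: fun_upd_twist)
  next
    case (Node B C)
    have "tree_act (Leaf i) g (\<lambda>w. sweedler (\<Delta> h) (\<lambda>v. G v w))
      = (\<lambda>w. sweedler (\<Delta> h) (\<lambda>v. tree_act (Leaf i) g (G v) w))" for G
      by (rule tree_act_sweedler)
    then show ?case
      using Node by (simp del: tree_act.simps(1))
  qed
next
  case (Node A C)
  then have "leaves A \<inter> leaves B = {}" "leaves C \<inter> leaves B = {}" by auto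
  with Node.IH show ?case by (simp add: tree_act_sweedler)
qed

lemma trees_act_commute:
  assumes "\<forall>A\<in>set As. leaves A \<inter> leaves B = {}"
  shows "F \<lhd> trees_act As v \<lhd> tree_act B h = F \<lhd> tree_act B h \<lhd> trees_act As v"
  using assms by (induction As arbitrary: v F) (auto simp: tree_act_commute)

lemma tensor_act_commute_tree:
  assumes "\<forall>A\<in>set As. leaves A \<inter> leaves B = {}"
  shows "F \<lhd> tensor_act t As \<lhd> tree_act B h = F \<lhd> tree_act B h \<lhd> tensor_act t As"
  unfolding tensor_act_def tree_act_sweedler
  by (simp add: trees_act_commute[OF assms])

lemma tensor_act_commute_trees:
  assumes "\<forall>A\<in>set As. \<forall>B\<in>set Bs. leaves A \<inter> leaves B = {}"
  shows "F \<lhd> tensor_act t As \<lhd> trees_act Bs v = F \<lhd> trees_act Bs v \<lhd> tensor_act t As"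
  using assms
proof (induction Bs arbitrary: v F)
  case (Cons B Bs)
  then show ?case using tensor_act_commute_tree[of As B] by simp
qed simp

lemma tensor_act_commute:
  assumes "\<forall>A\<in>set As. \<forall>B\<in>set Bs. leaves A \<inter> leaves B = {}"
  shows "F \<lhd> tensor_act t As \<lhd> tensor_act s Bs = F \<lhd> tensor_act s Bs \<lhd> tensor_act t As"
proof -
  have "F \<lhd> tensor_act t As \<lhd> tensor_act s Bs
      = (\<lambda>w. sweedler s (\<lambda>v. (F \<lhd> trees_act Bs v \<lhd> tensor_act t As) w))"
    by (simp add: tensor_act_def[of s] tensor_act_commute_trees[OF assms])
  also have "\<dots> = F \<lhd> tensor_act s Bs \<lhd> tensor_act t As"
    by (simp add: tensor_act_def[of s] tensor_act_sweedler)
  finally show ?thesis .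
qed

text \<open>Multiplicativity is proved for lists of trees that are multiplicative themselves; the multiplicativity of single
trees follows by induction, since a node is the action of \<open>\<Delta>(h)\<close> on the list of its two subtrees.\<close>

lemma trees_act_mult_if:
  assumes "\<forall>A\<in>set As. \<forall>F g h. multilinear F \<longrightarrow> F \<lhd> tree_act A g \<lhd> tree_act A h = F \<lhd> tree_act A (g * h)"
    and "disjoint_trees As" "multilinear F" "length v = length As" "length w = length As"
  shows "F \<lhd> trees_act As v \<lhd> trees_act As w = F \<lhd> trees_act As (map2 (*) v w)"
  using assms
proof (induction As arbitrary: v w F)
  case (Cons A As)
  from Cons.prems obtain a v' b w' where vw: "v = a # v'" "w = b # w'"
    by (cases v; cases w) auto
  have c: "\<forall>B\<in>set As. leaves B \<inter> leaves A = {}"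
    using Cons.prems by auto
  show ?case
    using Cons vw by (simp add: trees_act_commute[OF c])
qed simp

lemma tensor_act_mult_if:
  assumes "\<forall>A\<in>set As. \<forall>F g h. multilinear F \<longrightarrow> F \<lhd> tree_act A g \<lhd> tree_act A h = F \<lhd> tree_act A (g * h)"
    and "disjoint_trees As" "multilinear F" "length As = n" "s \<in> carrier (\<T> n)" "t \<in> carrier (\<T> n)"
  shows "F \<lhd> tensor_act s As \<lhd> tensor_act t As = F \<lhd> tensor_act (s \<otimes>\<^bsub>\<T> n\<^esub> t) As"
proof
  fix x
  have "(F \<lhd> tensor_act s As \<lhd> tensor_act t As) x
      = sweedler t (\<lambda>w. sweedler s (\<lambda>v. (F \<lhd> trees_act As v \<lhd> trees_act As w) x))"
    by (simp add: tensor_act_def trees_act_sweedler)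
  also have "\<dots> = sweedler s (\<lambda>v. sweedler t (\<lambda>w. (F \<lhd> trees_act As v \<lhd> trees_act As w) x))"
    by (rule sweedler_swap)
  also have "\<dots> = sweedler s (\<lambda>v. sweedler t (\<lambda>w. (F \<lhd> trees_act As (map2 (*) v w)) x))"
    by (intro sweedler_cong[OF assms(5)] sweedler_cong[OF assms(6)])
      (use trees_act_mult_if[OF assms(1-3)] assms(4) in simp)
  also have "\<dots> = (F \<lhd> tensor_act (s \<otimes>\<^bsub>\<T> n\<^esub> t) As) x"
    by (simp add: tensor_act_def sweedler_mult[OF assms(5,6) multiform_trees_act[OF assms(3,4)]])
  finally show "(F \<lhd> tensor_act s As \<lhd> tensor_act t As) x = (F \<lhd> tensor_act (s \<otimes>\<^bsub>\<T> n\<^esub> t) As) x" .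
qed

lemma tree_act_Node: "tree_act (Node A B) h = tensor_act (\<Delta> h) [A, B]"
proof (intro ext)
  fix F w
  show "tree_act (Node A B) h F w = tensor_act (\<Delta> h) [A, B] F w"
    unfolding tree_act.simps tensor_act_def
    by (rule sweedler_cong[OF \<Delta>_closed]) (auto simp: length_Suc_conv numeral_2_eq_2)
qed

lemma tree_act_mult:
  assumes "distinct_leaves A" "multilinear F"
  shows "F \<lhd> tree_act A g \<lhd> tree_act A h = F \<lhd> tree_act A (g * h)"
  using assms
proof (induction A arbitrary: F g h)
  case (Leaf i)
  then show ?case by (simp add: mult.assoc)
next
  case (Node A B)
  show ?case
    unfolding tree_act_Node \<Delta>_mult
    by (rule tensor_act_mult_if) (use Node \<Delta>_closed in auto)
qed

lemma disjoint_treesD: "disjoint_trees As \<Longrightarrow> A \<in> set As \<Longrightarrow> distinct_leaves A"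
  by (induction As) auto

lemma tensor_act_mult:
  assumes "disjoint_trees As" "multilinear F" "length As = n" "s \<in> carrier (\<T> n)" "t \<in> carrier (\<T> n)"
  shows "F \<lhd> tensor_act s As \<lhd> tensor_act t As = F \<lhd> tensor_act (s \<otimes>\<^bsub>\<T> n\<^esub> t) As"
  using assms disjoint_treesD tree_act_mult by (intro tensor_act_mult_if) blast+

lemma tensor_act_one_if:
  assumes "\<forall>A\<in>set As. \<forall>F. multilinear F \<longrightarrow> tree_act A 1 F = F" "multilinear F" "length As = n"
  shows "tensor_act \<one>\<^bsub>\<T> n\<^esub> As F = F"
proof -
  have "trees_act As (replicate n 1) F = F"
    using assms by (induction As arbitrary: F n) auto
  then show ?thesis
    by (simp add: tensor_act_def sweedler_one[OF multiform_trees_act] assms)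
qed

lemma tree_act_one: "multilinear F \<Longrightarrow> tree_act A 1 F = F"
proof (induction A arbitrary: F)
  case (Node A B)
  show ?case
    unfolding tree_act_Node \<Delta>_one by (rule tensor_act_one_if) (use Node in auto)
qed simp

lemma tensor_act_one: "multilinear F \<Longrightarrow> length As = n \<Longrightarrow> tensor_act \<one>\<^bsub>\<T> n\<^esub> As F = F"
  by (rule tensor_act_one_if) (auto simp: tree_act_one)

lemma tensor_act_inv:
  assumes "disjoint_trees As" "multilinear F" "length As = n" "t \<in> Units (\<T> n)"
  shows "F \<lhd> tensor_act t As \<lhd> tensor_act (inv\<^bsub>\<T> n\<^esub> t) As = F"
    "F \<lhd> tensor_act (inv\<^bsub>\<T> n\<^esub> t) As \<lhd> tensor_act t As = F"
proof -
  interpret monoid "\<T> n" by (rule tensor_power_monoid)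
  have "t \<in> carrier (\<T> n)" "inv\<^bsub>\<T> n\<^esub> t \<in> carrier (\<T> n)"
    using assms(4) by auto
  note * = tensor_act_mult[OF assms(1-3) this] tensor_act_mult[OF assms(1-3) this(2,1)]
  show "F \<lhd> tensor_act t As \<lhd> tensor_act (inv\<^bsub>\<T> n\<^esub> t) As = F"
    "F \<lhd> tensor_act (inv\<^bsub>\<T> n\<^esub> t) As \<lhd> tensor_act t As = F"
    using * assms by (simp_all add: tensor_act_one)
qed

lemma tensor_act_tensor:
  assumes "xs \<in> tensor_words n" "multilinear F" "length As = n"
  shows "tensor_act (tensor n xs) As F = (\<lambda>w. \<Sum>v\<leftarrow>xs. trees_act As v F w)"
  by (simp add: tensor_act_def sweedler_tensor[OF assms(1) multiform_trees_act[OF assms(2,3)]])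

lemma trees_act_append:
  "length v = length As \<Longrightarrow> trees_act (As @ Bs) (v @ w) F = F \<lhd> trees_act As v \<lhd> trees_act Bs w"
proof (induction As arbitrary: v F)
  case (Cons A As)
  then show ?case by (cases v) auto
qed simp

lemma on_factor_\<Delta>_words:
  assumes "t \<in> carrier (\<T> n)" "i < n"
  shows "[take i w @ v @ drop (Suc i) w. w \<leftarrow> summands t, v \<leftarrow> summands (\<Delta> (w ! i))] \<in> tensor_words (Suc n)"
  using assms summands_length[OF assms(1)] \<Delta>_length by (force simp: tensor_words_def)

lemma on_factor_closed:
  assumes "t \<in> carrier (\<T> n)" "i < n"
  shows "on_factor (Suc n) i \<Delta> t \<in> carrier (\<T> (Suc n))"
  unfolding on_factor_def by (rule tensor_carrier[OF on_factor_\<Delta>_words[OF assms]])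

text \<open>Applying the coproduct to a tensor factor is the same as joining two strands into one bundle. This turns the axioms,
which are stated with \<open>on_factor\<close>, into rules for trees.\<close>

lemma tensor_act_on_factor:
  assumes "t \<in> carrier (\<T> n)" "multilinear F" "length As + 1 + length Bs = n" "length As = i"
  shows "tensor_act (on_factor (Suc n) i \<Delta> t) (As @ A # B # Bs) F
    = tensor_act t (As @ (Node A B) # Bs) F"
proof
  fix x
  have "tensor_act (on_factor (Suc n) i \<Delta> t) (As @ A # B # Bs) F x
     = sweedler t (\<lambda>w. sweedler (\<Delta> (w ! i))
          (\<lambda>v. trees_act (As @ [A, B] @ Bs) (take i w @ v @ drop (Suc i) w) F x))"
    unfolding on_factor_def
    by (subst tensor_act_tensor[OF on_factor_\<Delta>_words])
      (use assms in \<open>simp_all add: sum_list_concat_map sweedler_def o_def\<close>)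
  also have "\<dots> = sweedler t (\<lambda>w. trees_act (As @ Node A B # Bs) w F x)"
  proof (rule sweedler_cong[OF assms(1)])
    fix w :: "'h list" assume "length w = n"
    then have w: "w = take i w @ w ! i # drop (Suc i) w" "length (take i w) = length As"
      using assms by (auto simp: id_take_nth_drop)
    have "sweedler (\<Delta> (w ! i)) (\<lambda>v. trees_act (As @ [A, B] @ Bs) (take i w @ v @ drop (Suc i) w) F x)
      = sweedler (\<Delta> (w ! i)) (\<lambda>v. (F \<lhd> trees_act As (take i w) \<lhd> trees_act [A, B] v \<lhd> trees_act Bs (drop (Suc i) w)) x)"
      by (rule sweedler_cong[OF \<Delta>_closed])
        (simp only: trees_act_append w(2) length_Cons list.size numeral_2_eq_2 add_0_left)
    also have "\<dots> = (F \<lhd> trees_act As (take i w) \<lhd> tree_act (Node A B) (w ! i) \<lhd> trees_act Bs (drop (Suc i) w)) x"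
      by (simp only: tree_act_Node tensor_act_def trees_act_sweedler)
    also have "\<dots> = trees_act (As @ Node A B # Bs) w F x"
      using trees_act_append[OF w(2), of "Node A B # Bs" "w ! i # drop (Suc i) w" F] w(1) by simp
    finally show "sweedler (\<Delta> (w ! i)) (\<lambda>v. trees_act (As @ [A, B] @ Bs) (take i w @ v @ drop (Suc i) w) F x)
      = trees_act (As @ Node A B # Bs) w F x" .
  qed
  finally show "tensor_act (on_factor (Suc n) i \<Delta> t) (As @ A # B # Bs) F x
    = tensor_act t (As @ (Node A B) # Bs) F x"
    by (simp add: tensor_act_def)
qed

section \<open>The associator on bundles of strands\<close>

lemma \<Phi>_carrier [simp]: "\<Phi> \<in> carrier (\<T> 3)" "\<Phi>_inv \<in> carrier (\<T> 3)"
proof -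
  interpret monoid "\<T> 3" by (rule tensor_power_monoid)
  show "\<Phi> \<in> carrier (\<T> 3)" "\<Phi>_inv \<in> carrier (\<T> 3)" using \<Phi>_unit by auto
qed

abbreviation assoc :: "'i tree \<Rightarrow> 'i tree \<Rightarrow> 'i tree \<Rightarrow> (('i \<Rightarrow> 'h) \<Rightarrow> 'k) \<Rightarrow> ('i \<Rightarrow> 'h) \<Rightarrow> 'k"
  where "assoc A B C \<equiv> tensor_act \<Phi> [A, B, C]"

abbreviation assoc_inv :: "'i tree \<Rightarrow> 'i tree \<Rightarrow> 'i tree \<Rightarrow> (('i \<Rightarrow> 'h) \<Rightarrow> 'k) \<Rightarrow> ('i \<Rightarrow> 'h) \<Rightarrow> 'k"
  where "assoc_inv A B C \<equiv> tensor_act \<Phi>_inv [A, B, C]"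

lemma tensor_act_3:
  assumes "t \<in> carrier (\<T> 3)"
  shows "tensor_act t [A, B, C] F
    = (\<lambda>w. sweedler t (\<lambda>v. (F \<lhd> tree_act A (v ! 0) \<lhd> tree_act B (v ! 1) \<lhd> tree_act C (v ! 2)) w))"
  unfolding tensor_act_def
  by (rule ext, rule sweedler_cong[OF assms])
    (auto simp: length_Suc_conv numeral_3_eq_3 numeral_2_eq_2)

lemma tensor_act_2:
  assumes "t \<in> carrier (\<T> 2)"
  shows "tensor_act t [A, B] F = (\<lambda>w. sweedler t (\<lambda>v. (F \<lhd> tree_act A (v ! 0) \<lhd> tree_act B (v ! 1)) w))"
  unfolding tensor_act_def
  by (rule ext, rule sweedler_cong[OF assms]) (auto simp: length_Suc_conv numeral_2_eq_2)

lemma assoc_inv [simp]: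
  assumes "multilinear F" "disjoint_trees [A, B, C]"
  shows "F \<lhd> assoc A B C \<lhd> assoc_inv A B C = F"
    "F \<lhd> assoc_inv A B C \<lhd> assoc A B C = F"
  using tensor_act_inv[OF assms(2,1) _ \<Phi>_unit] by simp_all

text \<open>Quasi-coassociativity: the associator re-brackets the bundle through which \<open>h\<close> acts.\<close>

lemma assoc_natural:
  assumes "multilinear F" "disjoint_trees [A, B, C]"
  shows "F \<lhd> tree_act (A \<bullet> (B \<bullet> C)) h \<lhd> assoc A B C = F \<lhd> assoc A B C \<lhd> tree_act ((A \<bullet> B) \<bullet> C) h"
    "F \<lhd> tree_act ((A \<bullet> B) \<bullet> C) h \<lhd> assoc_inv A B C = F \<lhd> assoc_inv A B C \<lhd> tree_act (A \<bullet> (B \<bullet> C)) h"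
proof -
  interpret T3: monoid "\<T> 3" by (rule tensor_power_monoid)
  note inv = tensor_act_inv[OF assms(2) _ _ \<Phi>_unit]
  have c1: "on_factor 3 1 \<Delta> (\<Delta> h) \<in> carrier (\<T> 3)" "on_factor 3 0 \<Delta> (\<Delta> h) \<in> carrier (\<T> 3)"
    using on_factor_closed[OF \<Delta>_closed, of 1] on_factor_closed[OF \<Delta>_closed, of 0] by simp_all
  have l: "tree_act (A \<bullet> (B \<bullet> C)) h G = tensor_act (on_factor 3 1 \<Delta> (\<Delta> h)) [A, B, C] G"
    if "multilinear G" for G
    using tensor_act_on_factor[OF \<Delta>_closed that, of "[A]" "[]" 1 h B C] by (simp only: tree_act_Node) simp
  have r: "tree_act ((A \<bullet> B) \<bullet> C) h G = tensor_act (on_factor 3 0 \<Delta> (\<Delta> h)) [A, B, C] G"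
    if "multilinear G" for G
    using tensor_act_on_factor[OF \<Delta>_closed that, of "[]" "[C]" 0 h A B] by (simp only: tree_act_Node) simp
  have m: "tensor_act s [A, B, C] G \<lhd> tensor_act t [A, B, C] = tensor_act (s \<otimes>\<^bsub>\<T> 3\<^esub> t) [A, B, C] G"
    if "multilinear G" "s \<in> carrier (\<T> 3)" "t \<in> carrier (\<T> 3)" for s t G
    by (rule tensor_act_mult) (use that assms in auto)
  have eq: "on_factor 3 1 \<Delta> (\<Delta> h) \<otimes>\<^bsub>\<T> 3\<^esub> \<Phi> = \<Phi> \<otimes>\<^bsub>\<T> 3\<^esub> on_factor 3 0 \<Delta> (\<Delta> h)"
    unfolding quasi_coassoc using c1 \<Phi>_unit by (simp add: T3.m_assoc)
  have *: "F \<lhd> tree_act (A \<bullet> (B \<bullet> C)) h \<lhd> assoc A B C = F \<lhd> assoc A B C \<lhd> tree_act ((A \<bullet> B) \<bullet> C) h"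
    if "multilinear F" for F
    using that c1 by (simp only: l r m multilinear_tensor_act \<Phi>_carrier eq)
  show "F \<lhd> tree_act (A \<bullet> (B \<bullet> C)) h \<lhd> assoc A B C = F \<lhd> assoc A B C \<lhd> tree_act ((A \<bullet> B) \<bullet> C) h"
    by (rule *[OF assms(1)])
  have "F \<lhd> assoc_inv A B C \<lhd> tree_act (A \<bullet> (B \<bullet> C)) h
    = F \<lhd> assoc_inv A B C \<lhd> tree_act (A \<bullet> (B \<bullet> C)) h \<lhd> assoc A B C \<lhd> assoc_inv A B C"
    using assms by (simp del: tree_act.simps)
  also have "\<dots> = F \<lhd> tree_act ((A \<bullet> B) \<bullet> C) h \<lhd> assoc_inv A B C"
    using assms by (subst *) (simp_all del: tree_act.simps)
  finally show "F \<lhd> tree_act ((A \<bullet> B) \<bullet> C) h \<lhd> assoc_inv A B C = F \<lhd> assoc_inv A B C \<lhd> tree_act (A \<bullet> (B \<bullet> C)) h" ..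
qed

lemma pentagon_act:
  assumes F: "multilinear F" and d: "disjoint_trees [A, B, C, D]"
  shows "F \<lhd> assoc B C D \<lhd> assoc A (B \<bullet> C) D \<lhd> assoc A B C
    = F \<lhd> assoc A B (C \<bullet> D) \<lhd> assoc (A \<bullet> B) C D"
proof -
  interpret T4: monoid "\<T> 4" by (rule tensor_power_monoid)
  have l: "v \<in> set (summands \<Phi>) \<Longrightarrow> length v = 3" for v
    by (rule summands_length[OF \<Phi>_carrier(1)])
  have w1: "[1 # w. w \<leftarrow> summands \<Phi>] \<in> tensor_words 4" "[w @ [1]. w \<leftarrow> summands \<Phi>] \<in> tensor_words 4"
    using l by (auto simp: tensor_words_def)
  have of: "on_factor 4 i \<Delta> \<Phi> \<in> carrier (\<T> 4)" if "i < 3" for i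
    using on_factor_closed[OF \<Phi>_carrier(1) that] by simp
  have 1: "tensor_act (tensor 4 [1 # w. w \<leftarrow> summands \<Phi>]) [A, B, C, D] G = assoc B C D G"
    if "multilinear G" for G
    using that by (subst tensor_act_tensor[OF w1(1)])
      (simp_all add: tree_act_one tensor_act_def[of \<Phi>] sweedler_def o_def)
  have 2: "tensor_act (tensor 4 [w @ [1]. w \<leftarrow> summands \<Phi>]) [A, B, C, D] G = assoc A B C G"
    if "multilinear G" for G
  proof -
    have "trees_act ([A, B, C] @ [D]) (w @ [1]) G = trees_act [A, B, C] w G" if "w \<in> set (summands \<Phi>)" for w
      using l[OF that] \<open>multilinear G\<close> by (subst trees_act_append) (simp_all add: tree_act_one)
    then show ?thesis
      using that by (subst tensor_act_tensor[OF w1(2)])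
        (simp_all add: tensor_act_def[of \<Phi>] sweedler_def o_def cong: map_cong)
  qed
  have 3: "tensor_act (on_factor 4 1 \<Delta> \<Phi>) [A, B, C, D] G = assoc A (B \<bullet> C) D G"
    "tensor_act (on_factor 4 2 \<Delta> \<Phi>) [A, B, C, D] G = assoc A B (C \<bullet> D) G"
    "tensor_act (on_factor 4 0 \<Delta> \<Phi>) [A, B, C, D] G = assoc (A \<bullet> B) C D G"
    if "multilinear G" for G
    using tensor_act_on_factor[OF \<Phi>_carrier(1) that, of "[A]" "[D]" 1 B C]
      tensor_act_on_factor[OF \<Phi>_carrier(1) that, of "[A, B]" "[]" 2 C D]
      tensor_act_on_factor[OF \<Phi>_carrier(1) that, of "[]" "[C, D]" 0 A B] by simp_all
  have m: "tensor_act s [A, B, C, D] G \<lhd> tensor_act t [A, B, C, D] = tensor_act (s \<otimes>\<^bsub>\<T> 4\<^esub> t) [A, B, C, D] G"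
    if "multilinear G" "s \<in> carrier (\<T> 4)" "t \<in> carrier (\<T> 4)" for s t G
    by (rule tensor_act_mult) (use that d in auto)
  show ?thesis
    unfolding 1[OF F, symmetric] 3(2)[OF F, symmetric]
    by (simp only: F multilinear_tensor_act 1[symmetric] 2[symmetric] 3[symmetric] m w1 of tensor_carrier
        T4.m_closed pentagon)
qed

text \<open>An operator that re-brackets a bundle does so inside the arguments of any other tensor.\<close>

lemma tensor_act_natural:
  assumes "\<And>F h. multilinear F \<Longrightarrow> F \<lhd> tree_act A h \<lhd> tensor_act s Cs = F \<lhd> tensor_act s Cs \<lhd> tree_act A' h"
    and "\<forall>B\<in>set As \<union> set Bs. \<forall>C\<in>set Cs. leaves B \<inter> leaves C = {}"
    and "multilinear F" "length As + 1 + length Bs = n" "t \<in> carrier (\<T> n)"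
  shows "F \<lhd> tensor_act t (As @ A # Bs) \<lhd> tensor_act s Cs = F \<lhd> tensor_act s Cs \<lhd> tensor_act t (As @ A' # Bs)"
proof -
  have *: "F \<lhd> trees_act (As @ A # Bs) v \<lhd> tensor_act s Cs = F \<lhd> tensor_act s Cs \<lhd> trees_act (As @ A' # Bs) v"
    if "length v = n" for v
  proof -
    define x a y where xay: "x = take (length As) v" "a = v ! length As" "y = drop (Suc (length As)) v"
    have v: "v = x @ a # y" "length x = length As" "length y = length Bs"
      using that assms(4) by (auto simp: xay id_take_nth_drop)
    have c: "G \<lhd> trees_act As x \<lhd> tensor_act s Cs = G \<lhd> tensor_act s Cs \<lhd> trees_act As x"
      "G \<lhd> trees_act Bs y \<lhd> tensor_act s Cs = G \<lhd> tensor_act s Cs \<lhd> trees_act Bs y" for G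
      by (rule tensor_act_commute_trees[symmetric]; use assms(2) in blast)+
    show ?thesis
      using v by (simp add: trees_act_append c assms)
  qed
  have "F \<lhd> tensor_act t (As @ A # Bs) \<lhd> tensor_act s Cs
    = (\<lambda>w. sweedler t (\<lambda>v. (F \<lhd> trees_act (As @ A # Bs) v \<lhd> tensor_act s Cs) w))"
    by (simp only: tensor_act_def[of t] tensor_act_sweedler)
  also have "\<dots> = F \<lhd> tensor_act s Cs \<lhd> tensor_act t (As @ A' # Bs)"
    unfolding tensor_act_def[of t] by (rule ext, rule sweedler_cong[OF assms(5)]) (simp add: *)
  finally show ?thesis .
qed

section \<open>Invariant forms and the counit\<close>

lemma linform_\<epsilon>: "linform \<epsilon>"
proof -
  interpret Vector_Spaces.linear scale "(*)" \<epsilon> by (rule \<epsilon>_linear)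
  show ?thesis by (auto simp: linform_def add scale)
qed

lemma counit_forms:
  assumes "linform l"
  shows "sweedler (\<Delta> h) (\<lambda>v. \<epsilon> (v ! 1) * l (v ! 0)) = l h"
    "sweedler (\<Delta> h) (\<lambda>v. \<epsilon> (v ! 0) * l (v ! 1)) = l h"
proof -
  have "sweedler (\<Delta> h) (\<lambda>v. \<epsilon> (v ! 1) *s v ! 0) = h" "sweedler (\<Delta> h) (\<lambda>v. \<epsilon> (v ! 0) *s v ! 1) = h"
    using counit_right[of h] counit_left[of h] by (simp_all add: sum_comprehension_2[OF \<Delta>_closed])
  then have "l (sweedler (\<Delta> h) (\<lambda>v. \<epsilon> (v ! 1) *s v ! 0)) = l h" "l (sweedler (\<Delta> h) (\<lambda>v. \<epsilon> (v ! 0) *s v ! 1)) = l h"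
    by simp_all
  then show "sweedler (\<Delta> h) (\<lambda>v. \<epsilon> (v ! 1) * l (v ! 0)) = l h"
    "sweedler (\<Delta> h) (\<lambda>v. \<epsilon> (v ! 0) * l (v ! 1)) = l h"
    by (simp_all add: linform_sweedler[OF assms] linformD(2)[OF assms])
qed

lemma counit_\<Phi>_middle:
  assumes "bilinear_form B"
  shows "sweedler \<Phi> (\<lambda>v. \<epsilon> (v ! 1) * B (v ! 0) (v ! 2)) = B 1 1"
proof -
  have l: "v \<in> set (summands \<Phi>) \<Longrightarrow> length v = 3" for v
    by (rule summands_length[OF \<Phi>_carrier(1)])
  have xs: "[[\<epsilon> b *s a, c]. [a, b, c] \<leftarrow> summands \<Phi>] = map (\<lambda>v. [\<epsilon> (v ! 1) *s v ! 0, v ! 2]) (summands \<Phi>)"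
    by (subst comprehension_3) (use l in auto)
  have w: "map (\<lambda>v. [\<epsilon> (v ! 1) *s v ! 0, v ! 2]) (summands \<Phi>) \<in> tensor_words 2"
    by (auto simp: tensor_words_def)
  have "sweedler \<one>\<^bsub>\<T> 2\<^esub> (\<lambda>v. B (v ! 0) (v ! 1)) = sweedler \<Phi> (\<lambda>v. B (\<epsilon> (v ! 1) *s v ! 0) (v ! 2))"
    unfolding counit_\<Phi>[symmetric] xs
    by (subst sweedler_tensor[OF w multiform_bilinear[OF assms]]) (simp add: sweedler_def o_def)
  then show ?thesis
    unfolding sweedler_one[OF multiform_bilinear[OF assms]]
    by (simp add: linformD(2)[OF bilinear_formD(2)[OF assms]] replicate_2)
qed

text \<open>A form is left invariant under \<open>K\<close> if the bundle \<open>K\<close> ends in a cap: an element that acts on it from the left passes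
to the counit. Likewise for a cup at the slots \<open>i\<close>, \<open>j\<close> and multiplication from the right.\<close>

definition left_invariant :: "'i tree \<Rightarrow> (('i \<Rightarrow> 'h) \<Rightarrow> 'k) \<Rightarrow> bool"
  where "left_invariant K F \<longleftrightarrow> (\<forall>h. F \<lhd> tree_act K h = (\<lambda>w. \<epsilon> h * F w))"

definition right_invariant :: "'i \<Rightarrow> 'i \<Rightarrow> (('i \<Rightarrow> 'h) \<Rightarrow> 'k) \<Rightarrow> bool"
  where "right_invariant i j F \<longleftrightarrow>
    (\<forall>h w. sweedler (\<Delta> h) (\<lambda>v. F (w(i := w i * (v ! 0), j := w j * (v ! 1)))) = \<epsilon> h * F w)"

lemma left_invariantD: "left_invariant K F \<Longrightarrow> tree_act K h F = (\<lambda>w. \<epsilon> h * F w)"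
  by (simp add: left_invariant_def)

lemma left_invariant_tree_act:
  "left_invariant K F \<Longrightarrow> leaves K \<inter> leaves A = {} \<Longrightarrow> left_invariant K (tree_act A h F)"
  unfolding left_invariant_def using tree_act_commute[of A K] by (simp add: tree_act_scale Int_commute)

lemma left_invariant_trees_act:
  "left_invariant K F \<Longrightarrow> \<forall>A\<in>set As. leaves K \<inter> leaves A = {} \<Longrightarrow> left_invariant K (trees_act As v F)"
  by (induction As arbitrary: v F) (auto simp: left_invariant_tree_act)

lemma left_invariant_tensor_act:
  "left_invariant K F \<Longrightarrow> \<forall>A\<in>set As. leaves K \<inter> leaves A = {} \<Longrightarrow> left_invariant K (tensor_act t As F)"
  unfolding left_invariant_def using tensor_act_commute_tree[of As K]
  by (simp add: tensor_act_scale Int_commute)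

lemma left_reduce_left:
  assumes "left_invariant B F" "multilinear F"
  shows "F \<lhd> tree_act (B \<bullet> C) h = F \<lhd> tree_act C h"
  using counit_forms(2)[OF linform_tree_act[OF assms(2), of C]]
  by (simp add: left_invariantD[OF assms(1)] tree_act_scale)

lemma left_reduce_right:
  assumes "left_invariant C F" "multilinear F" "leaves B \<inter> leaves C = {}"
  shows "F \<lhd> tree_act (B \<bullet> C) h = F \<lhd> tree_act B h"
  using counit_forms(1)[OF linform_tree_act[OF assms(2), of B]]
  by (simp add: tree_act_commute[OF assms(3)] left_invariantD[OF assms(1)] tree_act_scale)

lemma left_invariant_Node:
  assumes "left_invariant B F" "left_invariant C F" "multilinear F"
  shows "left_invariant (B \<bullet> C) F"
  unfolding left_invariant_def left_reduce_left[OF assms(1,3)] using left_invariantD[OF assms(2)] by simp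

text \<open>A strand of a bundle that ends in a cap can be dropped from the bundle.\<close>

lemma left_replace:
  assumes "\<And>G h. multilinear G \<Longrightarrow> left_invariant K G \<Longrightarrow> G \<lhd> tree_act T h = G \<lhd> tree_act T' h"
    and "left_invariant K F" "multilinear F" "\<forall>A\<in>set As. leaves K \<inter> leaves A = {}"
    and "t \<in> carrier (\<T> n)" "length As + 1 + length Bs = n"
  shows "F \<lhd> tensor_act t (As @ T # Bs) = F \<lhd> tensor_act t (As @ T' # Bs)"
  unfolding tensor_act_def
proof (rule ext, rule sweedler_cong[OF assms(5)])
  fix x and v :: "'h list" assume "length v = n"
  with assms(6) have v: "v = take (length As) v @ drop (length As) v" "length (take (length As) v) = length As"
    by auto
  have "multilinear (F \<lhd> trees_act As (take (length As) v))" "left_invariant K (F \<lhd> trees_act As (take (length As) v))"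
    using assms by (auto intro: left_invariant_trees_act)
  from assms(1)[OF this]
  show "trees_act (As @ T # Bs) v F x = trees_act (As @ T' # Bs) v F x"
    using trees_act_append[OF v(2), of _ "drop (length As) v" F] v(1) by simp
qed

lemma assoc_middle:
  assumes F: "multilinear F" and inv: "left_invariant B F" and d: "leaves A \<inter> leaves B = {}"
  shows "F \<lhd> assoc A B C = F"
proof
  fix w
  have "bilinear_form (\<lambda>a c. (F \<lhd> tree_act A a \<lhd> tree_act C c) w)"
    using linform_tree_act[of _ C w] F
    by (auto intro!: bilinear_formI simp: linform_def tree_act_plus tree_act_smult tree_act_add tree_act_scale)
  from counit_\<Phi>_middle[OF this] show "(F \<lhd> assoc A B C) w = F w"
    using F by (simp add: tensor_act_3 tree_act_commute[OF d] left_invariantD[OF inv] tree_act_scale tree_act_one)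
qed

lemma assoc_invariant_first:
  assumes "left_invariant A F"
  shows "F \<lhd> assoc A B C
    = (\<lambda>w. sweedler \<Phi> (\<lambda>v. \<epsilon> (v ! 0) * (F \<lhd> tree_act B (v ! 1) \<lhd> tree_act C (v ! 2)) w))"
  by (simp add: tensor_act_3 left_invariantD[OF assms] tree_act_scale)

lemma assoc_invariant_third:
  assumes "left_invariant C F" "leaves A \<inter> leaves C = {}" "leaves B \<inter> leaves C = {}"
  shows "F \<lhd> assoc A B C
    = (\<lambda>w. sweedler \<Phi> (\<lambda>v. \<epsilon> (v ! 2) * (F \<lhd> tree_act A (v ! 0) \<lhd> tree_act B (v ! 1)) w))"
  by (simp add: tensor_act_3 tree_act_commute[OF assms(2)] tree_act_commute[OF assms(3)]
      left_invariantD[OF assms(1)] tree_act_scale)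

text \<open>The axioms only contain the counit in the middle slot of \<open>\<Phi>\<close>. Put the counit into the first two slots of the pentagon:
writing \<open>e\<close> for \<open>(\<epsilon> \<otimes> id \<otimes> id)(\<Phi>)\<close> it becomes \<open>ee = e\<close>, and \<open>e\<close> is invertible.\<close>

lemma counit_\<Phi>_first:
  assumes B: "bilinear_form B"
  shows "sweedler \<Phi> (\<lambda>v. \<epsilon> (v ! 0) * B (v ! 1) (v ! 2)) = B 1 1"
proof -
  define F :: "(slot4 \<Rightarrow> 'h) \<Rightarrow> 'k" where "F = (\<lambda>w. \<epsilon> (w A4) * \<epsilon> (w B4) * B (w C4) (w D4))"
  have F: "multilinear F"
    unfolding multilinear_def
  proof (intro allI)
    fix w i show "linform (\<lambda>a. F (w(i := a)))"
      by (cases i) (use bilinear_formD[OF B] linform_\<epsilon> in \<open>auto simp: F_def mult.assoc intro!: linform_scaled\<close>)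
  qed
  have ab: "left_invariant a4 F" "left_invariant b4 F"
    by (auto simp: left_invariant_def F_def \<epsilon>_mult algebra_simps)
  define G where "G = F \<lhd> assoc a4 c4 d4"
  have G: "multilinear G" "left_invariant b4 G"
    unfolding G_def using F ab by (auto intro!: left_invariant_tensor_act)
  have Gb: "F \<lhd> assoc b4 c4 d4 = G" "F \<lhd> assoc (a4 \<bullet> b4) c4 d4 = G"
    unfolding G_def by (simp_all only: assoc_invariant_first ab left_invariant_Node F)
  have "left_invariant a4 G"
    unfolding Gb(1)[symmetric] using ab by (auto intro!: left_invariant_tensor_act)
  have "G \<lhd> tensor_act \<Phi> ([a4] @ (b4 \<bullet> c4) # [d4]) = G \<lhd> tensor_act \<Phi> ([a4] @ c4 # [d4])"
    by (rule left_replace[where K = b4 and n = 3])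
      (use G in \<open>auto simp del: tree_act.simps simp: left_reduce_left\<close>)
  then have "G \<lhd> assoc a4 (b4 \<bullet> c4) d4 = G \<lhd> assoc a4 c4 d4"
    by simp
  moreover have "left_invariant b4 (G \<lhd> assoc a4 c4 d4)"
    using G by (auto intro!: left_invariant_tensor_act)
  ultimately have "G \<lhd> assoc a4 (b4 \<bullet> c4) d4 \<lhd> assoc a4 b4 c4 = G \<lhd> assoc a4 c4 d4"
    using G by (simp add: assoc_middle)
  moreover have "F \<lhd> assoc b4 c4 d4 \<lhd> assoc a4 (b4 \<bullet> c4) d4 \<lhd> assoc a4 b4 c4
    = F \<lhd> assoc a4 b4 (c4 \<bullet> d4) \<lhd> assoc (a4 \<bullet> b4) c4 d4"
    by (rule pentagon_act[OF F]) auto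
  ultimately have "G \<lhd> assoc a4 c4 d4 = G"
    by (simp add: Gb F ab assoc_middle)
  then have "G \<lhd> assoc a4 c4 d4 \<lhd> assoc_inv a4 c4 d4 = G \<lhd> assoc_inv a4 c4 d4"
    by simp
  then have "F \<lhd> assoc a4 c4 d4 = F"
    using F G by (simp add: G_def)
  then have "(F \<lhd> assoc a4 c4 d4) (\<lambda>_. 1) = F (\<lambda>_. 1)"
    by simp
  then show ?thesis
    by (simp add: assoc_invariant_first ab) (simp add: F_def \<epsilon>_one)
qed

text \<open>As for the first slot, with the counit in the last two slots of the pentagon.\<close>

lemma counit_\<Phi>_third:
  assumes B: "bilinear_form B"
  shows "sweedler \<Phi> (\<lambda>v. \<epsilon> (v ! 2) * B (v ! 0) (v ! 1)) = B 1 1"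
proof -
  define F :: "(slot4 \<Rightarrow> 'h) \<Rightarrow> 'k" where "F = (\<lambda>w. \<epsilon> (w C4) * \<epsilon> (w D4) * B (w A4) (w B4))"
  have F: "multilinear F"
    unfolding multilinear_def
  proof (intro allI)
    fix w i show "linform (\<lambda>a. F (w(i := a)))"
      by (cases i) (use bilinear_formD[OF B] linform_\<epsilon> in \<open>auto simp: F_def mult.assoc intro!: linform_scaled\<close>)
  qed
  have cd: "left_invariant c4 F" "left_invariant d4 F"
    by (auto simp: left_invariant_def F_def \<epsilon>_mult algebra_simps)
  define G where "G = F \<lhd> assoc a4 b4 d4"
  have G: "multilinear G" "left_invariant c4 G"
    unfolding G_def using F cd by (auto intro!: left_invariant_tensor_act)
  have Gb: "F \<lhd> assoc a4 b4 (c4 \<bullet> d4) = G" "F \<lhd> assoc a4 b4 c4 = G"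
    unfolding G_def by (simp_all add: assoc_invariant_third cd left_invariant_Node F)
  have "left_invariant d4 G"
    unfolding Gb(2)[symmetric] using cd by (auto intro!: left_invariant_tensor_act)
  have "F \<lhd> tensor_act \<Phi> ([a4] @ (b4 \<bullet> c4) # [d4]) = F \<lhd> tensor_act \<Phi> ([a4] @ b4 # [d4])"
    by (rule left_replace[where K = c4 and n = 3])
      (use F cd in \<open>auto simp del: tree_act.simps simp: left_reduce_right\<close>)
  then have *: "F \<lhd> assoc a4 (b4 \<bullet> c4) d4 = G"
    by (simp add: G_def)
  have "F \<lhd> assoc b4 c4 d4 \<lhd> assoc a4 (b4 \<bullet> c4) d4 \<lhd> assoc a4 b4 c4
    = F \<lhd> assoc a4 b4 (c4 \<bullet> d4) \<lhd> assoc (a4 \<bullet> b4) c4 d4"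
    by (rule pentagon_act[OF F]) auto
  then have "G \<lhd> assoc a4 b4 c4 = G"
    by (simp add: Gb * F G cd assoc_middle)
  then have "G \<lhd> assoc a4 b4 c4 \<lhd> assoc_inv a4 b4 c4 = G \<lhd> assoc_inv a4 b4 c4"
    by simp
  then have "F \<lhd> assoc a4 b4 c4 = F"
    using F G by (simp add: Gb(2)[symmetric])
  then have "(F \<lhd> assoc a4 b4 c4) (\<lambda>_. 1) = F (\<lambda>_. 1)"
    by simp
  then show ?thesis
    by (simp add: assoc_invariant_third cd) (simp add: F_def \<epsilon>_one)
qed

lemma bilinear_tree_act:
  "multilinear F \<Longrightarrow> bilinear_form (\<lambda>a c. (F \<lhd> tree_act A a \<lhd> tree_act C c) w)"
  using linform_tree_act[of _ C w]
  by (auto intro!: bilinear_formI simp: linform_def tree_act_plus tree_act_smult tree_act_add tree_act_scale)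

text \<open>Naturality with respect to a cap, which maps its bundle to the unit object.\<close>

lemma assoc_absorb:
  assumes "multilinear F" "disjoint_trees [A, B, C]"
    and "left_invariant A F \<or> left_invariant B F \<or> left_invariant C F"
  shows "F \<lhd> assoc A B C = F" "F \<lhd> assoc_inv A B C = F"
proof -
  show *: "F \<lhd> assoc A B C = F"
  proof -
    have "F \<lhd> assoc A B C = F" if "left_invariant A F"
      using counit_\<Phi>_first[OF bilinear_tree_act[OF assms(1)]] assms that
      by (simp add: assoc_invariant_first tree_act_one)
    moreover have "F \<lhd> assoc A B C = F" if "left_invariant C F"
      using counit_\<Phi>_third[OF bilinear_tree_act[OF assms(1)]] assms that
      by (simp add: assoc_invariant_third tree_act_one)
    ultimately show ?thesis
      using assms assoc_middle[of F B A C] by auto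
  qed
  have "F \<lhd> assoc A B C \<lhd> assoc_inv A B C = F"
    by (rule assoc_inv[OF assms(1,2)])
  then show "F \<lhd> assoc_inv A B C = F" by (simp only: *)
qed

text \<open>Multiplications from the left and from the right commute.\<close>

lemma right_invariant_tree_act:
  assumes "right_invariant i j F" "i \<noteq> j"
  shows "right_invariant i j (tree_act A g F)"
  using assms(1)
proof (induction A arbitrary: g F)
  case (Leaf k)
  have *: "(w(i := w i * a, j := w j * b))(k := g * (w(i := w i * a, j := w j * b)) k)
    = (w(k := g * w k))(i := (w(k := g * w k)) i * a, j := (w(k := g * w k)) j * b)" for w a b
    using assms(2) by (auto simp: fun_eq_iff mult.assoc)
  show ?case
    using Leaf unfolding right_invariant_def tree_act.simps * by blast
next
  case (Node A B)
  have IH: "right_invariant i j (F \<lhd> tree_act A a \<lhd> tree_act B b)" for a b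
    using Node by blast
  show ?case
    unfolding right_invariant_def tree_act.simps
  proof (intro allI)
    fix h w
    show "sweedler (\<Delta> h) (\<lambda>v. sweedler (\<Delta> g) (\<lambda>va. tree_act B (va ! 1) (tree_act A (va ! 0) F) (w(i := w i * v ! 0, j := w j * v ! 1))))
      = \<epsilon> h * sweedler (\<Delta> g) (\<lambda>v. tree_act B (v ! 1) (tree_act A (v ! 0) F) w)"
      by (subst sweedler_swap) (use IH in \<open>simp add: right_invariant_def sweedler_scale\<close>)
  qed
qed

lemma right_invariant_trees_act:
  "right_invariant i j F \<Longrightarrow> i \<noteq> j \<Longrightarrow> right_invariant i j (trees_act As v F)"
  by (induction As arbitrary: v F) (auto simp: right_invariant_tree_act)

lemma right_invariant_tensor_act:
  assumes "right_invariant i j F" "i \<noteq> j"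
  shows "right_invariant i j (tensor_act t As F)"
  unfolding right_invariant_def tensor_act_def
proof (intro allI)
  fix h w
  show "sweedler (\<Delta> h) (\<lambda>v. sweedler t (\<lambda>va. trees_act As va F (w(i := w i * v ! 0, j := w j * v ! 1))))
    = \<epsilon> h * sweedler t (\<lambda>v. trees_act As v F w)"
    by (subst sweedler_swap)
      (use right_invariant_trees_act[OF assms] in \<open>simp add: right_invariant_def sweedler_scale\<close>)
qed

text \<open>At the word of ones, multiplication from the left and from the right agree, so a cup absorbs the last operator.\<close>

lemma right_invariantD:
  assumes "right_invariant i j F" "i \<noteq> j"
  shows "(F \<lhd> tree_act (Leaf i \<bullet> Leaf j) h) (\<lambda>_. 1) = \<epsilon> h * F (\<lambda>_. 1)"
  using assms(1)[unfolded right_invariant_def, rule_format, of h "\<lambda>_. 1"] assms(2) by (simp add: fun_upd_twist)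

lemma right_reduce_right:
  assumes "right_invariant i j F" "i \<noteq> j" "multilinear F"
  shows "(F \<lhd> tree_act (A \<bullet> (Leaf i \<bullet> Leaf j)) h) (\<lambda>_. 1) = (F \<lhd> tree_act A h) (\<lambda>_. 1)"
  unfolding tree_act.simps(2)[of A]
  using right_invariantD[OF right_invariant_tree_act[OF assms(1,2)] assms(2)]
    counit_forms(1)[OF linform_tree_act[OF assms(3)]]
  by (simp del: tree_act.simps)

lemma right_reduce_left:
  assumes "right_invariant i j F" "i \<noteq> j" "multilinear F" "i \<notin> leaves A" "j \<notin> leaves A"
  shows "(F \<lhd> tree_act ((Leaf i \<bullet> Leaf j) \<bullet> A) h) (\<lambda>_. 1) = (F \<lhd> tree_act A h) (\<lambda>_. 1)"
proof -
  have d: "leaves (Leaf i \<bullet> Leaf j) \<inter> leaves A = {}" using assms by auto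
  show ?thesis
    unfolding tree_act.simps(2)[of _ A] tree_act_commute[OF d]
    using right_invariantD[OF right_invariant_tree_act[OF assms(1,2)] assms(2)]
      counit_forms(2)[OF linform_tree_act[OF assms(3)]]
    by (simp del: tree_act.simps)
qed

lemma tree_act_past_trees:
  assumes "\<forall>B\<in>set Bs. leaves B \<inter> leaves T = {}"
  shows "F \<lhd> tree_act T h \<lhd> trees_act Bs v = F \<lhd> trees_act Bs v \<lhd> tree_act T h"
  using trees_act_commute[OF assms] by metis

text \<open>The counterpart of \<open>left_replace\<close> for cups.\<close>

lemma right_replace:
  assumes "\<And>G h. multilinear G \<Longrightarrow> right_invariant i j G \<Longrightarrow>
      (G \<lhd> tree_act T h) (\<lambda>_. 1) = (G \<lhd> tree_act T' h) (\<lambda>_. 1)"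
    and "right_invariant i j F" "i \<noteq> j" "multilinear F"
    and "\<forall>B\<in>set Bs. leaves B \<inter> leaves T = {} \<and> leaves B \<inter> leaves T' = {}"
    and "t \<in> carrier (\<T> n)" "length As + 1 + length Bs = n"
  shows "(F \<lhd> tensor_act t (As @ T # Bs)) (\<lambda>_. 1) = (F \<lhd> tensor_act t (As @ T' # Bs)) (\<lambda>_. 1)"
  unfolding tensor_act_def
proof (rule sweedler_cong[OF assms(6)])
  fix v :: "'h list" assume "length v = n"
  with assms(7) have v: "v = take (length As) v @ drop (length As) v" "length (take (length As) v) = length As"
    by auto
  let ?G = "F \<lhd> trees_act As (take (length As) v) \<lhd> trees_act Bs (tl (drop (length As) v))"
  have "multilinear ?G" "right_invariant i j ?G"
    using assms by (auto intro!: right_invariant_trees_act)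
  from assms(1)[OF this, of "hd (drop (length As) v)"]
  show "trees_act (As @ T # Bs) v F (\<lambda>_. 1) = trees_act (As @ T' # Bs) v F (\<lambda>_. 1)"
    using trees_act_append[OF v(2), of _ "drop (length As) v" F] v(1) assms(5)
    by (simp add: tree_act_past_trees)
qed

lemma bilinear_tensor_act:
  assumes "multilinear F"
  shows "bilinear_form (\<lambda>a c. (F \<lhd> tree_act A a \<lhd> tree_act C c \<lhd> tensor_act s Cs) w)"
  unfolding tensor_act_def
proof (rule bilinear_formI)
  fix a b
  show "linform (\<lambda>c. sweedler s (\<lambda>v. trees_act Cs v (tree_act C c (tree_act A a F)) w))"
    using assms by (intro linform_sweedlerI) (simp add: linform_def tree_act_plus tree_act_smult trees_act_add trees_act_scale)
  show "linform (\<lambda>a. sweedler s (\<lambda>v. trees_act Cs v (tree_act C b (tree_act A a F)) w))"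
    using assms by (intro linform_sweedlerI)
      (simp add: linform_def tree_act_plus tree_act_smult tree_act_add tree_act_scale trees_act_add trees_act_scale)
qed

text \<open>A cup also absorbs an associator that is followed by operators on other slots, since the component acting on the cup
can be moved past them.\<close>

lemma assoc_right_absorb_past:
  fixes i j :: 'i
  defines "K \<equiv> Leaf i \<bullet> Leaf j"
  assumes F: "multilinear F" and r: "right_invariant i j F" and d: "disjoint_trees [A, B, C]"
    and K: "A = K \<or> B = K \<or> C = K" and Cs: "\<forall>D\<in>set Cs. leaves D \<inter> leaves K = {}"
  shows "(F \<lhd> assoc A B C \<lhd> tensor_act s Cs) (\<lambda>_. 1) = (F \<lhd> tensor_act s Cs) (\<lambda>_. 1)"
    "(F \<lhd> assoc_inv A B C \<lhd> tensor_act s Cs) (\<lambda>_. 1) = (F \<lhd> tensor_act s Cs) (\<lambda>_. 1)"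
proof -
  have ij: "i \<noteq> j" using K d by (auto simp: K_def)
  have *: "(F \<lhd> assoc A B C \<lhd> tensor_act s Cs) (\<lambda>_. 1) = (F \<lhd> tensor_act s Cs) (\<lambda>_. 1)"
    if F: "multilinear F" and r: "right_invariant i j F" for F
  proof -
    note inv = right_invariantD[OF right_invariant_tensor_act[OF
          right_invariant_tree_act[OF right_invariant_tree_act[OF r ij] ij] ij] ij, folded K_def]
    note past = tensor_act_commute_tree[OF Cs, symmetric]
    from K consider "A = K" | "B = K" | "C = K" by blast
    then show ?thesis
    proof cases
      case 1
      have c: "leaves K \<inter> leaves B = {}" "leaves K \<inter> leaves C = {}" using d 1 by auto
      show ?thesis
        unfolding 1 tensor_act_3[OF \<Phi>_carrier(1)] tensor_act_sweedler
          tree_act_commute[OF c(1)] tree_act_commute[OF c(2)] past inv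
        using counit_\<Phi>_first[OF bilinear_tensor_act[OF F]] F by (simp add: tree_act_one)
    next
      case 2
      have c: "leaves K \<inter> leaves C = {}" using d 2 by auto
      show ?thesis
        unfolding 2 tensor_act_3[OF \<Phi>_carrier(1)] tensor_act_sweedler tree_act_commute[OF c] past inv
        using counit_\<Phi>_middle[OF bilinear_tensor_act[OF F]] F by (simp add: tree_act_one)
    next
      case 3
      show ?thesis
        unfolding 3 tensor_act_3[OF \<Phi>_carrier(1)] tensor_act_sweedler past inv
        using counit_\<Phi>_third[OF bilinear_tensor_act[OF F]] F by (simp add: tree_act_one)
    qed
  qed
  show "(F \<lhd> assoc A B C \<lhd> tensor_act s Cs) (\<lambda>_. 1) = (F \<lhd> tensor_act s Cs) (\<lambda>_. 1)"
    by (rule *[OF F r])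
  have "(F \<lhd> assoc_inv A B C \<lhd> assoc A B C \<lhd> tensor_act s Cs) (\<lambda>_. 1)
      = (F \<lhd> assoc_inv A B C \<lhd> tensor_act s Cs) (\<lambda>_. 1)"
    by (rule *) (use F r ij in \<open>auto intro: right_invariant_tensor_act\<close>)
  then show "(F \<lhd> assoc_inv A B C \<lhd> tensor_act s Cs) (\<lambda>_. 1) = (F \<lhd> tensor_act s Cs) (\<lambda>_. 1)"
    using F d by simp
qed

lemma assoc_right_absorb:
  fixes i j :: 'i
  defines "K \<equiv> Leaf i \<bullet> Leaf j"
  assumes "multilinear F" "right_invariant i j F" "disjoint_trees [A, B, C]" "A = K \<or> B = K \<or> C = K"
  shows "(F \<lhd> assoc A B C) (\<lambda>_. 1) = F (\<lambda>_. 1)" "(F \<lhd> assoc_inv A B C) (\<lambda>_. 1) = F (\<lambda>_. 1)"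
  using assoc_right_absorb_past[OF assms(2-4) assms(5)[unfolded K_def], of "[]" "\<one>\<^bsub>\<T> 0\<^esub>"] assms(2)
  by (simp_all add: tensor_act_one)

lemma \<Delta>_carrier [simp]: "\<Delta> h \<in> carrier (\<T> 2)"
  by (rule \<Delta>_closed)

lemma linform_eval2_\<Delta>: "bilinear_form B \<Longrightarrow> linform (\<lambda>h. eval2 B (\<Delta> h))"
  unfolding eval2_def by (rule linform_\<Delta>[OF multiform_bilinear])

section \<open>Consequences of the pentagon\<close>

lemma assoc_natural_at:
  assumes "multilinear F" "disjoint_trees [A, B, C]" "length As + 1 + length Bs = n" "t \<in> carrier (\<T> n)"
    and "\<forall>D\<in>set As \<union> set Bs. \<forall>E\<in>{A, B, C}. leaves D \<inter> leaves E = {}"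
  shows "F \<lhd> tensor_act t (As @ (A \<bullet> (B \<bullet> C)) # Bs) \<lhd> assoc A B C
      = F \<lhd> assoc A B C \<lhd> tensor_act t (As @ ((A \<bullet> B) \<bullet> C) # Bs)"
    "F \<lhd> tensor_act t (As @ ((A \<bullet> B) \<bullet> C) # Bs) \<lhd> assoc_inv A B C
      = F \<lhd> assoc_inv A B C \<lhd> tensor_act t (As @ (A \<bullet> (B \<bullet> C)) # Bs)"
  by (rule tensor_act_natural[where n = n]; use assms in \<open>auto simp del: tree_act.simps simp: assoc_natural\<close>)+

text \<open>Two composites of associators from \<open>((ab)c)(de)\<close> to \<open>a((b(cd))e)\<close>, and their inverses. They are equal by naturality and
two pentagons, on \<open>a, b, c, de\<close> and on \<open>b, c, d, e\<close>.\<close>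

lemma assoc_coherence:
  assumes F: "multilinear F" and d: "disjoint_trees [a, b, c, d, e]"
  shows "F \<lhd> assoc b c d \<lhd> assoc_inv (b \<bullet> c) d e \<lhd> assoc a (b \<bullet> c) (d \<bullet> e) \<lhd> assoc a b c
    = F \<lhd> assoc_inv b (c \<bullet> d) e \<lhd> assoc a b ((c \<bullet> d) \<bullet> e) \<lhd> assoc_inv c d e \<lhd> assoc (a \<bullet> b) c (d \<bullet> e)"
    "F \<lhd> assoc_inv a b c \<lhd> assoc_inv a (b \<bullet> c) (d \<bullet> e) \<lhd> assoc (b \<bullet> c) d e \<lhd> assoc_inv b c d
    = F \<lhd> assoc_inv (a \<bullet> b) c (d \<bullet> e) \<lhd> assoc c d e \<lhd> assoc_inv a b ((c \<bullet> d) \<bullet> e) \<lhd> assoc b (c \<bullet> d) e"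
proof -
  have dis: "disjoint_trees [a, b, c]" "disjoint_trees [b, c, d]" "disjoint_trees [c, d, e]"
    "disjoint_trees [b \<bullet> c, d, e]" "disjoint_trees [b, c \<bullet> d, e]" "disjoint_trees [b, c, d \<bullet> e]"
    "disjoint_trees [a, b \<bullet> c, d \<bullet> e]" "disjoint_trees [a \<bullet> b, c, d \<bullet> e]" "disjoint_trees [a, b, (c \<bullet> d) \<bullet> e]"
    "disjoint_trees [a, b, c, d \<bullet> e]" "disjoint_trees [b, c, d, e]"
    using d by (auto simp: Int_Un_distrib Int_Un_distrib2)
  have *: "F \<lhd> assoc b c d \<lhd> assoc_inv (b \<bullet> c) d e \<lhd> assoc a (b \<bullet> c) (d \<bullet> e) \<lhd> assoc a b c
    = F \<lhd> assoc_inv b (c \<bullet> d) e \<lhd> assoc a b ((c \<bullet> d) \<bullet> e) \<lhd> assoc_inv c d e \<lhd> assoc (a \<bullet> b) c (d \<bullet> e)"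
    if F: "multilinear F" for F
  proof -
    let ?G = "F \<lhd> assoc_inv b (c \<bullet> d) e \<lhd> assoc_inv c d e"
    have G: "multilinear ?G" using F by simp
    have "F \<lhd> assoc_inv b (c \<bullet> d) e \<lhd> assoc a b ((c \<bullet> d) \<bullet> e) \<lhd> assoc_inv c d e
      = ?G \<lhd> assoc a b (c \<bullet> (d \<bullet> e))"
      using assoc_natural_at(2)[of "F \<lhd> assoc_inv b (c \<bullet> d) e" c d e "[a, b]" "[]" 3 \<Phi>] F d by simp
    then have "F \<lhd> assoc_inv b (c \<bullet> d) e \<lhd> assoc a b ((c \<bullet> d) \<bullet> e) \<lhd> assoc_inv c d e \<lhd> assoc (a \<bullet> b) c (d \<bullet> e)
      = ?G \<lhd> assoc b c (d \<bullet> e) \<lhd> assoc a (b \<bullet> c) (d \<bullet> e) \<lhd> assoc a b c"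
      by (simp only: pentagon_act[OF G dis(10)])
    also have "?G \<lhd> assoc b c (d \<bullet> e) = F \<lhd> assoc b c d \<lhd> assoc_inv (b \<bullet> c) d e"
    proof -
      have "?G \<lhd> assoc b c (d \<bullet> e) \<lhd> assoc (b \<bullet> c) d e = F \<lhd> assoc b c d"
        using F by (simp only: pentagon_act[OF G dis(11), symmetric] assoc_inv dis multilinear_tensor_act)
      then have "?G \<lhd> assoc b c (d \<bullet> e) \<lhd> assoc (b \<bullet> c) d e \<lhd> assoc_inv (b \<bullet> c) d e
        = F \<lhd> assoc b c d \<lhd> assoc_inv (b \<bullet> c) d e" by simp
      then show ?thesis using G by (simp only: assoc_inv dis multilinear_tensor_act)
    qed
    finally show ?thesis ..
  qed
  show "F \<lhd> assoc b c d \<lhd> assoc_inv (b \<bullet> c) d e \<lhd> assoc a (b \<bullet> c) (d \<bullet> e) \<lhd> assoc a b c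
    = F \<lhd> assoc_inv b (c \<bullet> d) e \<lhd> assoc a b ((c \<bullet> d) \<bullet> e) \<lhd> assoc_inv c d e \<lhd> assoc (a \<bullet> b) c (d \<bullet> e)"
    by (rule *[OF F])
  let ?P = "F \<lhd> assoc_inv a b c \<lhd> assoc_inv a (b \<bullet> c) (d \<bullet> e) \<lhd> assoc (b \<bullet> c) d e \<lhd> assoc_inv b c d"
  have P: "multilinear ?P" using F by simp
  have "F = ?P \<lhd> assoc b c d \<lhd> assoc_inv (b \<bullet> c) d e \<lhd> assoc a (b \<bullet> c) (d \<bullet> e) \<lhd> assoc a b c"
    using F by (simp only: assoc_inv dis multilinear_tensor_act)
  also have "\<dots> = ?P \<lhd> assoc_inv b (c \<bullet> d) e \<lhd> assoc a b ((c \<bullet> d) \<bullet> e) \<lhd> assoc_inv c d e \<lhd> assoc (a \<bullet> b) c (d \<bullet> e)"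
    by (rule *[OF P])
  finally have "F \<lhd> assoc_inv (a \<bullet> b) c (d \<bullet> e) \<lhd> assoc c d e \<lhd> assoc_inv a b ((c \<bullet> d) \<bullet> e) \<lhd> assoc b (c \<bullet> d) e
    = ?P \<lhd> assoc_inv b (c \<bullet> d) e \<lhd> assoc a b ((c \<bullet> d) \<bullet> e) \<lhd> assoc_inv c d e \<lhd> assoc (a \<bullet> b) c (d \<bullet> e)
     \<lhd> assoc_inv (a \<bullet> b) c (d \<bullet> e) \<lhd> assoc c d e \<lhd> assoc_inv a b ((c \<bullet> d) \<bullet> e) \<lhd> assoc b (c \<bullet> d) e"
    by simp
  also have "\<dots> = ?P"
    using P by (simp only: assoc_inv dis multilinear_tensor_act)
  finally show "?P = F \<lhd> assoc_inv (a \<bullet> b) c (d \<bullet> e) \<lhd> assoc c d e \<lhd> assoc_inv a b ((c \<bullet> d) \<bullet> e) \<lhd> assoc b (c \<bullet> d) e" ..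
qed

lemma pentagon_variants:
  assumes F: "multilinear F" and d: "disjoint_trees [A, B, C, D]"
  shows "F \<lhd> assoc A B C \<lhd> assoc_inv (A \<bullet> B) C D
      = F \<lhd> assoc_inv A (B \<bullet> C) D \<lhd> assoc_inv B C D \<lhd> assoc A B (C \<bullet> D)"
    "F \<lhd> assoc A (B \<bullet> C) D \<lhd> assoc A B C \<lhd> assoc_inv (A \<bullet> B) C D
      = F \<lhd> assoc_inv B C D \<lhd> assoc A B (C \<bullet> D)"
    "F \<lhd> assoc_inv A B C \<lhd> assoc_inv A (B \<bullet> C) D \<lhd> assoc_inv B C D
      = F \<lhd> assoc_inv (A \<bullet> B) C D \<lhd> assoc_inv A B (C \<bullet> D)"
    "F \<lhd> assoc_inv A B (C \<bullet> D) \<lhd> assoc B C D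
      = F \<lhd> assoc (A \<bullet> B) C D \<lhd> assoc_inv A B C \<lhd> assoc_inv A (B \<bullet> C) D"
proof -
  have dis: "disjoint_trees [A, B, C]" "disjoint_trees [B, C, D]" "disjoint_trees [A \<bullet> B, C, D]"
    "disjoint_trees [A, B \<bullet> C, D]" "disjoint_trees [A, B, C \<bullet> D]"
    using d by (auto simp: Int_Un_distrib Int_Un_distrib2)
  note can = assoc_inv[OF _ dis(1)] assoc_inv[OF _ dis(2)] assoc_inv[OF _ dis(3)]
    assoc_inv[OF _ dis(4)] assoc_inv[OF _ dis(5)]
  show 2: "F \<lhd> assoc A (B \<bullet> C) D \<lhd> assoc A B C \<lhd> assoc_inv (A \<bullet> B) C D
      = F \<lhd> assoc_inv B C D \<lhd> assoc A B (C \<bullet> D)"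
    using pentagon_act[of "F \<lhd> assoc_inv B C D", OF _ d] F
    by (simp only: can multilinear_tensor_act)
  show "F \<lhd> assoc A B C \<lhd> assoc_inv (A \<bullet> B) C D
      = F \<lhd> assoc_inv A (B \<bullet> C) D \<lhd> assoc_inv B C D \<lhd> assoc A B (C \<bullet> D)"
    using pentagon_act[of "F \<lhd> assoc_inv A (B \<bullet> C) D \<lhd> assoc_inv B C D", OF _ d] F
    by (simp only: can multilinear_tensor_act)
  show "F \<lhd> assoc_inv A B (C \<bullet> D) \<lhd> assoc B C D
      = F \<lhd> assoc (A \<bullet> B) C D \<lhd> assoc_inv A B C \<lhd> assoc_inv A (B \<bullet> C) D"
  proof -
    let ?G = "F \<lhd> assoc_inv A B (C \<bullet> D)"
    have "?G \<lhd> assoc B C D = ?G \<lhd> assoc B C D \<lhd> assoc A (B \<bullet> C) D \<lhd> assoc A B C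
      \<lhd> assoc_inv A B C \<lhd> assoc_inv A (B \<bullet> C) D"
      using F by (simp only: can multilinear_tensor_act)
    then show ?thesis
      using F by (simp only: pentagon_act[OF _ d] can multilinear_tensor_act)
  qed
  show "F \<lhd> assoc_inv A B C \<lhd> assoc_inv A (B \<bullet> C) D \<lhd> assoc_inv B C D
      = F \<lhd> assoc_inv (A \<bullet> B) C D \<lhd> assoc_inv A B (C \<bullet> D)"
  proof -
    let ?G = "F \<lhd> assoc_inv A B C \<lhd> assoc_inv A (B \<bullet> C) D \<lhd> assoc_inv B C D"
    have "?G = ?G \<lhd> assoc A B (C \<bullet> D) \<lhd> assoc (A \<bullet> B) C D
      \<lhd> assoc_inv (A \<bullet> B) C D \<lhd> assoc_inv A B (C \<bullet> D)"
      using F by (simp only: can multilinear_tensor_act)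
    also have "?G \<lhd> assoc A B (C \<bullet> D) \<lhd> assoc (A \<bullet> B) C D = F"
      using F by (simp only: pentagon_act[OF _ d, symmetric] can multilinear_tensor_act)
    finally show ?thesis .
  qed
qed

text \<open>Exchanging the tensor factors exchanges the strands.\<close>

lemma tensor_act_flip:
  assumes t: "t \<in> carrier (\<T> 2)" and F: "multilinear F" and d: "leaves A \<inter> leaves B = {}"
  shows "tensor_act (flip t) [A, B] F = tensor_act t [B, A] F"
proof -
  have "map (\<lambda>v. [v ! 1, v ! 0]) (summands t) \<in> tensor_words 2"
    by (auto simp: tensor_words_def)
  from tensor_act_tensor[OF this F, of "[A, B]"] show ?thesis
    unfolding flip_def flip_comprehension[OF t] tensor_act_2[OF t]
    by (simp add: sweedler_def o_def tree_act_commute[OF d])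
qed

end

section \<open>Antipode and invariant forms\<close>

context quasi_hopf_algebra
begin

interpretation T2: monoid "\<T> 2"
  by (rule tensor_power_monoid)

lemma S_endo: "linear_endo S"
proof -
  interpret Vector_Spaces.linear scale scale S by (rule S_linear)
  show ?thesis by (auto simp: linear_endo_def add scale)
qed

lemma S_add: "S (a + b) = S a + S b" and S_scale: "S (c *s a) = c *s S a"
  using S_endo by (auto simp: linear_endo_def)

lemmas linear_simps = linform_def bilinear_form_def distrib_left distrib_right scale_mult_left scale_mult_right
  S_add S_scale

lemma antipode_\<alpha>_form: "linform l \<Longrightarrow> sweedler (\<Delta> h) (\<lambda>v. l (S (v ! 0) * \<alpha> * v ! 1)) = \<epsilon> h * l \<alpha>"
  using arg_cong[OF antipode_\<alpha>[of h], of l]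
  by (simp add: sum_comprehension_2[OF \<Delta>_closed] linform_sweedler linformD(2))

lemma antipode_\<beta>_form: "linform l \<Longrightarrow> sweedler (\<Delta> h) (\<lambda>v. l (v ! 0 * \<beta> * S (v ! 1))) = \<epsilon> h * l \<beta>"
  using arg_cong[OF antipode_\<beta>[of h], of l]
  by (simp add: sum_comprehension_2[OF \<Delta>_closed] linform_sweedler linformD(2))

lemma antipode_\<Phi>_form: "linform l \<Longrightarrow> sweedler \<Phi> (\<lambda>v. l (v ! 0 * \<beta> * S (v ! 1) * \<alpha> * v ! 2)) = l 1"
  using arg_cong[OF antipode_\<Phi>, of l]
  by (simp add: sum_comprehension_3[OF \<Phi>_carrier(1)] linform_sweedler)

lemma antipode_\<Phi>_inv_form: "linform l \<Longrightarrow> sweedler \<Phi>_inv (\<lambda>v. l (S (v ! 0) * \<alpha> * v ! 1 * \<beta> * S (v ! 2))) = l 1"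
  using arg_cong[OF antipode_\<Phi>_inv, of l]
  by (simp add: sum_comprehension_3[OF \<Phi>_carrier(2)] linform_sweedler)

text \<open>Such an \<open>M\<close> is a second candidate for the evaluation of a dual, next to \<open>S(a)\<alpha>b\<close>.\<close>

definition invariant_form :: "('h \<Rightarrow> 'h \<Rightarrow> 'k) \<Rightarrow> bool"
  where "invariant_form M \<longleftrightarrow> bilinear_form M \<and>
    (\<forall>h a b. sweedler (\<Delta> h) (\<lambda>v. M (v ! 0 * a) (v ! 1 * b)) = \<epsilon> h * M a b)"

lemma linform_middle: "linform l \<Longrightarrow> linform (\<lambda>a. l (x * a * y))"
  by (auto simp: linform_def distrib_left distrib_right scale_mult_left scale_mult_right)

text \<open>The comparison \<open>x\<^sup>1 \<otimes> x\<^sup>2\<beta>S(x\<^sup>3)\<close> of the candidate \<open>M\<close> with the given dual carries the evaluation \<open>S(a)\<alpha>b\<close> to \<open>M\<close>.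
In the pentagon for \<open>a\<^sub>4, b\<^sub>4, c\<^sub>4, d\<^sub>4\<close> all factors but two are absorbed: \<open>M\<close> is a cap on the first two slots, \<open>\<alpha>\<close> one on
the last two, and \<open>\<beta>\<close> is a cup in the middle.\<close>

lemma invariant_form_\<Phi>_inv_\<alpha>:
  assumes "invariant_form M"
  shows "sweedler \<Phi>_inv (\<lambda>v. M (v ! 0) (v ! 1 * \<beta> * S (v ! 2) * \<alpha>)) = M 1 1"
proof -
  have M: "bilinear_form M" "\<And>h a b. sweedler (\<Delta> h) (\<lambda>v. M (v ! 0 * a) (v ! 1 * b)) = \<epsilon> h * M a b"
    using assms by (auto simp: invariant_form_def)
  define F :: "(slot4 \<Rightarrow> 'h) \<Rightarrow> 'k" where "F = (\<lambda>w. M (w A4) (w B4 * \<beta> * S (w C4) * \<alpha> * w D4))"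
  have F: "multilinear F"
    unfolding multilinear_def
  proof (intro allI)
    fix w i show "linform (\<lambda>a. F (w(i := a)))"
      using bilinear_formD[OF M(1)]
      by (cases i) (auto simp: F_def linear_simps)
  qed
  have ab: "left_invariant (a4 \<bullet> b4) F"
    using M(2)[of _ "w A4" "w B4 * \<beta> * S (w C4) * \<alpha> * w D4" for w]
    by (simp add: left_invariant_def F_def fun_eq_iff mult.assoc)
  have cd: "left_invariant (c4 \<bullet> d4) F"
    using antipode_\<alpha>_form[of "\<lambda>a. M (w A4) ((w B4 * \<beta> * S (w C4)) * a * w D4)" for w,
        OF linform_middle[OF bilinear_formD(1)[OF M(1)]]]
    by (simp add: left_invariant_def F_def fun_eq_iff mult.assoc S_mult)
  have bc: "right_invariant B4 C4 F"
    using antipode_\<beta>_form[of "\<lambda>a. M (w A4) (w B4 * a * (S (w C4) * \<alpha> * w D4))" for w,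
        OF linform_middle[OF bilinear_formD(1)[OF M(1)]]]
    by (simp add: right_invariant_def F_def fun_eq_iff mult.assoc S_mult)
  let ?G = "F \<lhd> assoc_inv a4 b4 (c4 \<bullet> d4)"
  have "?G \<lhd> assoc b4 c4 d4 \<lhd> assoc a4 (b4 \<bullet> c4) d4 \<lhd> assoc a4 b4 c4
    = ?G \<lhd> assoc a4 b4 (c4 \<bullet> d4) \<lhd> assoc (a4 \<bullet> b4) c4 d4"
    by (rule pentagon_act) (use F in auto)
  also have "?G \<lhd> assoc a4 b4 (c4 \<bullet> d4) = F"
    using F by simp
  also have "F \<lhd> assoc (a4 \<bullet> b4) c4 d4 = F"
    by (rule assoc_absorb) (use F ab in auto)
  also have "?G = F"
    by (rule assoc_absorb) (use F cd in auto)
  finally have "F \<lhd> assoc_inv a4 b4 c4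
    = F \<lhd> assoc b4 c4 d4 \<lhd> assoc a4 (b4 \<bullet> c4) d4 \<lhd> assoc a4 b4 c4 \<lhd> assoc_inv a4 b4 c4"
    by simp
  also have "\<dots> = F \<lhd> assoc b4 c4 d4 \<lhd> assoc a4 (b4 \<bullet> c4) d4"
    by (rule assoc_inv) (use F in auto)
  finally have "(F \<lhd> assoc_inv a4 b4 c4) (\<lambda>_. 1) = (F \<lhd> assoc b4 c4 d4 \<lhd> assoc a4 (b4 \<bullet> c4) d4) (\<lambda>_. 1)"
    by simp
  also have "\<dots> = (F \<lhd> assoc b4 c4 d4) (\<lambda>_. 1)"
    by (rule assoc_right_absorb) (use F bc in \<open>auto intro: right_invariant_tensor_act\<close>)
  also have "\<dots> = M 1 1"
    using antipode_\<Phi>_form[OF bilinear_formD(1)[OF M(1)], of 1]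
    by (simp add: tensor_act_3) (simp add: F_def)
  finally show ?thesis
    by (simp add: tensor_act_3) (simp add: F_def)
qed

text \<open>The comparison intertwines the two antipodes. Let \<open>h\<close> act on the bundle \<open>(a\<^sub>4b\<^sub>4)c\<^sub>4\<close>: the cap reduces this to the third slot;
after re-bracketing to \<open>a\<^sub>4(b\<^sub>4c\<^sub>4)\<close> the cup reduces it to the first one.\<close>

lemma invariant_form_\<Phi>_inv_move:
  assumes "invariant_form M"
  shows "sweedler \<Phi>_inv (\<lambda>v. M (v ! 0 * h) (v ! 1 * \<beta> * S (v ! 2)))
    = sweedler \<Phi>_inv (\<lambda>v. M (v ! 0) (v ! 1 * \<beta> * S (h * v ! 2)))"
proof -
  have M: "bilinear_form M" "\<And>h a b. sweedler (\<Delta> h) (\<lambda>v. M (v ! 0 * a) (v ! 1 * b)) = \<epsilon> h * M a b"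
    using assms by (auto simp: invariant_form_def)
  define F :: "(slot4 \<Rightarrow> 'h) \<Rightarrow> 'k" where "F = (\<lambda>w. M (w A4) (w B4 * \<beta> * S (w C4) * w D4))"
  have F: "multilinear F"
    unfolding multilinear_def
  proof (intro allI)
    fix w i show "linform (\<lambda>a. F (w(i := a)))"
      using bilinear_formD[OF M(1)]
      by (cases i) (auto simp: F_def linear_simps)
  qed
  have ab: "left_invariant (a4 \<bullet> b4) F"
    using M(2)[of _ "w A4" "w B4 * \<beta> * S (w C4) * w D4" for w]
    by (simp add: left_invariant_def F_def fun_eq_iff mult.assoc)
  have bc: "right_invariant B4 C4 F"
    using antipode_\<beta>_form[of "\<lambda>a. M (w A4) (w B4 * a * (S (w C4) * w D4))" for w,
        OF linform_middle[OF bilinear_formD(1)[OF M(1)]]]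
    by (simp add: right_invariant_def F_def fun_eq_iff mult.assoc S_mult)
  have "F \<lhd> tree_act c4 h \<lhd> assoc_inv a4 b4 c4 = F \<lhd> tree_act ((a4 \<bullet> b4) \<bullet> c4) h \<lhd> assoc_inv a4 b4 c4"
    using left_reduce_left[OF ab F, of c4 h] by simp
  also have "\<dots> = F \<lhd> assoc_inv a4 b4 c4 \<lhd> tree_act (a4 \<bullet> (b4 \<bullet> c4)) h"
    by (rule assoc_natural) (use F in auto)
  finally have "(F \<lhd> tree_act c4 h \<lhd> assoc_inv a4 b4 c4) (\<lambda>_. 1)
    = (F \<lhd> assoc_inv a4 b4 c4 \<lhd> tree_act (a4 \<bullet> (b4 \<bullet> c4)) h) (\<lambda>_. 1)"
    by simp
  also have "\<dots> = (F \<lhd> assoc_inv a4 b4 c4 \<lhd> tree_act a4 h) (\<lambda>_. 1)"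
    by (rule right_reduce_right) (use F bc in \<open>auto intro: right_invariant_tensor_act\<close>)
  finally show ?thesis
    by (simp add: tensor_act_3) (simp add: F_def)
qed

section \<open>The Drinfeld twist\<close>

definition cop_antipode :: "'h \<Rightarrow> 'h list list set"
  where "cop_antipode h = map_both S (flip (\<Delta> h))"

lemma cop_antipode_closed [simp]: "cop_antipode h \<in> carrier (\<T> 2)"
  by (simp add: cop_antipode_def)

lemma eval2_cop_antipode:
  "bilinear_form B \<Longrightarrow> eval2 B (cop_antipode h) = eval2 (\<lambda>a b. B (S b) (S a)) (\<Delta> h)"
  by (simp add: cop_antipode_def bilinear_form_endo S_endo)

lemma map_both_S_mult:
  assumes "s \<in> carrier (\<T> 2)" "t \<in> carrier (\<T> 2)"
  shows "map_both S (s \<star> t) = map_both S t \<star> map_both S s"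
proof (rule tensor2_eqI)
  fix B assume B: "bilinear_form B"
  have *: "bilinear_form (\<lambda>c d. eval2 (\<lambda>a b. B (S a * c) (S b * d)) t)" for t
    unfolding eval2_def by (intro bilinear_form_sweedler bilinear_form_mult B)
  have *: "bilinear_form (\<lambda>c d. eval2 (\<lambda>a b. B (c * S a) (d * S b)) t)" for t
    unfolding eval2_def by (intro bilinear_form_sweedler bilinear_form_mult B)
  show "eval2 B (map_both S (s \<star> t)) = eval2 B (map_both S t \<star> map_both S s)"
    using assms B
    by (simp add: eval2_mult bilinear_form_endo S_endo S_mult bilinear_form_eval2 bilinear_form_mult *)
      (simp add: eval2_def sweedler_swap[of s t])
qed (use assms in auto)

lemma cop_antipode_mult: "cop_antipode (a * b) = cop_antipode b \<star> cop_antipode a"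
  by (simp add: cop_antipode_def \<Delta>_mult flip_mult map_both_S_mult)

lemma cop_antipode_one: "cop_antipode 1 = \<one>\<^bsub>\<T> 2\<^esub>"
  by (rule tensor2_eqI) (auto simp: eval2_cop_antipode \<Delta>_one bilinear_form_flip bilinear_form_endo[OF bilinear_form_flip S_endo] S_one)

lemma \<gamma>_words: "[[S (X2 * x12) * \<alpha> * X3 * x2, S (X1 * x11) * \<alpha> * x3].
      [X1, X2, X3] \<leftarrow> summands \<Phi>, [x1, x2, x3] \<leftarrow> summands \<Phi>_inv, [x11, x12] \<leftarrow> summands (\<Delta> x1)] \<in> tensor_words 2"
  by (auto simp: tensor_words_def split: list.splits)

lemma \<gamma>_closed [simp]: "\<gamma> \<in> carrier (\<T> 2)"
  unfolding \<gamma>_def by (rule tensor_carrier[OF \<gamma>_words])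

lemma eval2_\<gamma>:
  assumes "bilinear_form B"
  shows "eval2 B \<gamma> = sweedler \<Phi> (\<lambda>X. sweedler \<Phi>_inv (\<lambda>x. sweedler (\<Delta> (x ! 0)) (\<lambda>v.
    B (S (X ! 1 * v ! 1) * \<alpha> * X ! 2 * x ! 1) (S (X ! 0 * v ! 0) * \<alpha> * x ! 2))))"
  unfolding \<gamma>_def by (subst eval2_tensor[OF assms \<gamma>_words])
    (simp add: sum_comprehension_3[OF \<Phi>_carrier(1)] sum_comprehension_3[OF \<Phi>_carrier(2)]
      sum_comprehension_2[OF \<Delta>_closed])

text \<open>The element \<open>\<gamma>\<close> is two nested caps after re-bracketing \<open>(ab)(cd)\<close> to \<open>(a(bc))d\<close>. The form \<open>Q w\<close> may depend on further slots,
so that the lemma applies to forms with four and with six slots.\<close>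

lemma \<gamma>_act:
  assumes d: "distinct [a, b, c, d]"
    and F: "\<And>w. F w = Q w (S (w b) * \<alpha> * w c) (S (w a) * \<alpha> * w d)"
    and Q: "\<And>w. bilinear_form (Q w)" "\<And>w i x. i \<in> {a, b, c, d} \<Longrightarrow> Q (w(i := x)) = Q w"
  shows "(F \<lhd> assoc (Leaf a) (Leaf b) (Leaf c) \<lhd> assoc_inv (Leaf a \<bullet> Leaf b) (Leaf c) (Leaf d)) w
    = eval2 (\<lambda>r s. Q w (S (w b) * r * w c) (S (w a) * s * w d)) \<gamma>"
proof -
  have ne: "a \<noteq> b" "a \<noteq> c" "a \<noteq> d" "b \<noteq> a" "b \<noteq> c" "b \<noteq> d" "c \<noteq> a" "c \<noteq> b" "c \<noteq> d" "d \<noteq> a" "d \<noteq> b" "d \<noteq> c"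
    using d by auto
  show ?thesis
    unfolding eval2_\<gamma>[OF bilinear_form_compose[OF Q(1)]] sweedler_swap[where s = \<Phi> and t = \<Phi>_inv] sweedler_swap[where s = \<Phi> and t = "\<Delta> x" for x]
    using ne by (simp add: tensor_act_3 F Q S_mult mult.assoc)
qed

text \<open>Nested caps, on \<open>b\<^sub>4c\<^sub>4\<close> inside and on \<open>a\<^sub>4d\<^sub>4\<close> outside: the evaluation of \<open>W\<^sup>* \<otimes> V\<^sup>*\<close> on \<open>V \<otimes> W\<close>.\<close>

definition cap_form :: "('h \<Rightarrow> 'h \<Rightarrow> 'k) \<Rightarrow> (slot4 \<Rightarrow> 'h) \<Rightarrow> 'k"
  where "cap_form B w = B (S (w B4) * \<alpha> * w C4) (S (w A4) * \<alpha> * w D4)"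

lemma multilinear_cap_form [simp]: "bilinear_form B \<Longrightarrow> multilinear (cap_form B)"
  unfolding multilinear_def
proof (intro allI)
  fix w i assume "bilinear_form B"
  then show "linform (\<lambda>a. cap_form B (w(i := a)))"
    by (cases i) (auto simp: cap_form_def linear_simps)
qed

lemma cap_form_invariant:
  assumes "bilinear_form B"
  shows "left_invariant (b4 \<bullet> c4) (cap_form B)" "left_invariant (a4 \<bullet> d4) (cap_form B)"
proof -
  have "linform (\<lambda>a. B (S (w B4) * a * w C4) (S (w A4) * \<alpha> * w D4))" for w :: "slot4 \<Rightarrow> 'h"
    by (rule linform_middle[OF bilinear_formD(2)[OF assms]])
  from antipode_\<alpha>_form[OF this] show "left_invariant (b4 \<bullet> c4) (cap_form B)"
    by (simp add: left_invariant_def cap_form_def fun_eq_iff mult.assoc S_mult)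
  have "linform (\<lambda>a. B (S (w B4) * \<alpha> * w C4) (S (w A4) * a * w D4))" for w :: "slot4 \<Rightarrow> 'h"
    by (rule linform_middle[OF bilinear_formD(1)[OF assms]])
  from antipode_\<alpha>_form[OF this] show "left_invariant (a4 \<bullet> d4) (cap_form B)"
    by (simp add: left_invariant_def cap_form_def fun_eq_iff mult.assoc S_mult)
qed

definition \<gamma>_form :: "('h \<Rightarrow> 'h \<Rightarrow> 'k) \<Rightarrow> (slot4 \<Rightarrow> 'h) \<Rightarrow> 'k"
  where "\<gamma>_form B = cap_form B \<lhd> assoc a4 b4 c4
    \<lhd> assoc_inv (a4 \<bullet> b4) c4 d4"

lemma \<gamma>_form_eval: "bilinear_form B \<Longrightarrow> \<gamma>_form B w = eval2 (\<lambda>r s. B (S (w B4) * r * w C4) (S (w A4) * s * w D4)) \<gamma>"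
  unfolding \<gamma>_form_def by (rule \<gamma>_act) (auto simp: cap_form_def)

lemma multilinear_\<gamma>_form [simp]: "bilinear_form B \<Longrightarrow> multilinear (\<gamma>_form B)"
  by (simp add: \<gamma>_form_def)

text \<open>Re-bracketing turns an action on the bundle \<open>(a\<^sub>4b\<^sub>4)(c\<^sub>4d\<^sub>4)\<close> into one on \<open>(a\<^sub>4(b\<^sub>4c\<^sub>4))d\<^sub>4\<close>, which passes first to the inner
and then to the outer cap.\<close>

lemma \<gamma>_form_invariant:
  assumes B: "bilinear_form B"
  shows "left_invariant ((a4 \<bullet> b4) \<bullet> (c4 \<bullet> d4)) (\<gamma>_form B)"
  unfolding left_invariant_def
proof
  fix h
  let ?F = "cap_form B"
  have F: "multilinear ?F" using B by simp
  have "?F \<lhd> tensor_act (\<Delta> h) ([] @ (a4 \<bullet> (b4 \<bullet> c4)) # [d4]) = ?F \<lhd> tensor_act (\<Delta> h) ([] @ a4 # [d4])"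
    by (rule left_replace[where K = "b4 \<bullet> c4" and n = 2])
      (use cap_form_invariant[OF B] F in \<open>auto simp del: tree_act.simps simp: left_reduce_right\<close>)
  then have 1: "?F \<lhd> tree_act ((a4 \<bullet> (b4 \<bullet> c4)) \<bullet> d4) h = (\<lambda>w. \<epsilon> h * ?F w)"
    unfolding tree_act_Node[of "a4 \<bullet> (b4 \<bullet> c4)"] using left_invariantD[OF cap_form_invariant(2)[OF B], of h]
    by (simp only: append_Nil tree_act_Node)
  have 2: "?F \<lhd> tensor_act (\<Delta> h) ([] @ (a4 \<bullet> (b4 \<bullet> c4)) # [d4]) \<lhd> assoc a4 b4 c4
    = ?F \<lhd> assoc a4 b4 c4 \<lhd> tensor_act (\<Delta> h) ([] @ ((a4 \<bullet> b4) \<bullet> c4) # [d4])"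
    by (rule tensor_act_natural[where n = 2]) (use F in \<open>auto simp del: tree_act.simps intro: assoc_natural\<close>)
  have "\<gamma>_form B \<lhd> tree_act ((a4 \<bullet> b4) \<bullet> (c4 \<bullet> d4)) h
    = ?F \<lhd> assoc a4 b4 c4 \<lhd> tree_act (((a4 \<bullet> b4) \<bullet> c4) \<bullet> d4) h \<lhd> assoc_inv (a4 \<bullet> b4) c4 d4"
    unfolding \<gamma>_form_def by (rule assoc_natural(2)[symmetric]) (use F in auto)
  also have "?F \<lhd> assoc a4 b4 c4 \<lhd> tree_act (((a4 \<bullet> b4) \<bullet> c4) \<bullet> d4) h
    = ?F \<lhd> tree_act ((a4 \<bullet> (b4 \<bullet> c4)) \<bullet> d4) h \<lhd> assoc a4 b4 c4"
    using 2 by (simp only: append_Nil tree_act_Node)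
  finally show "\<gamma>_form B \<lhd> tree_act ((a4 \<bullet> b4) \<bullet> (c4 \<bullet> d4)) h = (\<lambda>w. \<epsilon> h * \<gamma>_form B w)"
    unfolding 1 by (simp only: tensor_act_scale \<gamma>_form_def)
qed

definition \<gamma>_pairing :: "('h \<Rightarrow> 'h \<Rightarrow> 'k) \<Rightarrow> 'h \<Rightarrow> 'h \<Rightarrow> 'k"
  where "\<gamma>_pairing B x y = eval2 B (cop_antipode x \<star> \<gamma> \<star> \<Delta> y)"

lemma \<gamma>_pairing_form:
  assumes B: "bilinear_form B"
  shows "\<gamma>_pairing B x y
    = (\<gamma>_form B \<lhd> tree_act (a4 \<bullet> b4) x \<lhd> tree_act (c4 \<bullet> d4) y) (\<lambda>_. 1)"
proof -
  have *: "bilinear_form (\<lambda>a b. eval2 (\<lambda>r s. B (a * r * c) (b * s * d)) \<gamma>)" for c d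
    unfolding eval2_def mult.assoc by (intro bilinear_form_sweedler bilinear_form_mult B)
  have "\<gamma>_pairing B x y = eval2 (\<lambda>c d. eval2 (\<lambda>a b. B (a * c) (b * d)) (cop_antipode x \<star> \<gamma>)) (\<Delta> y)"
    unfolding \<gamma>_pairing_def by (rule eval2_mult_right) (use B in auto)
  then show ?thesis
    using B by (simp add: eval2_mult bilinear_form_mult eval2_cop_antipode * \<gamma>_form_eval) (simp add: eval2_def)
qed

lemma \<gamma>_pairing_invariant:
  assumes B: "bilinear_form B"
  shows "invariant_form (\<gamma>_pairing B)"
proof -
  let ?ab = "a4 \<bullet> b4" and ?cd = "c4 \<bullet> d4"
  let ?F = "\<gamma>_form B"
  have F: "multilinear ?F" using B by simp
  have c: "leaves ?ab \<inter> leaves ?cd = {}" by auto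
  have dl: "distinct_leaves ?ab" "distinct_leaves ?cd" by auto
  have "bilinear_form (\<gamma>_pairing B)"
    unfolding \<gamma>_pairing_form[OF B, abs_def] by (rule bilinear_tree_act[OF F])
  moreover have "sweedler (\<Delta> h) (\<lambda>v. \<gamma>_pairing B (v ! 0 * a) (v ! 1 * b)) = \<epsilon> h * \<gamma>_pairing B a b" for h a b
  proof -
    have "(?F \<lhd> tree_act ?ab (v ! 0 * a) \<lhd> tree_act ?cd (v ! 1 * b))
      = ?F \<lhd> tree_act ?ab (v ! 0) \<lhd> tree_act ?cd (v ! 1) \<lhd> tree_act ?ab a \<lhd> tree_act ?cd b" for v
      using F by (simp only: tree_act_mult[symmetric, OF dl(1)] tree_act_mult[symmetric, OF dl(2)]
          multilinear_tree_act tree_act_commute[OF c])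
    then have "sweedler (\<Delta> h) (\<lambda>v. \<gamma>_pairing B (v ! 0 * a) (v ! 1 * b))
      = (?F \<lhd> tree_act (?ab \<bullet> ?cd) h \<lhd> tree_act ?ab a \<lhd> tree_act ?cd b) (\<lambda>_. 1)"
      unfolding \<gamma>_pairing_form[OF B] tree_act.simps(2)[of ?ab] tree_act_sweedler by simp
    also have "\<dots> = \<epsilon> h * \<gamma>_pairing B a b"
      unfolding left_invariantD[OF \<gamma>_form_invariant[OF B]] \<gamma>_pairing_form[OF B]
      by (simp only: tree_act_scale)
    finally show ?thesis .
  qed
  ultimately show ?thesis by (simp add: invariant_form_def)
qed

lemma twist_summands_closed:
  "t \<in> set [map_both S (flip (\<Delta> x1)) \<star> \<gamma> \<star> \<Delta> (x2 * \<beta> * S x3). [x1, x2, x3] \<leftarrow> summands \<Phi>_inv]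
    \<Longrightarrow> t \<in> carrier (\<T> 2)"
  by (auto split: list.splits)

lemma twist_closed [simp]: "drinfeld_twist \<in> carrier (\<T> 2)"
  unfolding drinfeld_twist_def by (rule tensor_sum_closed[OF twist_summands_closed])

lemma eval2_twist:
  assumes "bilinear_form B"
  shows "eval2 B drinfeld_twist = sweedler \<Phi>_inv (\<lambda>x. eval2 B (cop_antipode (x ! 0) \<star> \<gamma> \<star> \<Delta> (x ! 1 * \<beta> * S (x ! 2))))"
  unfolding drinfeld_twist_def
  by (subst eval2_tensor_sum[OF twist_summands_closed assms])
    (simp_all add: sum_comprehension_3[OF \<Phi>_carrier(2)] cop_antipode_def)

lemma eval2_twist_sandwich:
  assumes "bilinear_form B" "s \<in> carrier (\<T> 2)" "t \<in> carrier (\<T> 2)"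
  shows "eval2 B (s \<star> drinfeld_twist \<star> t) = sweedler \<Phi>_inv (\<lambda>x. eval2 B
    (s \<star> (cop_antipode (x ! 0) \<star> \<gamma> \<star> \<Delta> (x ! 1 * \<beta> * S (x ! 2))) \<star> t))"
  using assms by (simp add: eval2_sandwich(1) eval2_twist bilinear_form_sandwich)

text \<open>Both this and the next lemma are the comparison of duals for \<open>\<gamma>_pairing\<close>, read through the definition of the twist.\<close>

lemma twist_\<Delta>_\<alpha>: "drinfeld_twist \<star> \<Delta> \<alpha> = \<gamma>"
proof (rule tensor2_eqI)
  fix B assume B: "bilinear_form B"
  have "eval2 B (drinfeld_twist \<star> \<Delta> \<alpha>) = sweedler \<Phi>_inv (\<lambda>x. \<gamma>_pairing B (x ! 0) (x ! 1 * \<beta> * S (x ! 2) * \<alpha>))"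
    using eval2_twist_sandwich[OF B T2.one_closed \<Delta>_closed, of \<alpha>]
    by (simp add: \<gamma>_pairing_def \<Delta>_mult T2.m_assoc)
  also have "\<dots> = \<gamma>_pairing B 1 1"
    by (rule invariant_form_\<Phi>_inv_\<alpha>[OF \<gamma>_pairing_invariant[OF B]])
  also have "\<dots> = eval2 B \<gamma>"
    by (simp add: \<gamma>_pairing_def cop_antipode_one \<Delta>_one)
  finally show "eval2 B (drinfeld_twist \<star> \<Delta> \<alpha>) = eval2 B \<gamma>" .
qed auto

lemma twist_\<Delta>_S: "drinfeld_twist \<star> \<Delta> (S h) = cop_antipode h \<star> drinfeld_twist"
proof (rule tensor2_eqI)
  fix B assume B: "bilinear_form B"
  have "eval2 B (drinfeld_twist \<star> \<Delta> (S h)) = sweedler \<Phi>_inv (\<lambda>x. \<gamma>_pairing B (x ! 0) (x ! 1 * \<beta> * S (h * x ! 2)))"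
    using eval2_twist_sandwich[OF B T2.one_closed \<Delta>_closed, of "S h"]
    by (simp add: \<gamma>_pairing_def \<Delta>_mult T2.m_assoc S_mult)
  also have "\<dots> = sweedler \<Phi>_inv (\<lambda>x. \<gamma>_pairing B (x ! 0 * h) (x ! 1 * \<beta> * S (x ! 2)))"
    by (rule invariant_form_\<Phi>_inv_move[OF \<gamma>_pairing_invariant[OF B], symmetric])
  also have "\<dots> = eval2 B (cop_antipode h \<star> drinfeld_twist)"
    using eval2_twist_sandwich[OF B cop_antipode_closed T2.one_closed, of h]
    by (simp add: \<gamma>_pairing_def \<Delta>_mult T2.m_assoc cop_antipode_mult)
  finally show "eval2 B (drinfeld_twist \<star> \<Delta> (S h)) = eval2 B (cop_antipode h \<star> drinfeld_twist)" .
qed auto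

section \<open>Invertibility of the Drinfeld twist\<close>

text \<open>The nested cups of \<open>V \<otimes> W\<close> followed by its nested caps, in the order of the snake identity for \<open>V \<otimes> W\<close> and, in
\<open>dual_snake_form\<close>, of that for its dual.\<close>

definition snake_form :: "('h \<Rightarrow> 'h \<Rightarrow> 'k) \<Rightarrow> (slot6 \<Rightarrow> 'h) \<Rightarrow> 'k"
  where "snake_form B w = B (w A6 * \<beta> * S (w D6) * \<alpha> * w E6) (w B6 * \<beta> * S (w C6) * \<alpha> * w F6)"

definition dual_snake_form :: "('h \<Rightarrow> 'h \<Rightarrow> 'k) \<Rightarrow> (slot6 \<Rightarrow> 'h) \<Rightarrow> 'k"
  where "dual_snake_form B w = B (S (w B6) * \<alpha> * w C6 * \<beta> * S (w F6)) (S (w A6) * \<alpha> * w D6 * \<beta> * S (w E6))"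

lemma multilinear_snake_forms [simp]:
  assumes "bilinear_form B"
  shows "multilinear (snake_form B)" "multilinear (dual_snake_form B)"
  unfolding multilinear_def
proof (intro allI)
  fix w i
  show "linform (\<lambda>a. snake_form B (w(i := a)))"
    using assms by (cases i) (auto simp: snake_form_def linear_simps)
next
  show "\<forall>w i. linform (\<lambda>a. dual_snake_form B (w(i := a)))"
  proof (intro allI)
    fix w i
    show "linform (\<lambda>a. dual_snake_form B (w(i := a)))"
      using assms by (cases i) (auto simp: dual_snake_form_def linear_simps)
  qed
qed

lemma snake_form_invariant:
  assumes B: "bilinear_form B"
  shows "left_invariant (d6 \<bullet> e6) (snake_form B)" "left_invariant (c6 \<bullet> f6) (snake_form B)"
    "right_invariant A6 D6 (snake_form B)" "right_invariant B6 C6 (snake_form B)"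
  subgoal
    using antipode_\<alpha>_form[of "\<lambda>a. B ((w A6 * \<beta> * S (w D6)) * a * w E6) (w B6 * \<beta> * S (w C6) * \<alpha> * w F6)" for w,
      OF linform_middle[OF bilinear_formD(2)[OF B]]]
    by (simp add: left_invariant_def snake_form_def fun_eq_iff mult.assoc S_mult)
  subgoal
    using antipode_\<alpha>_form[of "\<lambda>a. B (w A6 * \<beta> * S (w D6) * \<alpha> * w E6) ((w B6 * \<beta> * S (w C6)) * a * w F6)" for w,
      OF linform_middle[OF bilinear_formD(1)[OF B]]]
    by (simp add: left_invariant_def snake_form_def fun_eq_iff mult.assoc S_mult)
  subgoal
    using antipode_\<beta>_form[of "\<lambda>a. B (w A6 * a * (S (w D6) * \<alpha> * w E6)) (w B6 * \<beta> * S (w C6) * \<alpha> * w F6)" for w,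
      OF linform_middle[OF bilinear_formD(2)[OF B]]]
    by (simp add: right_invariant_def snake_form_def fun_eq_iff mult.assoc S_mult)
  subgoal
    using antipode_\<beta>_form[of "\<lambda>a. B (w A6 * \<beta> * S (w D6) * \<alpha> * w E6) (w B6 * a * (S (w C6) * \<alpha> * w F6))" for w,
      OF linform_middle[OF bilinear_formD(1)[OF B]]]
    by (simp add: right_invariant_def snake_form_def fun_eq_iff mult.assoc S_mult)
  done

lemma dual_snake_form_invariant:
  assumes B: "bilinear_form B"
  shows "left_invariant (b6 \<bullet> c6) (dual_snake_form B)" "left_invariant (a6 \<bullet> d6) (dual_snake_form B)"
    "right_invariant C6 F6 (dual_snake_form B)" "right_invariant D6 E6 (dual_snake_form B)"
  subgoal
    using antipode_\<alpha>_form[of "\<lambda>a. B (S (w B6) * a * (w C6 * \<beta> * S (w F6))) (S (w A6) * \<alpha> * w D6 * \<beta> * S (w E6))" for w,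
      OF linform_middle[OF bilinear_formD(2)[OF B]]]
    by (simp add: left_invariant_def dual_snake_form_def fun_eq_iff mult.assoc S_mult)
  subgoal
    using antipode_\<alpha>_form[of "\<lambda>a. B (S (w B6) * \<alpha> * w C6 * \<beta> * S (w F6)) (S (w A6) * a * (w D6 * \<beta> * S (w E6)))" for w,
      OF linform_middle[OF bilinear_formD(1)[OF B]]]
    by (simp add: left_invariant_def dual_snake_form_def fun_eq_iff mult.assoc S_mult)
  subgoal
    using antipode_\<beta>_form[of "\<lambda>a. B ((S (w B6) * \<alpha> * w C6) * a * S (w F6)) (S (w A6) * \<alpha> * w D6 * \<beta> * S (w E6))" for w,
      OF linform_middle[OF bilinear_formD(2)[OF B]]]
    by (simp add: right_invariant_def dual_snake_form_def fun_eq_iff mult.assoc S_mult)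
  subgoal
    using antipode_\<beta>_form[of "\<lambda>a. B (S (w B6) * \<alpha> * w C6 * \<beta> * S (w F6)) ((S (w A6) * \<alpha> * w D6) * a * S (w E6))" for w,
      OF linform_middle[OF bilinear_formD(1)[OF B]]]
    by (simp add: right_invariant_def dual_snake_form_def fun_eq_iff mult.assoc S_mult)
  done

text \<open>The snake identity for \<open>V \<otimes> W\<close>, with strands \<open>V = a\<^sub>6\<close>, \<open>W = b\<^sub>6\<close>, \<open>W\<^sup>* = c\<^sub>6\<close>, \<open>V\<^sup>* = d\<^sub>6\<close> from the cups and \<open>V = e\<^sub>6\<close>, \<open>W = f\<^sub>6\<close>
entering on the right. By coherence the brackets can be rearranged so that the snake for \<open>V\<close>, which uses
\<open>a\<^sub>6, d\<^sub>6, e\<^sub>6\<close>, and the snake for \<open>W\<close>, which uses \<open>b\<^sub>6, c\<^sub>6, f\<^sub>6\<close>, become independent.\<close>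

lemma snake_act:
  assumes B: "bilinear_form B"
  shows "(snake_form B \<lhd> assoc c6 d6 e6 \<lhd> assoc_inv (c6 \<bullet> d6) e6 f6 \<lhd> assoc (a6 \<bullet> b6) (c6 \<bullet> d6) (e6 \<bullet> f6)
    \<lhd> assoc (a6 \<bullet> b6) c6 d6 \<lhd> assoc_inv a6 b6 c6) (\<lambda>_. 1) = B 1 1"
proof -
  let ?F = "snake_form B"
  have F: "multilinear ?F" using B by simp
  note inv = snake_form_invariant[OF B]
  let ?Z = "?F \<lhd> assoc (a6 \<bullet> b6) c6 f6 \<lhd> assoc_inv a6 b6 c6"
  let ?Y = "?Z \<lhd> assoc_inv d6 e6 f6"
  have rY: "right_invariant A6 D6 ?Y" "right_invariant B6 C6 ?Y"
    using inv by (auto intro: right_invariant_tensor_act)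
  have Zinv: "left_invariant (d6 \<bullet> e6) ?Z"
    using inv(1) by (intro left_invariant_tensor_act) auto
  \<comment> \<open>The leftmost operators meet the caps first; the inner cap, on \<open>d\<^sub>6e\<^sub>6\<close>, absorbs its bundle in both of them.\<close>
  have 1: "?F \<lhd> assoc_inv c6 (d6 \<bullet> e6) f6 = ?F"
    by (rule assoc_absorb) (use F inv in auto)
  have 2: "?F \<lhd> assoc (a6 \<bullet> b6) c6 ((d6 \<bullet> e6) \<bullet> f6) = ?F \<lhd> assoc (a6 \<bullet> b6) c6 f6"
  proof -
    have "?F \<lhd> tensor_act \<Phi> ([a6 \<bullet> b6, c6] @ ((d6 \<bullet> e6) \<bullet> f6) # []) = ?F \<lhd> tensor_act \<Phi> ([a6 \<bullet> b6, c6] @ f6 # [])"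
      by (rule left_replace[where K = "d6 \<bullet> e6" and n = 3])
        (use F inv in \<open>auto simp: left_reduce_left simp del: tree_act.simps\<close>)
    then show ?thesis by simp
  qed
  have "?F \<lhd> assoc c6 d6 e6 \<lhd> assoc_inv (c6 \<bullet> d6) e6 f6 \<lhd> assoc (a6 \<bullet> b6) (c6 \<bullet> d6) (e6 \<bullet> f6)
      \<lhd> assoc (a6 \<bullet> b6) c6 d6 \<lhd> assoc_inv a6 b6 c6
    = ?F \<lhd> assoc (a6 \<bullet> b6) c6 f6 \<lhd> assoc_inv d6 e6 f6 \<lhd> assoc ((a6 \<bullet> b6) \<bullet> c6) d6 (e6 \<bullet> f6) \<lhd> assoc_inv a6 b6 c6"
    by (subst assoc_coherence(1)) (use F in \<open>auto simp: 1 2\<close>)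
  also have "\<dots> = ?F \<lhd> assoc (a6 \<bullet> b6) c6 f6 \<lhd> assoc_inv d6 e6 f6 \<lhd> assoc_inv a6 b6 c6 \<lhd> assoc (a6 \<bullet> (b6 \<bullet> c6)) d6 (e6 \<bullet> f6)"
    using assoc_natural_at(2)[of "?F \<lhd> assoc (a6 \<bullet> b6) c6 f6 \<lhd> assoc_inv d6 e6 f6" a6 b6 c6 "[]" "[d6, e6 \<bullet> f6]" 3 \<Phi>] F
    by simp
  also have "?F \<lhd> assoc (a6 \<bullet> b6) c6 f6 \<lhd> assoc_inv d6 e6 f6 \<lhd> assoc_inv a6 b6 c6 = ?Y"
    by (rule tensor_act_commute) auto
  finally have "(?F \<lhd> assoc c6 d6 e6 \<lhd> assoc_inv (c6 \<bullet> d6) e6 f6 \<lhd> assoc (a6 \<bullet> b6) (c6 \<bullet> d6) (e6 \<bullet> f6)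
      \<lhd> assoc (a6 \<bullet> b6) c6 d6 \<lhd> assoc_inv a6 b6 c6) (\<lambda>_. 1)
    = (?Y \<lhd> assoc (a6 \<bullet> (b6 \<bullet> c6)) d6 (e6 \<bullet> f6)) (\<lambda>_. 1)"
    by simp
  \<comment> \<open>The cup on \<open>b\<^sub>6c\<^sub>6\<close> lets that bundle be dropped on the right.\<close>
  also have "\<dots> = (?Y \<lhd> assoc a6 d6 (e6 \<bullet> f6)) (\<lambda>_. 1)"
  proof -
    have "(?Y \<lhd> tensor_act \<Phi> ([] @ (a6 \<bullet> (b6 \<bullet> c6)) # [d6, e6 \<bullet> f6])) (\<lambda>_. 1) = (?Y \<lhd> tensor_act \<Phi> ([] @ a6 # [d6, e6 \<bullet> f6])) (\<lambda>_. 1)"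
      by (rule right_replace[where i = B6 and j = C6 and n = 3])
        (use F rY in \<open>auto simp: right_reduce_right simp del: tree_act.simps\<close>)
    then show ?thesis by simp
  qed
  also have "\<dots> = (?Y \<lhd> assoc a6 d6 (e6 \<bullet> f6) \<lhd> assoc (a6 \<bullet> d6) e6 f6) (\<lambda>_. 1)"
    by (rule assoc_right_absorb[symmetric])
      (use F in \<open>auto intro!: right_invariant_tensor_act rY\<close>)
  \<comment> \<open>The pentagon on \<open>a\<^sub>6, d\<^sub>6, e\<^sub>6, f\<^sub>6\<close> frees the snake for \<open>V\<close> and the one on \<open>a\<^sub>6, b\<^sub>6, c\<^sub>6, f\<^sub>6\<close> that for \<open>W\<close>.\<close>
  also have "?Y \<lhd> assoc a6 d6 (e6 \<bullet> f6) \<lhd> assoc (a6 \<bullet> d6) e6 f6 = ?Y \<lhd> assoc d6 e6 f6 \<lhd> assoc a6 (d6 \<bullet> e6) f6 \<lhd> assoc a6 d6 e6"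
    by (rule pentagon_act[symmetric]) (use F in auto)
  also have "?Y \<lhd> assoc d6 e6 f6 = ?Z"
    by (rule assoc_inv) (use F in auto)
  also have "?Z \<lhd> assoc a6 (d6 \<bullet> e6) f6 = ?Z"
    by (rule assoc_absorb) (use F Zinv in auto)
  also have "?Z = ?F \<lhd> assoc b6 c6 f6 \<lhd> assoc a6 (b6 \<bullet> c6) f6"
  proof -
    have "?F \<lhd> assoc a6 b6 (c6 \<bullet> f6) = ?F"
      by (rule assoc_absorb) (use F inv in auto)
    then have "?F \<lhd> assoc (a6 \<bullet> b6) c6 f6 = ?F \<lhd> assoc a6 b6 (c6 \<bullet> f6) \<lhd> assoc (a6 \<bullet> b6) c6 f6"
      by simp
    also have "\<dots> = ?F \<lhd> assoc b6 c6 f6 \<lhd> assoc a6 (b6 \<bullet> c6) f6 \<lhd> assoc a6 b6 c6"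
      by (rule pentagon_act[symmetric]) (use F in auto)
    finally show ?thesis
      using F by simp
  qed
  also have "(?F \<lhd> assoc b6 c6 f6 \<lhd> assoc a6 (b6 \<bullet> c6) f6 \<lhd> assoc a6 d6 e6) (\<lambda>_. 1)
    = (?F \<lhd> assoc b6 c6 f6 \<lhd> assoc a6 d6 e6) (\<lambda>_. 1)"
    by (rule assoc_right_absorb_past[where i = B6 and j = C6])
      (use F inv in \<open>auto intro: right_invariant_tensor_act\<close>)
  also have "\<dots> = B 1 1"
    using antipode_\<Phi>_form[OF bilinear_formD(1)[OF B]] antipode_\<Phi>_form[OF bilinear_formD(2)[OF B]]
    by (simp add: tensor_act_3) (simp add: snake_form_def)
  finally show ?thesis .
qed

text \<open>The snake identity for \<open>W\<^sup>* \<otimes> V\<^sup>*\<close> uses the inverse composite of associators. The argument is that of \<open>snake_act\<close> with the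
roles of caps and cups exchanged.\<close>

lemma dual_snake_act:
  assumes B: "bilinear_form B"
  shows "(dual_snake_form B \<lhd> assoc a6 b6 c6 \<lhd> assoc_inv (a6 \<bullet> b6) c6 d6 \<lhd> assoc_inv (a6 \<bullet> b6) (c6 \<bullet> d6) (e6 \<bullet> f6)
    \<lhd> assoc (c6 \<bullet> d6) e6 f6 \<lhd> assoc_inv c6 d6 e6) (\<lambda>_. 1) = B 1 1"
proof -
  let ?F = "dual_snake_form B"
  have F: "multilinear ?F" using B by simp
  note inv = dual_snake_form_invariant[OF B]
  let ?V = "?F \<lhd> assoc_inv a6 d6 (e6 \<bullet> f6)"
  let ?W = "?V \<lhd> assoc d6 e6 f6"
  let ?G = "?F \<lhd> assoc a6 b6 c6 \<lhd> assoc_inv ((a6 \<bullet> b6) \<bullet> c6) d6 (e6 \<bullet> f6) \<lhd> assoc d6 e6 f6"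
  have rG: "right_invariant D6 E6 ?G" "right_invariant D6 E6 (?G \<lhd> assoc_inv (a6 \<bullet> b6) c6 ((d6 \<bullet> e6) \<bullet> f6))"
    using inv by (auto intro: right_invariant_tensor_act)
  have "(?F \<lhd> assoc a6 b6 c6 \<lhd> assoc_inv (a6 \<bullet> b6) c6 d6 \<lhd> assoc_inv (a6 \<bullet> b6) (c6 \<bullet> d6) (e6 \<bullet> f6)
      \<lhd> assoc (c6 \<bullet> d6) e6 f6 \<lhd> assoc_inv c6 d6 e6) (\<lambda>_. 1)
    = (?G \<lhd> assoc_inv (a6 \<bullet> b6) c6 ((d6 \<bullet> e6) \<bullet> f6) \<lhd> assoc c6 (d6 \<bullet> e6) f6) (\<lambda>_. 1)"
    by (subst assoc_coherence(2)) (use F in auto)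
  also have "\<dots> = (?G \<lhd> assoc_inv (a6 \<bullet> b6) c6 ((d6 \<bullet> e6) \<bullet> f6)) (\<lambda>_. 1)"
    by (rule assoc_right_absorb[where i = D6 and j = E6]) (use F rG in auto)
  also have "\<dots> = (?G \<lhd> assoc_inv (a6 \<bullet> b6) c6 f6) (\<lambda>_. 1)"
  proof -
    have "(?G \<lhd> tensor_act \<Phi>_inv ([a6 \<bullet> b6, c6] @ ((d6 \<bullet> e6) \<bullet> f6) # [])) (\<lambda>_. 1) = (?G \<lhd> tensor_act \<Phi>_inv ([a6 \<bullet> b6, c6] @ f6 # [])) (\<lambda>_. 1)"
      by (rule right_replace[where i = D6 and j = E6 and n = 3])
        (use F rG in \<open>auto simp: right_reduce_left simp del: tree_act.simps\<close>)
    then show ?thesis by simp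
  qed
  also have "?G = ?V \<lhd> assoc a6 b6 c6 \<lhd> assoc d6 e6 f6"
  proof -
    have "?F \<lhd> tensor_act \<Phi>_inv ([] @ (a6 \<bullet> (b6 \<bullet> c6)) # [d6, e6 \<bullet> f6]) = ?F \<lhd> tensor_act \<Phi>_inv ([] @ a6 # [d6, e6 \<bullet> f6])"
      by (rule left_replace[where K = "b6 \<bullet> c6" and n = 3])
        (use F inv in \<open>auto simp: left_reduce_right simp del: tree_act.simps\<close>)
    then show ?thesis
      using assoc_natural_at(1)[of ?F a6 b6 c6 "[]" "[d6, e6 \<bullet> f6]" 3 \<Phi>_inv] F by simp
  qed
  also have "?V \<lhd> assoc a6 b6 c6 \<lhd> assoc d6 e6 f6 = ?W \<lhd> assoc a6 b6 c6"
    by (rule tensor_act_commute) auto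
  also have "?W \<lhd> assoc a6 b6 c6 \<lhd> assoc_inv (a6 \<bullet> b6) c6 f6 = ?W \<lhd> assoc_inv b6 c6 f6 \<lhd> assoc a6 b6 (c6 \<bullet> f6)"
  proof -
    have W: "?W \<lhd> assoc_inv a6 (b6 \<bullet> c6) f6 = ?W"
    proof (rule assoc_absorb)
      have "left_invariant (b6 \<bullet> c6) ?W"
        using inv(1) by (intro left_invariant_tensor_act) auto
      then show "left_invariant a6 ?W \<or> left_invariant (b6 \<bullet> c6) ?W \<or> left_invariant f6 ?W" by blast
    qed (use F in auto)
    let ?U = "?W \<lhd> assoc_inv a6 (b6 \<bullet> c6) f6 \<lhd> assoc_inv b6 c6 f6"
    have "?U \<lhd> assoc b6 c6 f6 \<lhd> assoc a6 (b6 \<bullet> c6) f6 \<lhd> assoc a6 b6 c6 = ?U \<lhd> assoc a6 b6 (c6 \<bullet> f6) \<lhd> assoc (a6 \<bullet> b6) c6 f6"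
      by (rule pentagon_act) (use F in auto)
    then have "?U \<lhd> assoc b6 c6 f6 \<lhd> assoc a6 (b6 \<bullet> c6) f6 \<lhd> assoc a6 b6 c6 \<lhd> assoc_inv (a6 \<bullet> b6) c6 f6
      = ?U \<lhd> assoc a6 b6 (c6 \<bullet> f6) \<lhd> assoc (a6 \<bullet> b6) c6 f6 \<lhd> assoc_inv (a6 \<bullet> b6) c6 f6" by simp
    then have "?W \<lhd> assoc a6 b6 c6 \<lhd> assoc_inv (a6 \<bullet> b6) c6 f6 = ?U \<lhd> assoc a6 b6 (c6 \<bullet> f6)"
      using F by simp
    then show ?thesis by (simp only: W)
  qed
  also have "(?W \<lhd> assoc_inv b6 c6 f6 \<lhd> assoc a6 b6 (c6 \<bullet> f6)) (\<lambda>_. 1) = (?W \<lhd> assoc_inv b6 c6 f6) (\<lambda>_. 1)"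
    by (rule assoc_right_absorb[where i = C6 and j = F6])
      (use F inv in \<open>auto intro: right_invariant_tensor_act\<close>)
  also have "?W = ?F \<lhd> assoc_inv a6 d6 e6 \<lhd> assoc_inv a6 (d6 \<bullet> e6) f6"
  proof -
    have "?V \<lhd> assoc d6 e6 f6 \<lhd> assoc a6 (d6 \<bullet> e6) f6 \<lhd> assoc a6 d6 e6 = ?V \<lhd> assoc a6 d6 (e6 \<bullet> f6) \<lhd> assoc (a6 \<bullet> d6) e6 f6"
      by (rule pentagon_act) (use F in auto)
    also have "?V \<lhd> assoc a6 d6 (e6 \<bullet> f6) = ?F"
      by (rule assoc_inv) (use F in auto)
    also have "?F \<lhd> assoc (a6 \<bullet> d6) e6 f6 = ?F"
      by (rule assoc_absorb) (use F inv in auto)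
    finally have "?W \<lhd> assoc a6 (d6 \<bullet> e6) f6 \<lhd> assoc a6 d6 e6 \<lhd> assoc_inv a6 d6 e6 \<lhd> assoc_inv a6 (d6 \<bullet> e6) f6
      = ?F \<lhd> assoc_inv a6 d6 e6 \<lhd> assoc_inv a6 (d6 \<bullet> e6) f6" by simp
    then show ?thesis using F by simp
  qed
  also have "(?F \<lhd> assoc_inv a6 d6 e6 \<lhd> assoc_inv a6 (d6 \<bullet> e6) f6 \<lhd> assoc_inv b6 c6 f6) (\<lambda>_. 1)
    = (?F \<lhd> assoc_inv a6 d6 e6 \<lhd> assoc_inv b6 c6 f6) (\<lambda>_. 1)"
    by (rule assoc_right_absorb_past[where i = D6 and j = E6])
      (use F inv in \<open>auto intro: right_invariant_tensor_act\<close>)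
  also have "\<dots> = B 1 1"
    using antipode_\<Phi>_inv_form[OF bilinear_formD(1)[OF B]] antipode_\<Phi>_inv_form[OF bilinear_formD(2)[OF B]]
    by (simp add: tensor_act_3) (simp add: dual_snake_form_def)
  finally show ?thesis .
qed

text \<open>The nested cups that are dual to \<open>\<gamma>\<close>: \<open>1 \<mapsto> V \<otimes> V\<^sup>* \<mapsto> (V \<otimes> W) \<otimes> (W\<^sup>* \<otimes> V\<^sup>*)\<close>. The comprehension runs over \<open>\<Phi>\<^sup>-\<^sup>1\<close> first
because this is the order in which the operators on forms unfold.\<close>

definition \<delta> :: "'h list list set"
  where "\<delta> = tensor 2
    [[X11 * x1 * \<beta> * S X3, X12 * x2 * \<beta> * S (X2 * x3)].
      [x1, x2, x3] \<leftarrow> summands \<Phi>_inv, [X1, X2, X3] \<leftarrow> summands \<Phi>, [X11, X12] \<leftarrow> summands (\<Delta> X1)]"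

lemma \<delta>_words: "[[X11 * x1 * \<beta> * S X3, X12 * x2 * \<beta> * S (X2 * x3)].
      [x1, x2, x3] \<leftarrow> summands \<Phi>_inv, [X1, X2, X3] \<leftarrow> summands \<Phi>, [X11, X12] \<leftarrow> summands (\<Delta> X1)] \<in> tensor_words 2"
  by (auto simp: tensor_words_def split: list.splits)

lemma \<delta>_closed [simp]: "\<delta> \<in> carrier (\<T> 2)"
  unfolding \<delta>_def by (rule tensor_carrier[OF \<delta>_words])

lemma eval2_\<delta>:
  assumes "bilinear_form B"
  shows "eval2 B \<delta> = sweedler \<Phi>_inv (\<lambda>x. sweedler \<Phi> (\<lambda>X. sweedler (\<Delta> (X ! 0)) (\<lambda>v.
    B (v ! 0 * x ! 0 * \<beta> * S (X ! 2)) (v ! 1 * x ! 1 * \<beta> * S (X ! 1 * x ! 2)))))"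
  unfolding \<delta>_def by (subst eval2_tensor[OF assms \<delta>_words])
    (simp add: sum_comprehension_3[OF \<Phi>_carrier(1)] sum_comprehension_3[OF \<Phi>_carrier(2)]
      sum_comprehension_2[OF \<Delta>_closed])

text \<open>Cups are evaluated at the end of a chain of operators, hence at the word of ones; only words that are \<open>1\<close> outside the
slots of the cups occur as arguments of \<open>H\<close>.\<close>

lemma \<delta>_act:
  assumes d: "distinct [a, b, c, d]" and C: "bilinear_form C"
    and H: "\<And>w. (\<And>i. i \<notin> {a, b, c, d} \<Longrightarrow> w i = 1) \<Longrightarrow> H w = C (w a * \<beta> * S (w d)) (w b * \<beta> * S (w c))"
  shows "(H \<lhd> assoc (Leaf a \<bullet> Leaf b) (Leaf c) (Leaf d) \<lhd> assoc_inv (Leaf a) (Leaf b) (Leaf c)) (\<lambda>_. 1)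
    = eval2 C \<delta>"
proof -
  have ne: "a \<noteq> b" "a \<noteq> c" "a \<noteq> d" "b \<noteq> a" "b \<noteq> c" "b \<noteq> d" "c \<noteq> a" "c \<noteq> b" "c \<noteq> d" "d \<noteq> a" "d \<noteq> b" "d \<noteq> c"
    using d by auto
  have eq: "H ((\<lambda>_. 1)(d := p, c := q, b := r, a := s)) = C (s * \<beta> * S p) (r * \<beta> * S q)" for p q r s
    by (subst H) (use ne in auto)
  show ?thesis
    unfolding eval2_\<delta>[OF C] using ne by (simp add: tensor_act_3 eq)
qed

lemma \<gamma>_pairing_eval:
  assumes "bilinear_form B"
  shows "eval2 B (cop_antipode q \<star> \<gamma> \<star> \<Delta> r) = sweedler (\<Delta> r) (\<lambda>u. sweedler (\<Delta> q) (\<lambda>v.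
    eval2 (\<lambda>s t. B (S (v ! 1) * s * u ! 0) (S (v ! 0) * t * u ! 1)) \<gamma>))"
  using \<gamma>_pairing_form[OF assms, of q r] assms by (simp add: \<gamma>_pairing_def \<gamma>_form_eval)

text \<open>The left-hand side is the chain of operators of \<open>snake_act\<close> with \<open>p \<otimes> q \<otimes> r\<close> in place of \<open>\<Phi>\<close> on the three bundles.\<close>

lemma snake_form_pairing:
  assumes B: "bilinear_form B"
  shows "eval2 B (\<Delta> p \<star> \<delta> \<star> (cop_antipode q \<star> \<gamma> \<star> \<Delta> r))
    = (snake_form B \<lhd> assoc c6 d6 e6 \<lhd> assoc_inv (c6 \<bullet> d6) e6 f6
      \<lhd> tree_act (c6 \<bullet> d6) q \<lhd> tree_act (e6 \<bullet> f6) r \<lhd> tree_act (a6 \<bullet> b6) p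
      \<lhd> assoc (a6 \<bullet> b6) c6 d6 \<lhd> assoc_inv a6 b6 c6) (\<lambda>_. 1)"
proof -
  let ?t = "cop_antipode q \<star> \<gamma> \<star> \<Delta> r"
  have B': "bilinear_form (\<lambda>c d. B (a * x * c) (b * y * d))" for a b x y
    by (rule bilinear_form_mult[OF B])
  have G: "(snake_form B \<lhd> assoc c6 d6 e6 \<lhd> assoc_inv (c6 \<bullet> d6) e6 f6) w
    = eval2 (\<lambda>s t. (\<lambda>x y. B (w A6 * \<beta> * x) (w B6 * \<beta> * y)) (S (w D6) * s * w E6) (S (w C6) * t * w F6)) \<gamma>" for w
    by (rule \<gamma>_act[where Q = "\<lambda>w x y. B (w A6 * \<beta> * x) (w B6 * \<beta> * y)"])
      (use B' in \<open>auto simp: snake_form_def mult.assoc\<close>)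
  have t: "?t \<in> carrier (\<T> 2)" by simp
  show ?thesis
    unfolding eval2_sandwich(1)[OF \<Delta>_closed \<delta>_closed t B]
  proof (rule \<delta>_act[symmetric], goal_cases)
    case (3 w)
    then show ?case
      unfolding eval2_def[of _ "\<Delta> p"] \<gamma>_pairing_eval[OF B'] by (simp add: G S_mult mult.assoc)
  qed (use bilinear_form_sandwich[OF B] in auto)
qed

lemma dual_snake_form_pairing:
  assumes B: "bilinear_form B"
  shows "eval2 B ((cop_antipode p \<star> \<gamma> \<star> \<Delta> q) \<star> \<delta> \<star> cop_antipode r)
    = (dual_snake_form B \<lhd> assoc a6 b6 c6 \<lhd> assoc_inv (a6 \<bullet> b6) c6 d6
      \<lhd> tree_act (a6 \<bullet> b6) p \<lhd> tree_act (c6 \<bullet> d6) q \<lhd> tree_act (e6 \<bullet> f6) r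
      \<lhd> assoc (c6 \<bullet> d6) e6 f6 \<lhd> assoc_inv c6 d6 e6) (\<lambda>_. 1)"
proof -
  let ?s = "cop_antipode p \<star> \<gamma> \<star> \<Delta> q"
  have B': "bilinear_form (\<lambda>a b. B (a * x) (b * y))" "bilinear_form (\<lambda>a b. B (a * x * c) (b * y * d))" for c d x y
    using bilinear_form_mult(2)[OF B] by (simp_all add: mult.assoc)
  have C: "bilinear_form (\<lambda>x y. eval2 (\<lambda>c d. eval2 (\<lambda>a b. B (a * x * c) (b * y * d)) ?s) (cop_antipode r))"
    unfolding eval2_def by (intro bilinear_form_sweedler bilinear_form_compose B)
  have C': "bilinear_form (\<lambda>c d. eval2 (\<lambda>a b. B (a * x * c) (b * y * d)) ?s)" for x y
    unfolding eval2_def by (intro bilinear_form_sweedler bilinear_form_mult B)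
  have G: "(dual_snake_form B \<lhd> assoc a6 b6 c6 \<lhd> assoc_inv (a6 \<bullet> b6) c6 d6) w
    = eval2 (\<lambda>s t. (\<lambda>x y. B (x * (\<beta> * S (w F6))) (y * (\<beta> * S (w E6)))) (S (w B6) * s * w C6) (S (w A6) * t * w D6)) \<gamma>" for w
    by (rule \<gamma>_act[where Q = "\<lambda>w x y. B (x * (\<beta> * S (w F6))) (y * (\<beta> * S (w E6)))"])
      (use B' in \<open>auto simp: dual_snake_form_def mult.assoc\<close>)
  have s: "?s \<in> carrier (\<T> 2)" by simp
  show ?thesis
    unfolding eval2_sandwich(2)[OF s \<delta>_closed cop_antipode_closed B]
  proof (rule \<delta>_act[symmetric], goal_cases)
    case (3 w)
    then show ?case
      unfolding eval2_cop_antipode[OF C'] unfolding eval2_def[of _ "\<Delta> r"] \<gamma>_pairing_eval[OF B'(2)]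
      by (simp add: G S_mult S_one mult.assoc)
  qed (use C in auto)
qed

lemma snake_\<Phi>:
  assumes B: "bilinear_form B"
  shows "sweedler \<Phi> (\<lambda>X. eval2 B (\<Delta> (X ! 0) \<star> \<delta> \<star>
      (cop_antipode (X ! 1) \<star> \<gamma> \<star> \<Delta> (X ! 2)))) = B 1 1"
proof -
  let ?ab = "a6 \<bullet> b6" and ?cd = "c6 \<bullet> d6" and ?eg = "e6 \<bullet> f6"
  have c: "leaves ?cd \<inter> leaves ?ab = {}" "leaves ?eg \<inter> leaves ?ab = {}" by auto
  show ?thesis
    unfolding snake_form_pairing[OF B] snake_act[OF B, symmetric] tensor_act_3[OF \<Phi>_carrier(1), of ?ab ?cd ?eg]
      tensor_act_sweedler tree_act_commute[OF c(1)] tree_act_commute[OF c(2)] ..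
qed

lemma snake_\<Phi>_inv:
  assumes B: "bilinear_form B"
  shows "sweedler \<Phi>_inv (\<lambda>x. eval2 B ((cop_antipode (x ! 0) \<star> \<gamma> \<star> \<Delta> (x ! 1)) \<star>
      \<delta> \<star> cop_antipode (x ! 2))) = B 1 1"
  unfolding dual_snake_form_pairing[OF B] dual_snake_act[OF B, symmetric]
    tensor_act_3[OF \<Phi>_carrier(2), of "a6 \<bullet> b6" "c6 \<bullet> d6" "e6 \<bullet> f6"]
    tensor_act_sweedler ..

definition cup_form :: "('h \<Rightarrow> 'h \<Rightarrow> 'k) \<Rightarrow> (slot4 \<Rightarrow> 'h) \<Rightarrow> 'k"
  where "cup_form B w = B (w A4 * \<beta> * S (w D4)) (w B4 * \<beta> * S (w C4))"

text \<open>As for \<open>\<gamma>_form_invariant\<close>, with the two nested cups absorbing from the right.\<close>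

lemma \<delta>_invariant:
  assumes B: "bilinear_form B"
  shows "sweedler (\<Delta> h) (\<lambda>v. eval2 B (\<Delta> (v ! 0) \<star> \<delta> \<star> cop_antipode (v ! 1))) = \<epsilon> h * eval2 B \<delta>"
proof -
  let ?F = "cup_form B"
  have F: "multilinear ?F"
    unfolding multilinear_def
  proof (intro allI)
    fix w i show "linform (\<lambda>a. ?F (w(i := a)))"
      using B by (cases i) (auto simp: cup_form_def linear_simps)
  qed
  have inv: "right_invariant A4 D4 ?F" "right_invariant B4 C4 ?F"
    subgoal
      using antipode_\<beta>_form[of "\<lambda>a. B (w A4 * a * S (w D4)) (w B4 * \<beta> * S (w C4))" for w,
          OF linform_middle[OF bilinear_formD(2)[OF B]]]
      by (simp add: right_invariant_def cup_form_def fun_eq_iff mult.assoc S_mult)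
    subgoal
      using antipode_\<beta>_form[of "\<lambda>a. B (w A4 * \<beta> * S (w D4)) (w B4 * a * S (w C4))" for w,
          OF linform_middle[OF bilinear_formD(1)[OF B]]]
      by (simp add: right_invariant_def cup_form_def fun_eq_iff mult.assoc S_mult)
    done
  have eval: "eval2 B (\<Delta> x \<star> \<delta> \<star> cop_antipode y)
    = (?F \<lhd> tree_act (a4 \<bullet> b4) x \<lhd> tree_act (c4 \<bullet> d4) y \<lhd> assoc (a4 \<bullet> b4) c4 d4 \<lhd> assoc_inv a4 b4 c4) (\<lambda>_. 1)" for x y
  proof -
    have C: "bilinear_form (\<lambda>p q. eval2 (\<lambda>c d. eval2 (\<lambda>a b. B (a * p * c) (b * q * d)) (\<Delta> x)) (cop_antipode y))"
      unfolding eval2_def by (intro bilinear_form_sweedler bilinear_form_compose B)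
    have C': "bilinear_form (\<lambda>c d. eval2 (\<lambda>a b. B (a * p * c) (b * q * d)) (\<Delta> x))" for p q
      unfolding eval2_def by (intro bilinear_form_sweedler bilinear_form_mult B)
    show ?thesis
      unfolding eval2_sandwich(2)[OF \<Delta>_closed \<delta>_closed cop_antipode_closed B]
    proof (rule \<delta>_act[symmetric], goal_cases)
      case (3 w)
      then show ?case
        unfolding eval2_cop_antipode[OF C'] unfolding eval2_def[of _ "\<Delta> y"] eval2_def[of _ "\<Delta> x"]
        by (simp add: cup_form_def S_mult mult.assoc)
    qed (use C in auto)
  qed
  let ?Y = "?F \<lhd> assoc (a4 \<bullet> b4) c4 d4 \<lhd> assoc_inv a4 b4 c4"
  have rY: "right_invariant A4 D4 ?Y" "right_invariant B4 C4 ?Y"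
    using inv by (auto intro: right_invariant_tensor_act)
  have "sweedler (\<Delta> h) (\<lambda>v. eval2 B (\<Delta> (v ! 0) \<star> \<delta> \<star> cop_antipode (v ! 1)))
    = (?F \<lhd> tree_act ((a4 \<bullet> b4) \<bullet> (c4 \<bullet> d4)) h \<lhd> assoc (a4 \<bullet> b4) c4 d4 \<lhd> assoc_inv a4 b4 c4) (\<lambda>_. 1)"
    unfolding eval tree_act.simps(2)[of "a4 \<bullet> b4"] tensor_act_sweedler ..
  also have "?F \<lhd> tree_act ((a4 \<bullet> b4) \<bullet> (c4 \<bullet> d4)) h \<lhd> assoc (a4 \<bullet> b4) c4 d4
    = ?F \<lhd> assoc (a4 \<bullet> b4) c4 d4 \<lhd> tree_act (((a4 \<bullet> b4) \<bullet> c4) \<bullet> d4) h"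
    by (rule assoc_natural) (use F in auto)
  also have "\<dots> \<lhd> assoc_inv a4 b4 c4 = ?Y \<lhd> tree_act ((a4 \<bullet> (b4 \<bullet> c4)) \<bullet> d4) h"
    using assoc_natural_at(2)[of "?F \<lhd> assoc (a4 \<bullet> b4) c4 d4" a4 b4 c4 "[]" "[d4]" 2 "\<Delta> h"] F
    by (simp only: tree_act_Node append_Nil) simp
  also have "(?Y \<lhd> tree_act ((a4 \<bullet> (b4 \<bullet> c4)) \<bullet> d4) h) (\<lambda>_. 1) = (?Y \<lhd> tree_act (a4 \<bullet> d4) h) (\<lambda>_. 1)"
  proof -
    have "(?Y \<lhd> tensor_act (\<Delta> h) ([] @ (a4 \<bullet> (b4 \<bullet> c4)) # [d4])) (\<lambda>_. 1) = (?Y \<lhd> tensor_act (\<Delta> h) ([] @ a4 # [d4])) (\<lambda>_. 1)"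
      by (rule right_replace[where i = B4 and j = C4 and n = 2])
        (use F rY in \<open>auto simp: right_reduce_right simp del: tree_act.simps\<close>)
    then show ?thesis by (simp only: tree_act_Node append_Nil)
  qed
  also have "\<dots> = \<epsilon> h * ?Y (\<lambda>_. 1)"
    by (rule right_invariantD[OF rY(1)]) simp
  also have "?Y (\<lambda>_. 1) = eval2 B \<delta>"
    by (rule \<delta>_act) (auto simp: cup_form_def B)
  finally show ?thesis .
qed

lemma linform_sandwich_\<Delta>:
  assumes "bilinear_form B" "s \<in> carrier (\<T> 2)" "t \<in> carrier (\<T> 2)"
  shows "linform (\<lambda>h. eval2 B (s \<star> \<Delta> h \<star> t))"
  using assms by (simp add: eval2_sandwich(1) linform_eval2_\<Delta> bilinear_form_sandwich)

lemma linform_sandwich_cop_antipode: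
  assumes B: "bilinear_form B" and c: "s \<in> carrier (\<T> 2)" "t \<in> carrier (\<T> 2)"
  shows "linform (\<lambda>h. eval2 B (s \<star> cop_antipode h \<star> t))"
  unfolding eval2_sandwich(1)[OF c(1) cop_antipode_closed c(2) B] eval2_cop_antipode[OF bilinear_form_sandwich[OF B]]
  by (rule linform_eval2_\<Delta>) (rule bilinear_form_flip[OF bilinear_form_endo[OF bilinear_form_sandwich[OF B] S_endo]])

text \<open>Here \<open>\<delta>\<close>, \<open>\<gamma>\<close> and \<open>\<beta>\<close> are cup, cap and cup on four consecutive slots, of which the last two slots belong to the given
dual. The pentagon moves the associator from the last three to the first three slots, where the snake
identity applies.\<close>

lemma \<delta>_twist: "\<delta> \<star> drinfeld_twist = \<Delta> \<beta>"
proof (rule tensor2_eqI)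
  fix B assume B: "bilinear_form B"
  define N where "N p q r = eval2 B (\<Delta> p \<star> \<delta> \<star> (cop_antipode q \<star> \<gamma> \<star> \<Delta> r))" for p q r
  have lin: "linform (\<lambda>p. N p q r)" "linform (\<lambda>q. N p q r)" "linform (\<lambda>r. N p q r)" for p q r
    using linform_sandwich_\<Delta>[OF B T2.one_closed, of "\<delta> \<star> (cop_antipode q \<star> \<gamma> \<star> \<Delta> r)"]
      linform_sandwich_cop_antipode[OF B, of "\<Delta> p \<star> \<delta>" "\<gamma> \<star> \<Delta> r"]
      linform_sandwich_\<Delta>[OF B, of "\<Delta> p \<star> \<delta> \<star> (cop_antipode q \<star> \<gamma>)" "\<one>\<^bsub>\<T> 2\<^esub>"]
    unfolding N_def by (simp_all add: T2.m_assoc)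
  have inv23: "sweedler (\<Delta> h) (\<lambda>v. N p (v ! 0 * q) (v ! 1 * r)) = \<epsilon> h * N p q r" for h p q r
  proof -
    let ?B = "\<lambda>c d. eval2 (\<lambda>a b. B (a * c) (b * d)) (\<Delta> p \<star> \<delta>)"
    have "N p x y = \<gamma>_pairing ?B x y" for x y
      unfolding N_def \<gamma>_pairing_def by (rule eval2_mult_right) (use B in auto)
    then show ?thesis
      using \<gamma>_pairing_invariant[OF bilinear_form_eval2(2)[OF B]] by (simp add: invariant_form_def)
  qed
  have inv12: "sweedler (\<Delta> h) (\<lambda>v. N (p * v ! 0) (q * v ! 1) r) = \<epsilon> h * N p q r" for h p q r
  proof -
    let ?t = "cop_antipode q \<star> \<gamma> \<star> \<Delta> r"
    let ?B = "\<lambda>x y. eval2 (\<lambda>a b. eval2 (\<lambda>c d. B (a * x * c) (b * y * d)) ?t) (\<Delta> p)"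
    have "N (p * x) (q * y) r = eval2 B (\<Delta> p \<star> (\<Delta> x \<star> \<delta> \<star> cop_antipode y) \<star> ?t)" for x y
      unfolding N_def by (simp add: \<Delta>_mult cop_antipode_mult T2.m_assoc)
    then have 1: "N (p * x) (q * y) r = eval2 ?B (\<Delta> x \<star> \<delta> \<star> cop_antipode y)" for x y
      using B by (simp add: eval2_sandwich(1))
    have "N p q r = eval2 ?B \<delta>"
      unfolding N_def by (rule eval2_sandwich(1)) (use B in auto)
    then show ?thesis
      unfolding 1 using \<delta>_invariant[OF bilinear_form_sandwich[OF B]] by simp
  qed
  define F :: "(slot4 \<Rightarrow> 'h) \<Rightarrow> 'k" where "F = (\<lambda>w. N (w A4) (w B4) (w C4 * \<beta> * S (w D4)))"
  have F: "multilinear F"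
    unfolding multilinear_def
  proof (intro allI)
    fix w i show "linform (\<lambda>a. F (w(i := a)))"
      using lin
      by (cases i) (auto simp: F_def linear_simps)
  qed
  have bc: "left_invariant (b4 \<bullet> c4) F"
    using inv23[of _ "w A4" "w B4" "w C4 * \<beta> * S (w D4)" for w]
    by (simp add: left_invariant_def F_def fun_eq_iff mult.assoc)
  have ab: "right_invariant A4 B4 F"
    using inv12 by (simp add: right_invariant_def F_def)
  have cd: "right_invariant C4 D4 F"
    using antipode_\<beta>_form[of "\<lambda>a. N (w A4) (w B4) (w C4 * a * S (w D4))" for w, OF linform_middle[OF lin(3)]]
    by (simp add: right_invariant_def F_def fun_eq_iff mult.assoc S_mult)
  let ?V = "F \<lhd> assoc_inv b4 c4 d4"
  have "eval2 B (\<delta> \<star> drinfeld_twist) = sweedler \<Phi>_inv (\<lambda>x. N 1 (x ! 0) (x ! 1 * \<beta> * S (x ! 2)))"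
    using eval2_twist_sandwich[OF B \<delta>_closed T2.one_closed] by (simp add: N_def \<Delta>_one T2.m_assoc)
  also have "\<dots> = ?V (\<lambda>_. 1)"
    by (simp add: tensor_act_3) (simp add: F_def)
  also have "\<dots> = (?V \<lhd> assoc a4 b4 (c4 \<bullet> d4)) (\<lambda>_. 1)"
    by (rule assoc_right_absorb[symmetric]) (use F cd in \<open>auto intro: right_invariant_tensor_act\<close>)
  also have "\<dots> = (?V \<lhd> assoc a4 b4 (c4 \<bullet> d4) \<lhd> assoc (a4 \<bullet> b4) c4 d4) (\<lambda>_. 1)"
    by (rule assoc_right_absorb[symmetric]) (use F ab in \<open>auto intro!: right_invariant_tensor_act\<close>)
  also have "?V \<lhd> assoc a4 b4 (c4 \<bullet> d4) \<lhd> assoc (a4 \<bullet> b4) c4 d4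
    = ?V \<lhd> assoc b4 c4 d4 \<lhd> assoc a4 (b4 \<bullet> c4) d4 \<lhd> assoc a4 b4 c4"
    by (rule pentagon_act[symmetric]) (use F in auto)
  also have "?V \<lhd> assoc b4 c4 d4 = F"
    by (rule assoc_inv) (use F in auto)
  also have "F \<lhd> assoc a4 (b4 \<bullet> c4) d4 = F"
    by (rule assoc_absorb) (use F bc in auto)
  also have "(F \<lhd> assoc a4 b4 c4) (\<lambda>_. 1) = sweedler \<Phi> (\<lambda>X. N (X ! 0) (X ! 1) (X ! 2 * \<beta>))"
    by (simp add: tensor_act_3) (simp add: F_def S_one)
  also have "\<dots> = sweedler \<Phi> (\<lambda>X. eval2 (\<lambda>a b. eval2 (\<lambda>c d. B (a * c) (b * d)) (\<Delta> \<beta>)) (\<Delta> (X ! 0) \<star> \<delta> \<star>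
      (cop_antipode (X ! 1) \<star> \<gamma> \<star> \<Delta> (X ! 2))))"
    using B by (simp add: N_def \<Delta>_mult T2.m_assoc[symmetric] eval2_mult[symmetric])
  also have "\<dots> = eval2 B (\<Delta> \<beta>)"
    using snake_\<Phi>[OF bilinear_form_eval2(1)[OF B]] by simp
  finally show "eval2 B (\<delta> \<star> drinfeld_twist) = eval2 B (\<Delta> \<beta>)" .
qed auto

text \<open>The comparison of duals in the opposite direction.\<close>

definition twist_inv :: "'h list list set"
  where "twist_inv = tensor_sum 2
    [\<Delta> (S x1 * \<alpha> * x2) \<star> \<delta> \<star> cop_antipode x3. [x1, x2, x3] \<leftarrow> summands \<Phi>_inv]"

lemma twist_inv_summands_closed:
  "t \<in> set [\<Delta> (S x1 * \<alpha> * x2) \<star> \<delta> \<star> cop_antipode x3. [x1, x2, x3] \<leftarrow> summands \<Phi>_inv] \<Longrightarrow> t \<in> carrier (\<T> 2)"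
  by (auto split: list.splits)

lemma twist_inv_closed [simp]: "twist_inv \<in> carrier (\<T> 2)"
  unfolding twist_inv_def by (rule tensor_sum_closed[OF twist_inv_summands_closed])

lemma eval2_twist_inv:
  assumes "bilinear_form B"
  shows "eval2 B twist_inv = sweedler \<Phi>_inv (\<lambda>x. eval2 B (\<Delta> (S (x ! 0) * \<alpha> * x ! 1) \<star> \<delta> \<star> cop_antipode (x ! 2)))"
  unfolding twist_inv_def
  by (subst eval2_tensor_sum[OF twist_inv_summands_closed assms]) (simp_all add: sum_comprehension_3[OF \<Phi>_carrier(2)])

lemma twist_inverse: "drinfeld_twist \<star> twist_inv = \<one>\<^bsub>\<T> 2\<^esub>" "twist_inv \<star> drinfeld_twist = \<one>\<^bsub>\<T> 2\<^esub>"
proof -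
  show "drinfeld_twist \<star> twist_inv = \<one>\<^bsub>\<T> 2\<^esub>"
  proof (rule tensor2_eqI)
    fix B assume B: "bilinear_form B"
    have step: "drinfeld_twist \<star> (\<Delta> (S x * \<alpha> * y) \<star> \<delta> \<star> cop_antipode z)
      = (cop_antipode x \<star> \<gamma> \<star> \<Delta> y) \<star> \<delta> \<star> cop_antipode z" for x y z
    proof -
      have "drinfeld_twist \<star> (\<Delta> (S x * \<alpha> * y) \<star> \<delta> \<star> cop_antipode z)
        = (drinfeld_twist \<star> \<Delta> (S x)) \<star> \<Delta> \<alpha> \<star> \<Delta> y \<star> \<delta> \<star> cop_antipode z"
        by (simp add: \<Delta>_mult T2.m_assoc)
      also have "\<dots> = cop_antipode x \<star> (drinfeld_twist \<star> \<Delta> \<alpha>) \<star> \<Delta> y \<star> \<delta> \<star> cop_antipode z"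
        unfolding twist_\<Delta>_S by (simp add: T2.m_assoc)
      finally show ?thesis unfolding twist_\<Delta>_\<alpha> .
    qed
    have "eval2 B (drinfeld_twist \<star> twist_inv) = sweedler \<Phi>_inv (\<lambda>x. eval2 B (drinfeld_twist \<star> (\<Delta> (S (x ! 0) * \<alpha> * x ! 1) \<star> \<delta> \<star> cop_antipode (x ! 2))))"
      using B by (simp add: eval2_mult_right eval2_twist_inv bilinear_form_eval2)
    then show "eval2 B (drinfeld_twist \<star> twist_inv) = eval2 B \<one>\<^bsub>\<T> 2\<^esub>"
      using snake_\<Phi>_inv[OF B] B unfolding step by simp
  qed auto
  show "twist_inv \<star> drinfeld_twist = \<one>\<^bsub>\<T> 2\<^esub>"
  proof (rule tensor2_eqI)
    fix B assume B: "bilinear_form B"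
    have step: "\<Delta> (S x * \<alpha> * y) \<star> \<delta> \<star> cop_antipode z \<star> drinfeld_twist = \<Delta> (S x * \<alpha> * y * \<beta> * S z)" for x y z
    proof -
      have "\<Delta> (S x * \<alpha> * y) \<star> \<delta> \<star> cop_antipode z \<star> drinfeld_twist
        = \<Delta> (S x * \<alpha> * y) \<star> (\<delta> \<star> (cop_antipode z \<star> drinfeld_twist))"
        by (simp add: T2.m_assoc)
      also have "\<delta> \<star> (cop_antipode z \<star> drinfeld_twist) = \<delta> \<star> drinfeld_twist \<star> \<Delta> (S z)"
        unfolding twist_\<Delta>_S[symmetric] by (simp add: T2.m_assoc)
      finally show ?thesis unfolding \<delta>_twist by (simp add: \<Delta>_mult T2.m_assoc)
    qed
    have "eval2 B (twist_inv \<star> drinfeld_twist) = sweedler \<Phi>_inv (\<lambda>x. eval2 B (\<Delta> (S (x ! 0) * \<alpha> * x ! 1) \<star> \<delta> \<star> cop_antipode (x ! 2) \<star> drinfeld_twist))"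
      using B by (simp add: eval2_mult eval2_twist_inv bilinear_form_eval2)
    also have "\<dots> = eval2 B (\<Delta> 1)"
      unfolding step by (rule antipode_\<Phi>_inv_form[OF linform_eval2_\<Delta>[OF B]])
    finally show "eval2 B (twist_inv \<star> drinfeld_twist) = eval2 B \<one>\<^bsub>\<T> 2\<^esub>"
      by (simp add: \<Delta>_one)
  qed auto
qed

end

section \<open>The braiding\<close>

context quasitriangular_quasi_hopf_algebra
begin

interpretation T2: monoid "\<T> 2"
  by (rule tensor_power_monoid)

abbreviation R_inv :: "'h list list set"
  where "R_inv \<equiv> inv\<^bsub>\<T> 2\<^esub> R"

lemma R_closed [simp]: "R \<in> carrier (\<T> 2)" "R_inv \<in> carrier (\<T> 2)"
  using R_unit by auto

abbreviation braid :: "'i tree \<Rightarrow> 'i tree \<Rightarrow> (('i \<Rightarrow> 'h) \<Rightarrow> 'k) \<Rightarrow> ('i \<Rightarrow> 'h) \<Rightarrow> 'k"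
  where "braid A B \<equiv> tensor_act R [A, B]"

abbreviation braid_inv :: "'i tree \<Rightarrow> 'i tree \<Rightarrow> (('i \<Rightarrow> 'h) \<Rightarrow> 'k) \<Rightarrow> ('i \<Rightarrow> 'h) \<Rightarrow> 'k"
  where "braid_inv A B \<equiv> tensor_act R_inv [A, B]"

lemma braid_inv [simp]:
  assumes "multilinear F" "disjoint_trees [A, B]"
  shows "F \<lhd> braid A B \<lhd> braid_inv A B = F" "F \<lhd> braid_inv A B \<lhd> braid A B = F"
  using tensor_act_inv[OF assms(2,1) _ R_unit] by simp_all

lemma braid_natural:
  assumes F: "multilinear F" and d: "disjoint_trees [A, B]"
  shows "F \<lhd> tree_act (B \<bullet> A) h \<lhd> braid A B = F \<lhd> braid A B \<lhd> tree_act (A \<bullet> B) h"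
    "F \<lhd> tree_act (A \<bullet> B) h \<lhd> braid_inv A B = F \<lhd> braid_inv A B \<lhd> tree_act (B \<bullet> A) h"
proof -
  have d': "leaves A \<inter> leaves B = {}" using d by auto
  have *: "F \<lhd> tree_act (B \<bullet> A) h \<lhd> braid A B = F \<lhd> braid A B \<lhd> tree_act (A \<bullet> B) h"
    if F: "multilinear F" for F
    unfolding tree_act_Node tensor_act_flip[OF \<Delta>_closed F d', symmetric]
    using tensor_act_mult[OF d F _ flip_closed[OF \<Delta>_closed] R_closed(1)]
      tensor_act_mult[OF d F _ R_closed(1) \<Delta>_closed] by (simp add: R_\<Delta>)
  show "F \<lhd> tree_act (B \<bullet> A) h \<lhd> braid A B = F \<lhd> braid A B \<lhd> tree_act (A \<bullet> B) h"
    by (rule *[OF F])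
  have "F \<lhd> braid_inv A B \<lhd> tree_act (B \<bullet> A) h
    = F \<lhd> braid_inv A B \<lhd> tree_act (B \<bullet> A) h \<lhd> braid A B \<lhd> braid_inv A B"
    using F d by (simp del: tree_act.simps)
  also have "\<dots> = F \<lhd> tree_act (A \<bullet> B) h \<lhd> braid_inv A B"
    using F d by (subst *) (simp_all del: tree_act.simps)
  finally show "F \<lhd> tree_act (A \<bullet> B) h \<lhd> braid_inv A B = F \<lhd> braid_inv A B \<lhd> tree_act (B \<bullet> A) h" ..
qed

lemma braid_natural_at:
  assumes "multilinear F" "disjoint_trees [A, B]" "length As + 1 + length Bs = n" "t \<in> carrier (\<T> n)"
    and "\<forall>D\<in>set As \<union> set Bs. \<forall>E\<in>{A, B}. leaves D \<inter> leaves E = {}"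
  shows "F \<lhd> tensor_act t (As @ (B \<bullet> A) # Bs) \<lhd> braid A B
      = F \<lhd> braid A B \<lhd> tensor_act t (As @ (A \<bullet> B) # Bs)"
    "F \<lhd> tensor_act t (As @ (A \<bullet> B) # Bs) \<lhd> braid_inv A B
      = F \<lhd> braid_inv A B \<lhd> tensor_act t (As @ (B \<bullet> A) # Bs)"
  by (rule tensor_act_natural[where n = n]; use assms in \<open>auto simp del: tree_act.simps simp: braid_natural\<close>)+

lemma braid_natural_3:
  assumes "multilinear F" "disjoint_trees [A, B, C, D]" "t \<in> carrier (\<T> 3)"
  shows "F \<lhd> tensor_act t [B \<bullet> A, C, D] \<lhd> braid A B = F \<lhd> braid A B \<lhd> tensor_act t [A \<bullet> B, C, D]"
    "F \<lhd> tensor_act t [C, B \<bullet> A, D] \<lhd> braid A B = F \<lhd> braid A B \<lhd> tensor_act t [C, A \<bullet> B, D]"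
    "F \<lhd> tensor_act t [C, D, B \<bullet> A] \<lhd> braid A B = F \<lhd> braid A B \<lhd> tensor_act t [C, D, A \<bullet> B]"
    "F \<lhd> tensor_act t [A \<bullet> B, C, D] \<lhd> braid_inv A B = F \<lhd> braid_inv A B \<lhd> tensor_act t [B \<bullet> A, C, D]"
  using braid_natural_at[OF assms(1) _ _ assms(3), of A B "[]" "[C, D]"]
    braid_natural_at[OF assms(1) _ _ assms(3), of A B "[C]" "[D]"]
    braid_natural_at[OF assms(1) _ _ assms(3), of A B "[C, D]" "[]"] assms(2)
  by (simp_all add: Int_commute)

lemma braid_natural_2:
  assumes "multilinear F" "disjoint_trees [A, B, C]" "t \<in> carrier (\<T> 2)"
  shows "F \<lhd> tensor_act t [B \<bullet> A, C] \<lhd> braid A B = F \<lhd> braid A B \<lhd> tensor_act t [A \<bullet> B, C]"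
    "F \<lhd> tensor_act t [C, B \<bullet> A] \<lhd> braid A B = F \<lhd> braid A B \<lhd> tensor_act t [C, A \<bullet> B]"
  using braid_natural_at[OF assms(1) _ _ assms(3), of A B "[]" "[C]"]
    braid_natural_at[OF assms(1) _ _ assms(3), of A B "[C]" "[]"] assms(2)
  by (simp_all add: Int_commute)

lemma counit_R_form:
  assumes "linform l"
  shows "sweedler R (\<lambda>v. \<epsilon> (v ! 0) * l (v ! 1)) = l 1" "sweedler R (\<lambda>v. \<epsilon> (v ! 1) * l (v ! 0)) = l 1"
  using arg_cong[OF counit_R_left, of l] arg_cong[OF counit_R_right, of l] assms
  by (simp_all add: sum_comprehension_2[OF R_closed(1)] linform_sweedler linformD(2))

lemma braid_absorb:
  assumes F: "multilinear F" and d: "disjoint_trees [A, B]" and "left_invariant A F \<or> left_invariant B F"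
  shows "F \<lhd> braid A B = F" "F \<lhd> braid_inv A B = F"
proof -
  have c: "leaves A \<inter> leaves B = {}" using d by auto
  show *: "F \<lhd> braid A B = F"
    using assms(3)
  proof
    assume "left_invariant A F"
    then show ?thesis
      using counit_R_form(1)[OF linform_tree_act[OF F, of B]] F
      by (simp add: tensor_act_2 left_invariantD tree_act_scale tree_act_one)
  next
    assume "left_invariant B F"
    then show ?thesis
      using counit_R_form(2)[OF linform_tree_act[OF F, of A]] F
      by (simp add: tensor_act_2 tree_act_commute[OF c] left_invariantD tree_act_scale tree_act_one)
  qed
  have "F \<lhd> braid A B \<lhd> braid_inv A B = F"
    using F d by simp
  then show "F \<lhd> braid_inv A B = F" by (simp only: *)
qed

lemma braid_right_absorb:
  assumes F: "multilinear F" and r: "right_invariant i j F" and d: "disjoint_trees [Leaf i \<bullet> Leaf j, B]"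
  shows "(F \<lhd> braid (Leaf i \<bullet> Leaf j) B) (\<lambda>_. 1) = F (\<lambda>_. 1)"
proof -
  have ij: "i \<noteq> j" and c: "leaves (Leaf i \<bullet> Leaf j) \<inter> leaves B = {}" using d by auto
  show ?thesis
    unfolding tensor_act_2[OF R_closed(1)] tree_act_commute[OF c]
      right_invariantD[OF right_invariant_tree_act[OF r ij] ij]
    using counit_R_form(1)[OF linform_tree_act[OF F, of B]] F by (simp add: tree_act_one)
qed

text \<open>Unfold both sides to sums over the components of \<open>\<Phi>\<close>, \<open>R\<close>, \<open>\<Phi>\<^sup>-\<^sup>1\<close>, \<open>R\<close>, \<open>\<Phi>\<close> and sort the actions by strand.\<close>

lemma hexagon_left_act:
  assumes F: "multilinear F" and d: "disjoint_trees [A, B, C]"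
  shows "F \<lhd> braid (A \<bullet> B) C
    = F \<lhd> assoc C A B \<lhd> braid A C \<lhd> assoc_inv A C B \<lhd> braid B C \<lhd> assoc A B C"
proof -
  let ?xs = "[[X2 * R1 * x1 * Y1, X3 * x3 * r1 * Y2, X1 * R2 * x2 * r2 * Y3].
        [X1, X2, X3] \<leftarrow> summands \<Phi>, [R1, R2] \<leftarrow> summands R, [x1, x2, x3] \<leftarrow> summands \<Phi>_inv,
        [r1, r2] \<leftarrow> summands R, [Y1, Y2, Y3] \<leftarrow> summands \<Phi>]"
  have w: "?xs \<in> tensor_words 3"
    by (auto simp: tensor_words_def split: list.splits)
  have c: "leaves A \<inter> leaves B = {}" "leaves A \<inter> leaves C = {}" "leaves B \<inter> leaves C = {}"
    and c': "leaves B \<inter> leaves A = {}" "leaves C \<inter> leaves A = {}" "leaves C \<inter> leaves B = {}"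
    and dl: "distinct_leaves A" "distinct_leaves B" "distinct_leaves C" using d by auto
  note order = tree_act_commute[OF c'(1)] tree_act_commute[OF c'(2)] tree_act_commute[OF c'(3)]
  note mult = tree_act_mult[OF dl(1)] tree_act_mult[OF dl(2)] tree_act_mult[OF dl(3)]
  have "F \<lhd> braid (A \<bullet> B) C = tensor_act (on_factor 3 0 \<Delta> R) [A, B, C] F"
    using tensor_act_on_factor[OF R_closed(1) F, of "[]" "[C]" 0 A B] by simp
  also have "\<dots> = (\<lambda>w. sweedler \<Phi> (\<lambda>X. sweedler R (\<lambda>P. sweedler \<Phi>_inv (\<lambda>x. sweedler R (\<lambda>Q. sweedler \<Phi> (\<lambda>Y.
    (F \<lhd> tree_act A (X ! 1 * P ! 0 * x ! 0 * Y ! 0) \<lhd> tree_act B (X ! 2 * x ! 2 * Q ! 0 * Y ! 1)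
      \<lhd> tree_act C (X ! 0 * P ! 1 * x ! 1 * Q ! 1 * Y ! 2)) w))))))"
    unfolding hexagon_left by (subst tensor_act_tensor[OF w F])
      (simp_all add: sum_comprehension_3[OF \<Phi>_carrier(1)] sum_comprehension_3[OF \<Phi>_carrier(2)]
        sum_comprehension_2[OF R_closed(1)])
  also have "\<dots> = (\<lambda>w. sweedler \<Phi> (\<lambda>X. sweedler R (\<lambda>P. sweedler \<Phi>_inv (\<lambda>x. sweedler R (\<lambda>Q. sweedler \<Phi> (\<lambda>Y.
    (F \<lhd> tree_act C (X ! 0) \<lhd> tree_act A (X ! 1) \<lhd> tree_act B (X ! 2) \<lhd> tree_act A (P ! 0) \<lhd> tree_act C (P ! 1)
      \<lhd> tree_act A (x ! 0) \<lhd> tree_act C (x ! 1) \<lhd> tree_act B (x ! 2) \<lhd> tree_act B (Q ! 0) \<lhd> tree_act C (Q ! 1)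
      \<lhd> tree_act A (Y ! 0) \<lhd> tree_act B (Y ! 1) \<lhd> tree_act C (Y ! 2)) w))))))"
    using F by (simp add: order mult mult.assoc)
  also have "\<dots> = F \<lhd> assoc C A B \<lhd> braid A C \<lhd> assoc_inv A C B \<lhd> braid B C \<lhd> assoc A B C"
    unfolding tensor_act_3[OF \<Phi>_carrier(1), of C A B F] tensor_act_sweedler
      tensor_act_2[OF R_closed(1), of A C "F \<lhd> tree_act C x \<lhd> tree_act A y \<lhd> tree_act B z" for x y z]
      tensor_act_3[OF \<Phi>_carrier(2), of A C B "F \<lhd> tree_act C x \<lhd> tree_act A y \<lhd> tree_act B z
        \<lhd> tree_act A x' \<lhd> tree_act C y'" for x y z x' y']
      tensor_act_2[OF R_closed(1), of B C "F \<lhd> tree_act C x \<lhd> tree_act A y \<lhd> tree_act B z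
        \<lhd> tree_act A x' \<lhd> tree_act C y' \<lhd> tree_act A x'' \<lhd> tree_act C y'' \<lhd> tree_act B z''"
        for x y z x' y' x'' y'' z'']
      tensor_act_3[OF \<Phi>_carrier(1), of A B C "F \<lhd> tree_act C x \<lhd> tree_act A y \<lhd> tree_act B z
        \<lhd> tree_act A x' \<lhd> tree_act C y' \<lhd> tree_act A x'' \<lhd> tree_act C y'' \<lhd> tree_act B z''
        \<lhd> tree_act B p \<lhd> tree_act C q" for x y z x' y' x'' y'' z'' p q] ..
  finally show ?thesis .
qed

lemma hexagon_right_act:
  assumes F: "multilinear F" and d: "disjoint_trees [A, B, C]"
  shows "F \<lhd> braid A (B \<bullet> C)
    = F \<lhd> assoc_inv B C A \<lhd> braid A C \<lhd> assoc B A C \<lhd> braid A B \<lhd> assoc_inv A B C"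
proof -
  let ?xs = "[[x3 * R1 * X2 * r1 * y1, x1 * X1 * r2 * y2, x2 * R2 * X3 * y3].
        [x1, x2, x3] \<leftarrow> summands \<Phi>_inv, [R1, R2] \<leftarrow> summands R, [X1, X2, X3] \<leftarrow> summands \<Phi>,
        [r1, r2] \<leftarrow> summands R, [y1, y2, y3] \<leftarrow> summands \<Phi>_inv]"
  have w: "?xs \<in> tensor_words 3"
    by (auto simp: tensor_words_def split: list.splits)
  have c': "leaves B \<inter> leaves A = {}" "leaves C \<inter> leaves A = {}" "leaves C \<inter> leaves B = {}"
    and dl: "distinct_leaves A" "distinct_leaves B" "distinct_leaves C" using d by auto
  note order = tree_act_commute[OF c'(1)] tree_act_commute[OF c'(2)] tree_act_commute[OF c'(3)]
  note mult = tree_act_mult[OF dl(1)] tree_act_mult[OF dl(2)] tree_act_mult[OF dl(3)]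
  have "F \<lhd> braid A (B \<bullet> C) = tensor_act (on_factor 3 1 \<Delta> R) [A, B, C] F"
    using tensor_act_on_factor[OF R_closed(1) F, of "[A]" "[]" 1 B C] by simp
  also have "\<dots> = (\<lambda>w. sweedler \<Phi>_inv (\<lambda>x. sweedler R (\<lambda>P. sweedler \<Phi> (\<lambda>X. sweedler R (\<lambda>Q. sweedler \<Phi>_inv (\<lambda>y.
    (F \<lhd> tree_act A (x ! 2 * P ! 0 * X ! 1 * Q ! 0 * y ! 0) \<lhd> tree_act B (x ! 0 * X ! 0 * Q ! 1 * y ! 1)
      \<lhd> tree_act C (x ! 1 * P ! 1 * X ! 2 * y ! 2)) w))))))"
    unfolding hexagon_right by (subst tensor_act_tensor[OF w F])
      (simp_all add: sum_comprehension_3[OF \<Phi>_carrier(1)] sum_comprehension_3[OF \<Phi>_carrier(2)]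
        sum_comprehension_2[OF R_closed(1)])
  also have "\<dots> = (\<lambda>w. sweedler \<Phi>_inv (\<lambda>x. sweedler R (\<lambda>P. sweedler \<Phi> (\<lambda>X. sweedler R (\<lambda>Q. sweedler \<Phi>_inv (\<lambda>y.
    (F \<lhd> tree_act B (x ! 0) \<lhd> tree_act C (x ! 1) \<lhd> tree_act A (x ! 2) \<lhd> tree_act A (P ! 0) \<lhd> tree_act C (P ! 1)
      \<lhd> tree_act B (X ! 0) \<lhd> tree_act A (X ! 1) \<lhd> tree_act C (X ! 2) \<lhd> tree_act A (Q ! 0) \<lhd> tree_act B (Q ! 1)
      \<lhd> tree_act A (y ! 0) \<lhd> tree_act B (y ! 1) \<lhd> tree_act C (y ! 2)) w))))))"
    using F by (simp add: order mult mult.assoc)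
  also have "\<dots> = F \<lhd> assoc_inv B C A \<lhd> braid A C \<lhd> assoc B A C \<lhd> braid A B \<lhd> assoc_inv A B C"
    unfolding tensor_act_3[OF \<Phi>_carrier(2), of B C A F] tensor_act_sweedler
      tensor_act_2[OF R_closed(1), of A C "F \<lhd> tree_act B x \<lhd> tree_act C y \<lhd> tree_act A z" for x y z]
      tensor_act_3[OF \<Phi>_carrier(1), of B A C "F \<lhd> tree_act B x \<lhd> tree_act C y \<lhd> tree_act A z
        \<lhd> tree_act A x' \<lhd> tree_act C y'" for x y z x' y']
      tensor_act_2[OF R_closed(1), of A B "F \<lhd> tree_act B x \<lhd> tree_act C y \<lhd> tree_act A z
        \<lhd> tree_act A x' \<lhd> tree_act C y' \<lhd> tree_act B x'' \<lhd> tree_act A y'' \<lhd> tree_act C z''"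
        for x y z x' y' x'' y'' z'']
      tensor_act_3[OF \<Phi>_carrier(2), of A B C "F \<lhd> tree_act B x \<lhd> tree_act C y \<lhd> tree_act A z
        \<lhd> tree_act A x' \<lhd> tree_act C y' \<lhd> tree_act B x'' \<lhd> tree_act A y'' \<lhd> tree_act C z''
        \<lhd> tree_act A p \<lhd> tree_act B q" for x y z x' y' x'' y'' z'' p q] ..
  finally show ?thesis .
qed

lemma pentagon_middle:
  assumes "multilinear F" "disjoint_trees [A, B, D, C]"
  shows "F \<lhd> assoc_inv B D C \<lhd> assoc A B (D \<bullet> C) \<lhd> assoc (A \<bullet> B) D C \<lhd> assoc_inv A B D
    = F \<lhd> assoc A (B \<bullet> D) C"
proof -
  have dis: "disjoint_trees [A, B, D]" "disjoint_trees [B, D, C]"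
    using assms(2) by auto
  note can = assoc_inv[OF _ dis(1)] assoc_inv[OF _ dis(2)]
  show ?thesis
    using assms(1) by (simp only: pentagon_act[OF _ assms(2), symmetric] can multilinear_tensor_act)
qed

lemma hexagon_variants:
  assumes F: "multilinear F" and d: "disjoint_trees [A, B, C]"
  shows hexagon_inverse: "F \<lhd> assoc A B C \<lhd> braid_inv A B
      = F \<lhd> braid_inv A (B \<bullet> C) \<lhd> assoc_inv B C A \<lhd> braid A C \<lhd> assoc B A C"
    and hexagon_left_tail: "F \<lhd> braid B C \<lhd> assoc_inv B C A \<lhd> braid A C \<lhd> assoc B A C
      = F \<lhd> assoc_inv C B A \<lhd> braid (B \<bullet> A) C"
    and hexagon_right_tail: "F \<lhd> assoc_inv B C A \<lhd> braid A C \<lhd> assoc B A C \<lhd> braid A B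
      = F \<lhd> braid A (B \<bullet> C) \<lhd> assoc A B C"
proof -
  have dis: "disjoint_trees [A, B, C]" "disjoint_trees [C, B, A]" "disjoint_trees [B, C, A]" "disjoint_trees [B, A, C]"
    "disjoint_trees [A, B]" "disjoint_trees [A, C]" "disjoint_trees [B, C]" "disjoint_trees [A, B \<bullet> C]"
    using d by auto
  note can = assoc_inv[OF _ dis(1)] assoc_inv[OF _ dis(2)] assoc_inv[OF _ dis(3)] assoc_inv[OF _ dis(4)]
    braid_inv[OF _ dis(5)] braid_inv[OF _ dis(6)] braid_inv[OF _ dis(7)] braid_inv[OF _ dis(8)]
  show "F \<lhd> assoc_inv B C A \<lhd> braid A C \<lhd> assoc B A C \<lhd> braid A B
      = F \<lhd> braid A (B \<bullet> C) \<lhd> assoc A B C"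
    using F by (simp only: hexagon_right_act[OF _ d] can multilinear_tensor_act)
  show "F \<lhd> braid B C \<lhd> assoc_inv B C A \<lhd> braid A C \<lhd> assoc B A C
      = F \<lhd> assoc_inv C B A \<lhd> braid (B \<bullet> A) C"
    using F by (simp only: hexagon_left_act[OF _ dis(4)] can multilinear_tensor_act)
  let ?G = "F \<lhd> braid_inv A (B \<bullet> C)"
  have "?G \<lhd> assoc_inv B C A \<lhd> braid A C \<lhd> assoc B A C \<lhd> braid A B \<lhd> assoc_inv A B C = F"
    using F by (simp only: hexagon_right_act[OF _ d, symmetric] can multilinear_tensor_act)
  then have "?G \<lhd> assoc_inv B C A \<lhd> braid A C \<lhd> assoc B A C \<lhd> braid A B \<lhd> assoc_inv A B C
      \<lhd> assoc A B C \<lhd> braid_inv A B = F \<lhd> assoc A B C \<lhd> braid_inv A B"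
    by simp
  then show "F \<lhd> assoc A B C \<lhd> braid_inv A B
      = F \<lhd> braid_inv A (B \<bullet> C) \<lhd> assoc_inv B C A \<lhd> braid A C \<lhd> assoc B A C"
    using F by (simp only: can multilinear_tensor_act)
qed

text \<open>A crossing over one leg of a cap is the inverse of the crossing over the other leg.\<close>

lemma hexagon_right_head:
  assumes F: "multilinear F" and d: "disjoint_trees [D, B, C]" and inv: "left_invariant (B \<bullet> C) F"
  shows "F \<lhd> assoc_inv B C D \<lhd> braid D C = F \<lhd> assoc D B C \<lhd> braid_inv D B \<lhd> assoc_inv B D C"
proof -
  have dis: "disjoint_trees [D, B, C]" "disjoint_trees [B, D, C]" "disjoint_trees [D, B]" using d by auto
  note can = assoc_inv[OF _ dis(1)] assoc_inv[OF _ dis(2)] braid_inv[OF _ dis(3)]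
  have "F \<lhd> braid D (B \<bullet> C) = F"
    by (rule braid_absorb) (use F d inv in auto)
  then have "F \<lhd> assoc_inv B C D \<lhd> braid D C \<lhd> assoc B D C \<lhd> braid D B \<lhd> assoc_inv D B C = F"
    by (simp only: hexagon_right_act[OF F d])
  then have "F \<lhd> assoc_inv B C D \<lhd> braid D C \<lhd> assoc B D C \<lhd> braid D B \<lhd> assoc_inv D B C
      \<lhd> assoc D B C \<lhd> braid_inv D B \<lhd> assoc_inv B D C
    = F \<lhd> assoc D B C \<lhd> braid_inv D B \<lhd> assoc_inv B D C"
    by simp
  then show ?thesis
    using F by (simp only: can multilinear_tensor_act)
qed

text \<open>To be used when \<open>b\<^sub>4\<close>, \<open>a\<^sub>4\<close> leave a common cup and \<open>c\<^sub>4\<close>, \<open>b\<^sub>4\<close> enter a common cap. Instead of undoing the crossing of \<open>a\<^sub>4\<close> and \<open>b\<^sub>4\<close> and then crossing \<open>b\<^sub>4\<close> over \<open>c\<^sub>4\<close>,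
move the whole bundle \<open>b\<^sub>4a\<^sub>4\<close> over \<open>c\<^sub>4\<close> and take \<open>a\<^sub>4\<close> back under the bundle \<open>c\<^sub>4b\<^sub>4\<close>. Then all operators but
one act on one of these bundles.\<close>

lemma cup_slides_through_crossing:
  fixes F :: "(slot4 \<Rightarrow> 'h) \<Rightarrow> 'k"
  assumes F: "multilinear F"
  shows "F \<lhd> braid b4 c4 \<lhd> assoc_inv b4 c4 d4 \<lhd> assoc a4 b4 (c4 \<bullet> d4) \<lhd> braid_inv a4 b4
    = F \<lhd> assoc a4 (c4 \<bullet> b4) d4 \<lhd> braid_inv a4 (c4 \<bullet> b4) \<lhd> assoc_inv c4 b4 a4 \<lhd> braid (b4 \<bullet> a4) c4 \<lhd> assoc_inv (b4 \<bullet> a4) c4 d4"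
proof -
  have s1: "F \<lhd> braid b4 c4 \<lhd> assoc_inv b4 c4 d4 \<lhd> assoc a4 b4 (c4 \<bullet> d4)
    = F \<lhd> braid b4 c4 \<lhd> assoc a4 (b4 \<bullet> c4) d4 \<lhd> assoc a4 b4 c4 \<lhd> assoc_inv (a4 \<bullet> b4) c4 d4"
    by (rule pentagon_variants(2)[symmetric]) (use F in auto)
  have s2: "F \<lhd> braid b4 c4 \<lhd> assoc a4 (b4 \<bullet> c4) d4
    = F \<lhd> assoc a4 (c4 \<bullet> b4) d4 \<lhd> braid b4 c4"
    by (rule braid_natural_3(2)[symmetric]) (use F in auto)
  have s3: "F \<lhd> assoc a4 (c4 \<bullet> b4) d4 \<lhd> braid b4 c4 \<lhd> assoc a4 b4 c4 \<lhd> assoc_inv (a4 \<bullet> b4) c4 d4 \<lhd> braid_inv a4 b4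
    = F \<lhd> assoc a4 (c4 \<bullet> b4) d4 \<lhd> braid b4 c4 \<lhd> assoc a4 b4 c4 \<lhd> braid_inv a4 b4 \<lhd> assoc_inv (b4 \<bullet> a4) c4 d4"
    by (rule braid_natural_3(4)) (use F in auto)
  have s4: "F \<lhd> assoc a4 (c4 \<bullet> b4) d4 \<lhd> braid b4 c4 \<lhd> assoc a4 b4 c4 \<lhd> braid_inv a4 b4
    = F \<lhd> assoc a4 (c4 \<bullet> b4) d4 \<lhd> braid b4 c4 \<lhd> braid_inv a4 (b4 \<bullet> c4) \<lhd> assoc_inv b4 c4 a4 \<lhd> braid a4 c4 \<lhd> assoc b4 a4 c4"
    by (rule hexagon_inverse) (use F in auto)
  have s5: "F \<lhd> assoc a4 (c4 \<bullet> b4) d4 \<lhd> braid b4 c4 \<lhd> braid_inv a4 (b4 \<bullet> c4)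
    = F \<lhd> assoc a4 (c4 \<bullet> b4) d4 \<lhd> braid_inv a4 (c4 \<bullet> b4) \<lhd> braid b4 c4"
    by (rule braid_natural_2(2)[symmetric]) (use F in auto)
  have s6: "F \<lhd> assoc a4 (c4 \<bullet> b4) d4 \<lhd> braid_inv a4 (c4 \<bullet> b4) \<lhd> braid b4 c4 \<lhd> assoc_inv b4 c4 a4 \<lhd> braid a4 c4 \<lhd> assoc b4 a4 c4
    = F \<lhd> assoc a4 (c4 \<bullet> b4) d4 \<lhd> braid_inv a4 (c4 \<bullet> b4) \<lhd> assoc_inv c4 b4 a4 \<lhd> braid (b4 \<bullet> a4) c4"
    by (rule hexagon_left_tail) (use F in auto)
  show ?thesis
    unfolding s1 unfolding s2 unfolding s3 unfolding s4 unfolding s5 unfolding s6 ..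
qed

text \<open>Under the nested caps on \<open>b\<^sub>4c\<^sub>4\<close> and \<open>a\<^sub>4d\<^sub>4\<close>, a full twist of \<open>c\<^sub>4\<close> and \<open>d\<^sub>4\<close> followed by the crossing of the two bundles reduces to
one crossing per cap. Of the six crossings, \<open>d\<^sub>4\<close> over \<open>c\<^sub>4\<close> and over \<open>b\<^sub>4\<close> combine to \<open>d\<^sub>4\<close> over the cap \<open>b\<^sub>4c\<^sub>4\<close>, and \<open>c\<^sub>4\<close> over \<open>d\<^sub>4\<close>
and over \<open>a\<^sub>4\<close> to \<open>c\<^sub>4\<close> over the cap \<open>a\<^sub>4d\<^sub>4\<close>; both pairs disappear.\<close>

lemma double_crossing_under_caps:
  fixes F :: "(slot4 \<Rightarrow> 'h) \<Rightarrow> 'k"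
  assumes F: "multilinear F" and bc: "left_invariant (b4 \<bullet> c4) F" and ad: "left_invariant (a4 \<bullet> d4) F"
  shows "F \<lhd> assoc a4 b4 c4 \<lhd> assoc_inv (a4 \<bullet> b4) c4 d4 \<lhd> braid (c4 \<bullet> d4) (a4 \<bullet> b4) \<lhd> braid d4 c4 \<lhd> braid c4 d4
    = F \<lhd> braid c4 b4 \<lhd> braid d4 a4 \<lhd> assoc c4 d4 a4 \<lhd> assoc_inv (c4 \<bullet> d4) a4 b4"
proof -
  have cbinv: "left_invariant (a4 \<bullet> d4) (F \<lhd> braid c4 b4)"
    using ad by (intro left_invariant_tensor_act) auto
  have s1: "F \<lhd> assoc a4 b4 c4 \<lhd> assoc_inv (a4 \<bullet> b4) c4 d4 \<lhd> braid (c4 \<bullet> d4) (a4 \<bullet> b4) \<lhd> braid d4 c4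
    = F \<lhd> assoc a4 b4 c4 \<lhd> assoc_inv (a4 \<bullet> b4) c4 d4 \<lhd> braid d4 c4 \<lhd> braid (d4 \<bullet> c4) (a4 \<bullet> b4)"
    by (rule braid_natural_2(1)) (use F in auto)
  have s2: "F \<lhd> assoc a4 b4 c4 \<lhd> assoc_inv (a4 \<bullet> b4) c4 d4 \<lhd> braid d4 c4 \<lhd> braid (d4 \<bullet> c4) (a4 \<bullet> b4) \<lhd> braid c4 d4
    = F \<lhd> assoc a4 b4 c4 \<lhd> assoc_inv (a4 \<bullet> b4) c4 d4 \<lhd> braid d4 c4 \<lhd> braid c4 d4 \<lhd> braid (c4 \<bullet> d4) (a4 \<bullet> b4)"
    by (rule braid_natural_2(1)) (use F in auto)
  have s3: "F \<lhd> assoc a4 b4 c4 \<lhd> assoc_inv (a4 \<bullet> b4) c4 d4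
    = F \<lhd> assoc_inv a4 (b4 \<bullet> c4) d4 \<lhd> assoc_inv b4 c4 d4 \<lhd> assoc a4 b4 (c4 \<bullet> d4)"
    by (rule pentagon_variants(1)) (use F in auto)
  have s4: "F \<lhd> assoc_inv a4 (b4 \<bullet> c4) d4
    = F"
    by (rule assoc_absorb) (use F bc in auto)
  have s5: "F \<lhd> assoc_inv b4 c4 d4 \<lhd> assoc a4 b4 (c4 \<bullet> d4) \<lhd> braid d4 c4
    = F \<lhd> assoc_inv b4 c4 d4 \<lhd> braid d4 c4 \<lhd> assoc a4 b4 (d4 \<bullet> c4)"
    by (rule braid_natural_3(3)) (use F in auto)
  \<comment> \<open>By the cap on \<open>b\<^sub>4c\<^sub>4\<close>, the crossing of \<open>d\<^sub>4\<close> over \<open>c\<^sub>4\<close> is the inverse of its crossing over \<open>b\<^sub>4\<close>.\<close>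
  have s6: "F \<lhd> assoc_inv b4 c4 d4 \<lhd> braid d4 c4
    = F \<lhd> assoc d4 b4 c4 \<lhd> braid_inv d4 b4 \<lhd> assoc_inv b4 d4 c4"
    by (rule hexagon_right_head) (use F bc in auto)
  have s7: "F \<lhd> assoc d4 b4 c4 \<lhd> braid_inv d4 b4 \<lhd> assoc_inv b4 d4 c4 \<lhd> assoc a4 b4 (d4 \<bullet> c4) \<lhd> braid c4 d4 \<lhd> braid (c4 \<bullet> d4) (a4 \<bullet> b4)
    = F \<lhd> assoc d4 b4 c4 \<lhd> braid_inv d4 b4 \<lhd> assoc_inv b4 d4 c4 \<lhd> assoc a4 b4 (d4 \<bullet> c4) \<lhd> braid (d4 \<bullet> c4) (a4 \<bullet> b4) \<lhd> braid c4 d4"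
    by (rule braid_natural_2(1)[symmetric]) (use F in auto)
  \<comment> \<open>Split the crossing of the bundles to expose \<open>d\<^sub>4\<close> over \<open>b\<^sub>4\<close>, which cancels.\<close>
  have s8: "F \<lhd> assoc d4 b4 c4 \<lhd> braid_inv d4 b4 \<lhd> assoc_inv b4 d4 c4 \<lhd> assoc a4 b4 (d4 \<bullet> c4) \<lhd> braid (d4 \<bullet> c4) (a4 \<bullet> b4)
    = F \<lhd> assoc d4 b4 c4 \<lhd> braid_inv d4 b4 \<lhd> assoc_inv b4 d4 c4 \<lhd> assoc a4 b4 (d4 \<bullet> c4) \<lhd> assoc (a4 \<bullet> b4) d4 c4 \<lhd> braid d4 (a4 \<bullet> b4) \<lhd> assoc_inv d4 (a4 \<bullet> b4) c4 \<lhd> braid c4 (a4 \<bullet> b4) \<lhd> assoc d4 c4 (a4 \<bullet> b4)"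
    by (rule hexagon_left_act) (use F in auto)
  have s9: "F \<lhd> assoc d4 b4 c4 \<lhd> braid_inv d4 b4 \<lhd> assoc_inv b4 d4 c4 \<lhd> assoc a4 b4 (d4 \<bullet> c4) \<lhd> assoc (a4 \<bullet> b4) d4 c4 \<lhd> braid d4 (a4 \<bullet> b4)
    = F \<lhd> assoc d4 b4 c4 \<lhd> braid_inv d4 b4 \<lhd> assoc_inv b4 d4 c4 \<lhd> assoc a4 b4 (d4 \<bullet> c4) \<lhd> assoc (a4 \<bullet> b4) d4 c4 \<lhd> assoc_inv a4 b4 d4 \<lhd> braid d4 b4 \<lhd> assoc a4 d4 b4 \<lhd> braid d4 a4 \<lhd> assoc_inv d4 a4 b4"
    by (rule hexagon_right_act) (use F in auto)
  have s10: "F \<lhd> assoc d4 b4 c4 \<lhd> braid_inv d4 b4 \<lhd> assoc_inv b4 d4 c4 \<lhd> assoc a4 b4 (d4 \<bullet> c4) \<lhd> assoc (a4 \<bullet> b4) d4 c4 \<lhd> assoc_inv a4 b4 d4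
    = F \<lhd> assoc d4 b4 c4 \<lhd> braid_inv d4 b4 \<lhd> assoc a4 (b4 \<bullet> d4) c4"
    by (rule pentagon_middle) (use F in auto)
  have s11: "F \<lhd> assoc d4 b4 c4 \<lhd> braid_inv d4 b4 \<lhd> assoc a4 (b4 \<bullet> d4) c4 \<lhd> braid d4 b4
    = F \<lhd> assoc d4 b4 c4 \<lhd> braid_inv d4 b4 \<lhd> braid d4 b4 \<lhd> assoc a4 (d4 \<bullet> b4) c4"
    by (rule braid_natural_3(2)) (use F in auto)
  have s12: "F \<lhd> assoc d4 b4 c4 \<lhd> braid_inv d4 b4 \<lhd> braid d4 b4
    = F \<lhd> assoc d4 b4 c4"
    by (rule braid_inv) (use F in auto)
  have s13: "F \<lhd> assoc d4 b4 c4 \<lhd> assoc a4 (d4 \<bullet> b4) c4 \<lhd> assoc a4 d4 b4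
    = F \<lhd> assoc a4 d4 (b4 \<bullet> c4) \<lhd> assoc (a4 \<bullet> d4) b4 c4"
    by (rule pentagon_act) (use F in auto)
  have s14: "F \<lhd> assoc a4 d4 (b4 \<bullet> c4)
    = F"
    by (rule assoc_absorb) (use F bc in auto)
  have s15: "F \<lhd> assoc (a4 \<bullet> d4) b4 c4
    = F"
    by (rule assoc_absorb) (use F ad in auto)
  \<comment> \<open>Only the crossings of \<open>c\<^sub>4\<close> with \<open>b\<^sub>4\<close>, \<open>a\<^sub>4\<close>, \<open>d\<^sub>4\<close> and of \<open>d\<^sub>4\<close> with \<open>a\<^sub>4\<close> are left; split those of \<open>c\<^sub>4\<close>.\<close>
  have s16: "F \<lhd> braid d4 a4 \<lhd> assoc_inv d4 a4 b4 \<lhd> assoc_inv d4 (a4 \<bullet> b4) c4 \<lhd> braid c4 (a4 \<bullet> b4)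
    = F \<lhd> braid d4 a4 \<lhd> assoc_inv d4 a4 b4 \<lhd> assoc_inv d4 (a4 \<bullet> b4) c4 \<lhd> assoc_inv a4 b4 c4 \<lhd> braid c4 b4 \<lhd> assoc a4 c4 b4 \<lhd> braid c4 a4 \<lhd> assoc_inv c4 a4 b4"
    by (rule hexagon_right_act) (use F in auto)
  have s17: "F \<lhd> braid d4 a4 \<lhd> assoc_inv d4 a4 b4 \<lhd> assoc_inv d4 (a4 \<bullet> b4) c4 \<lhd> assoc_inv a4 b4 c4
    = F \<lhd> braid d4 a4 \<lhd> assoc_inv (d4 \<bullet> a4) b4 c4 \<lhd> assoc_inv d4 a4 (b4 \<bullet> c4)"
    by (rule pentagon_variants(3)) (use F in auto)
  have s18: "F \<lhd> braid d4 a4 \<lhd> assoc_inv (d4 \<bullet> a4) b4 c4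
    = F \<lhd> assoc_inv (a4 \<bullet> d4) b4 c4 \<lhd> braid d4 a4"
    by (rule braid_natural_3(1)[symmetric]) (use F in auto)
  have s19: "F \<lhd> assoc_inv (a4 \<bullet> d4) b4 c4
    = F"
    by (rule assoc_absorb) (use F ad in auto)
  have s20: "F \<lhd> braid d4 a4 \<lhd> assoc_inv d4 a4 (b4 \<bullet> c4) \<lhd> braid c4 b4
    = F \<lhd> braid d4 a4 \<lhd> braid c4 b4 \<lhd> assoc_inv d4 a4 (c4 \<bullet> b4)"
    by (rule braid_natural_3(3)) (use F in auto)
  have s21: "F \<lhd> braid d4 a4 \<lhd> braid c4 b4 \<lhd> assoc_inv d4 a4 (c4 \<bullet> b4) \<lhd> assoc a4 c4 b4
    = F \<lhd> braid d4 a4 \<lhd> braid c4 b4 \<lhd> assoc (d4 \<bullet> a4) c4 b4 \<lhd> assoc_inv d4 a4 c4 \<lhd> assoc_inv d4 (a4 \<bullet> c4) b4"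
    by (rule pentagon_variants(4)) (use F in auto)
  have s22: "F \<lhd> braid d4 a4 \<lhd> braid c4 b4
    = F \<lhd> braid c4 b4 \<lhd> braid d4 a4"
    by (rule tensor_act_commute) (use F in auto)
  have s23: "F \<lhd> braid c4 b4 \<lhd> braid d4 a4 \<lhd> assoc (d4 \<bullet> a4) c4 b4
    = F \<lhd> braid c4 b4 \<lhd> assoc (a4 \<bullet> d4) c4 b4 \<lhd> braid d4 a4"
    by (rule braid_natural_3(1)[symmetric]) (use F in auto)
  have s24: "F \<lhd> braid c4 b4 \<lhd> assoc (a4 \<bullet> d4) c4 b4
    = F \<lhd> braid c4 b4"
    by (rule assoc_absorb) (use F cbinv in auto)
  have s25: "F \<lhd> braid c4 b4 \<lhd> braid d4 a4 \<lhd> assoc_inv d4 a4 c4 \<lhd> assoc_inv d4 (a4 \<bullet> c4) b4 \<lhd> braid c4 a4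
    = F \<lhd> braid c4 b4 \<lhd> braid d4 a4 \<lhd> assoc_inv d4 a4 c4 \<lhd> braid c4 a4 \<lhd> assoc_inv d4 (c4 \<bullet> a4) b4"
    by (rule braid_natural_3(2)) (use F in auto)
  have s26: "F \<lhd> braid c4 b4 \<lhd> braid d4 a4 \<lhd> assoc_inv d4 a4 c4 \<lhd> braid c4 a4 \<lhd> assoc_inv d4 (c4 \<bullet> a4) b4 \<lhd> assoc_inv c4 a4 b4 \<lhd> assoc d4 c4 (a4 \<bullet> b4)
    = F \<lhd> braid c4 b4 \<lhd> braid d4 a4 \<lhd> assoc_inv d4 a4 c4 \<lhd> braid c4 a4 \<lhd> assoc d4 c4 a4 \<lhd> assoc_inv (d4 \<bullet> c4) a4 b4"
    by (rule pentagon_variants(1)[symmetric]) (use F in auto)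
  have s27: "F \<lhd> braid c4 b4 \<lhd> braid d4 a4 \<lhd> assoc_inv d4 a4 c4 \<lhd> braid c4 a4 \<lhd> assoc d4 c4 a4 \<lhd> assoc_inv (d4 \<bullet> c4) a4 b4 \<lhd> braid c4 d4
    = F \<lhd> braid c4 b4 \<lhd> braid d4 a4 \<lhd> assoc_inv d4 a4 c4 \<lhd> braid c4 a4 \<lhd> assoc d4 c4 a4 \<lhd> braid c4 d4 \<lhd> assoc_inv (c4 \<bullet> d4) a4 b4"
    by (rule braid_natural_3(1)) (use F in auto)
  \<comment> \<open>The crossings of \<open>c\<^sub>4\<close> with \<open>a\<^sub>4\<close> and \<open>d\<^sub>4\<close> form one with the bundle under the other cap.\<close>
  have s28: "F \<lhd> braid c4 b4 \<lhd> braid d4 a4 \<lhd> assoc_inv d4 a4 c4 \<lhd> braid c4 a4 \<lhd> assoc d4 c4 a4 \<lhd> braid c4 d4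
    = F \<lhd> braid c4 b4 \<lhd> braid d4 a4 \<lhd> braid c4 (d4 \<bullet> a4) \<lhd> assoc c4 d4 a4"
    by (rule hexagon_right_tail) (use F in auto)
  have s29: "F \<lhd> braid c4 b4 \<lhd> braid d4 a4 \<lhd> braid c4 (d4 \<bullet> a4)
    = F \<lhd> braid c4 b4 \<lhd> braid c4 (a4 \<bullet> d4) \<lhd> braid d4 a4"
    by (rule braid_natural_2(2)[symmetric]) (use F in auto)
  have s30: "F \<lhd> braid c4 b4 \<lhd> braid c4 (a4 \<bullet> d4)
    = F \<lhd> braid c4 b4"
    by (rule braid_absorb) (use F cbinv in auto)
  show ?thesis
    unfolding s1 unfolding s2 unfolding s3 unfolding s4 unfolding s5 unfolding s6 unfolding s7
    unfolding s8 unfolding s9 unfolding s10 unfolding s11 unfolding s12 unfolding s13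
    unfolding s14 unfolding s15 unfolding s16 unfolding s17 unfolding s18 unfolding s19
    unfolding s20 unfolding s21 unfolding s22 unfolding s23 unfolding s24 unfolding s25
    unfolding s26 unfolding s27 unfolding s28 unfolding s29 unfolding s30 ..
qed

section \<open>The element u\<close>

definition R_cap :: 'h
  where "R_cap = sweedler R (\<lambda>v. S (v ! 1) * \<alpha> * v ! 0)"

lemma R_cap_form: "linform l \<Longrightarrow> sweedler R (\<lambda>v. l (S (v ! 1) * \<alpha> * v ! 0)) = l R_cap"
  by (simp add: R_cap_def linform_sweedler)

lemma bilinear_form_cap: "linform l \<Longrightarrow> bilinear_form (\<lambda>a b. l (S b * x * a))" "linform l \<Longrightarrow> bilinear_form (\<lambda>a b. l (S a * x * b))"
  by (auto simp: linear_simps)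

text \<open>A cap after a crossing is again a cap, for the opposite coproduct.\<close>

lemma R_cap_invariant:
  assumes l: "linform l"
  shows "sweedler (\<Delta> h) (\<lambda>v. l (S (v ! 1) * R_cap * v ! 0)) = \<epsilon> h * l R_cap"
proof -
  let ?W = "\<lambda>a b. l (S b * \<alpha> * a)"
  have W: "bilinear_form ?W" by (rule bilinear_form_cap[OF l])
  have "sweedler (\<Delta> h) (\<lambda>v. l (S (v ! 1) * R_cap * v ! 0)) = eval2 ?W (R \<star> \<Delta> h)"
    unfolding eval2_mult_right[OF R_closed(1) \<Delta>_closed W] unfolding eval2_def
    using R_cap_form[OF linform_middle[OF l], of "S b" a for a b] by (simp add: S_mult mult.assoc)
  also have "\<dots> = eval2 ?W (flip (\<Delta> h) \<star> R)"
    by (simp add: R_\<Delta>)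
  also have "\<dots> = eval2 (\<lambda>c d. eval2 (\<lambda>a b. ?W (b * c) (a * d)) (\<Delta> h)) R"
  proof -
    have "bilinear_form (\<lambda>a b. ?W (a * c) (b * d))" for c d
      by (rule bilinear_form_mult(2)[OF W])
    then show ?thesis using W by (simp add: eval2_mult_right)
  qed
  also have "\<dots> = eval2 (\<lambda>c d. \<epsilon> h * ?W c d) R"
    unfolding eval2_def using antipode_\<alpha>_form[OF linform_middle[OF l], of h "S d" c for c d]
    by (simp add: S_mult mult.assoc)
  also have "\<dots> = \<epsilon> h * l R_cap"
    unfolding eval2_def sweedler_scale using R_cap_form[OF l] by simp
  finally show ?thesis .
qed

lemma R_cap_invariant_form:
  assumes l: "linform l"
  shows "invariant_form (\<lambda>a b. l (S b * R_cap * a))"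
  unfolding invariant_form_def
proof (intro conjI allI)
  show "bilinear_form (\<lambda>a b. l (S b * R_cap * a))" by (rule bilinear_form_cap[OF l])
  show "sweedler (\<Delta> h) (\<lambda>v. l (S (v ! 1 * b) * R_cap * (v ! 0 * a))) = \<epsilon> h * l (S b * R_cap * a)" for h a b
    using R_cap_invariant[OF linform_middle[OF l], of h "S b" a] by (simp add: S_mult mult.assoc)
qed

text \<open>In this form \<open>u\<close> is the comparison of duals for the invariant form \<open>S(b) R_cap a\<close>.\<close>

lemma u_form:
  assumes l: "linform l"
  shows "l u = sweedler \<Phi>_inv (\<lambda>x. l (S (x ! 1 * \<beta> * S (x ! 2)) * R_cap * x ! 0))"
proof -
  have "l u = sweedler R (\<lambda>v. sweedler \<Phi>_inv (\<lambda>x. l (S (v ! 1 * x ! 1 * \<beta> * S (x ! 2)) * \<alpha> * v ! 0 * x ! 0)))"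
    unfolding u_def
    by (simp add: sum_comprehension_2[OF R_closed(1)] sum_comprehension_3[OF \<Phi>_carrier(2)] linform_sweedler[OF l])
  also have "\<dots> = sweedler \<Phi>_inv (\<lambda>x. l (S (x ! 1 * \<beta> * S (x ! 2)) * R_cap * x ! 0))"
    unfolding sweedler_swap[of R]
    using R_cap_form[OF linform_middle[OF l], of "S (p * \<beta> * S q)" r for p q r] by (simp add: S_mult mult.assoc)
  finally show ?thesis .
qed

lemma linform_mult:
  "linform l \<Longrightarrow> linform (\<lambda>a. l (x * a))" "linform l \<Longrightarrow> linform (\<lambda>a. l (a * x))" "linform l \<Longrightarrow> linform (\<lambda>a. l (x * S a))"
  "linform l \<Longrightarrow> linform (\<lambda>a. l (S a * x))" "linform l \<Longrightarrow> linform (\<lambda>a. l (S a))"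
  by (auto simp: linear_simps)

lemma S_\<alpha>_u: "S \<alpha> * u = R_cap"
proof (rule linform_separates)
  fix l assume l: "linform l"
  show "l (S \<alpha> * u) = l R_cap"
    using u_form[OF linform_mult(1)[OF l], of "S \<alpha>"] invariant_form_\<Phi>_inv_\<alpha>[OF R_cap_invariant_form[OF l]]
    by (simp add: S_mult S_one mult.assoc)
qed

lemma S_S_u: "S (S h) * u = u * h"
proof (rule linform_separates)
  fix l assume l: "linform l"
  show "l (S (S h) * u) = l (u * h)"
    using u_form[OF linform_mult(1)[OF l], of "S (S h)"] u_form[OF linform_mult(2)[OF l], of h]
      invariant_form_\<Phi>_inv_move[OF R_cap_invariant_form[OF l], of h]
    by (simp add: S_mult mult.assoc)
qed

definition R_inv_cap :: 'h
  where "R_inv_cap = sweedler R_inv (\<lambda>v. S (v ! 0) * \<alpha> * v ! 1)"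

lemma R_inv_cap_form: "linform l \<Longrightarrow> sweedler R_inv (\<lambda>v. l (S (v ! 0) * \<alpha> * v ! 1)) = l R_inv_cap"
  by (simp add: R_inv_cap_def linform_sweedler)

text \<open>Pull the inverse crossing into \<open>S(\<alpha>)u = R_cap\<close>; the two crossings cancel.\<close>

lemma S_R_inv_cap_u: "S R_inv_cap * u = \<alpha>"
proof (rule linform_separates)
  fix l assume l: "linform l"
  let ?W = "\<lambda>a b. l (S b * \<alpha> * a)"
  have W: "bilinear_form ?W" by (rule bilinear_form_cap[OF l])
  have "l (S R_inv_cap * u) = sweedler R_inv (\<lambda>v. l (S (v ! 1) * S \<alpha> * S (S (v ! 0)) * u))"
    using R_inv_cap_form[OF linform_mult(4)[OF l], of u] by (simp add: S_mult mult.assoc)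
  also have "\<dots> = sweedler R_inv (\<lambda>v. l (S (v ! 1) * R_cap * v ! 0))"
    by (simp add: S_S_u S_\<alpha>_u[symmetric] mult.assoc)
  also have "\<dots> = eval2 ?W (R \<star> R_inv)"
    unfolding eval2_mult_right[OF R_closed W] unfolding eval2_def
    using R_cap_form[OF linform_middle[OF l], of "S b" a for a b] by (simp add: S_mult mult.assoc)
  also have "\<dots> = l \<alpha>"
    using R_unit W by (simp add: S_one)
  finally show "l (S R_inv_cap * u) = l \<alpha>" .
qed

definition R_inv_cup :: 'h
  where "R_inv_cup = sweedler R_inv (\<lambda>v. v ! 1 * \<beta> * S (v ! 0))"

lemma R_inv_cup_form: "linform l \<Longrightarrow> sweedler R_inv (\<lambda>v. l (v ! 1 * \<beta> * S (v ! 0))) = l R_inv_cup"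
  by (simp add: R_inv_cup_def linform_sweedler)

text \<open>A cup whose crossing has been undone, paired with the crossing contained in \<open>u\<close>. Sliding the cup through that crossing leaves
the plain snake.\<close>

lemma u_R_inv_cup: "u * R_inv_cup = S \<beta>"
proof (rule linform_separates)
  fix l assume l: "linform l"
  define F :: "(slot4 \<Rightarrow> 'h) \<Rightarrow> 'k" where "F = (\<lambda>w. l (S (w C4 * \<beta> * S (w D4)) * \<alpha> * w B4 * \<beta> * S (w A4)))"
  have F: "multilinear F"
    unfolding multilinear_def
  proof (intro allI)
    fix w i show "linform (\<lambda>a. F (w(i := a)))"
      using l by (cases i) (auto simp: F_def linear_simps)
  qed
  have cb: "left_invariant (c4 \<bullet> b4) F"
    using antipode_\<alpha>_form[of "\<lambda>a. l (S (w C4 * \<beta> * S (w D4)) * a * (w B4 * \<beta> * S (w A4)))" for w, OF linform_middle[OF l]]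
    by (simp add: left_invariant_def F_def fun_eq_iff mult.assoc S_mult)
  have ba: "right_invariant B4 A4 F"
    using antipode_\<beta>_form[of "\<lambda>a. l ((S (w C4 * \<beta> * S (w D4)) * \<alpha> * w B4) * a * S (w A4))" for w, OF linform_middle[OF l]]
    by (simp add: right_invariant_def F_def fun_eq_iff mult.assoc S_mult)
  have cd: "right_invariant C4 D4 F"
    using antipode_\<beta>_form[of "\<lambda>a. l (S (w C4 * a * S (w D4)) * (\<alpha> * w B4 * \<beta> * S (w A4)))" for w]
      linform_middle[OF linform_mult(4)[OF l]]
    by (simp add: right_invariant_def F_def fun_eq_iff mult.assoc S_mult)
  have "l (u * R_inv_cup) = sweedler R_inv (\<lambda>P. l (u * (P ! 1 * \<beta> * S (P ! 0))))"
    by (rule R_inv_cup_form[OF linform_mult(1)[OF l], symmetric])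
  also have "\<dots> = sweedler R_inv (\<lambda>P. sweedler \<Phi>_inv (\<lambda>x.
      l (S (x ! 1 * \<beta> * S (x ! 2)) * R_cap * (x ! 0 * (P ! 1 * \<beta> * S (P ! 0))))))"
    using u_form[OF linform_mult(2)[OF l]] by (simp add: mult.assoc)
  also have "\<dots> = (F \<lhd> braid b4 c4 \<lhd> assoc_inv b4 c4 d4 \<lhd> braid_inv a4 b4) (\<lambda>_. 1)"
  proof -
    have "l (S (p * \<beta> * S q) * R_cap * r) = sweedler R (\<lambda>v. l (S (v ! 1 * p * \<beta> * S q) * \<alpha> * (v ! 0 * r)))" for p q r
      using R_cap_form[of "\<lambda>a. l (S (p * \<beta> * S q) * a * r)", OF linform_middle[OF l]] by (simp add: S_mult mult.assoc)
    then show ?thesis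
      by (simp add: tensor_act_3 tensor_act_2 F_def S_mult S_one mult.assoc)
  qed
  also have "\<dots> = (F \<lhd> braid b4 c4 \<lhd> assoc_inv b4 c4 d4 \<lhd> assoc a4 b4 (c4 \<bullet> d4) \<lhd> braid_inv a4 b4) (\<lambda>_. 1)"
    by (rule assoc_right_absorb_past[where i = C4 and j = D4, symmetric])
      (use F cd in \<open>auto intro!: right_invariant_tensor_act\<close>)
  also have "F \<lhd> braid b4 c4 \<lhd> assoc_inv b4 c4 d4 \<lhd> assoc a4 b4 (c4 \<bullet> d4) \<lhd> braid_inv a4 b4
    = F \<lhd> assoc a4 (c4 \<bullet> b4) d4 \<lhd> braid_inv a4 (c4 \<bullet> b4) \<lhd> assoc_inv c4 b4 a4
      \<lhd> braid (b4 \<bullet> a4) c4 \<lhd> assoc_inv (b4 \<bullet> a4) c4 d4"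
    by (rule cup_slides_through_crossing[OF F])
  also have "F \<lhd> assoc a4 (c4 \<bullet> b4) d4 = F"
    by (rule assoc_absorb) (use F cb in auto)
  also have "F \<lhd> braid_inv a4 (c4 \<bullet> b4) = F"
    by (rule braid_absorb) (use F cb in auto)
  also have "(F \<lhd> assoc_inv c4 b4 a4 \<lhd> braid (b4 \<bullet> a4) c4 \<lhd> assoc_inv (b4 \<bullet> a4) c4 d4) (\<lambda>_. 1)
    = (F \<lhd> assoc_inv c4 b4 a4 \<lhd> braid (b4 \<bullet> a4) c4) (\<lambda>_. 1)"
    by (rule assoc_right_absorb) (use F ba in \<open>auto intro!: right_invariant_tensor_act\<close>)
  also have "\<dots> = (F \<lhd> assoc_inv c4 b4 a4) (\<lambda>_. 1)"
    by (rule braid_right_absorb) (use F ba in \<open>auto intro!: right_invariant_tensor_act\<close>)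
  also have "\<dots> = l (S \<beta>)"
    using antipode_\<Phi>_inv_form[OF linform_mult(1)[OF l], of "S \<beta>"]
    by (simp add: tensor_act_3 F_def S_mult S_one mult.assoc)
  finally show "l (u * R_inv_cup) = l (S \<beta>)" .
qed

text \<open>Insert \<open>\<alpha> = S(R_inv_cap)u\<close> into \<open>S(x\<^sup>1)\<alpha>x\<^sup>2\<beta>S(x\<^sup>3) = 1\<close> and move \<open>u\<close> to the right.\<close>

lemma u_left_inverse: "\<exists>w. w * u = 1"
proof
  let ?w = "sweedler \<Phi>_inv (\<lambda>x. S (x ! 0) * S R_inv_cap * S (S (x ! 1 * \<beta> * S (x ! 2))))"
  show "?w * u = 1"
  proof (rule linform_separates)
    fix l assume l: "linform l"
    have "S p * S R_inv_cap * S (S q) * u = S p * \<alpha> * q" for p q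
      by (simp add: mult.assoc S_S_u) (simp add: mult.assoc[symmetric] S_R_inv_cap_u)
    then show "l (?w * u) = l 1"
      using antipode_\<Phi>_inv_form[OF l] by (simp add: linform_sweedler[OF linform_mult(2)[OF l]] mult.assoc)
  qed
qed

text \<open>Apply \<open>S\<close> to \<open>S(x\<^sup>1)\<alpha>x\<^sup>2\<beta>S(x\<^sup>3) = 1\<close>, insert \<open>S(\<beta>) = uR_inv_cup\<close> and move \<open>u\<close> to the left. Neither one-sided inverse
implies the other, as \<open>H\<close> may be infinite-dimensional.\<close>

lemma u_right_inverse: "\<exists>w. u * w = 1"
proof
  let ?w = "sweedler \<Phi>_inv (\<lambda>x. x ! 2 * R_inv_cup * S (S (x ! 0) * \<alpha> * x ! 1))"
  show "u * ?w = 1"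
  proof (rule linform_separates)
    fix l assume l: "linform l"
    have "u * (r * R_inv_cup * q) = S (S r) * S \<beta> * q" for r q
      by (simp add: mult.assoc[symmetric] S_S_u[symmetric]) (simp add: mult.assoc u_R_inv_cup)
    then have "u * (x ! 2 * R_inv_cup * S (S (x ! 0) * \<alpha> * x ! 1)) = S (S (x ! 0) * \<alpha> * x ! 1 * \<beta> * S (x ! 2))" for x
      by (simp add: S_mult mult.assoc)
    then show "l (u * ?w) = l 1"
      using antipode_\<Phi>_inv_form[OF linform_mult(5)[OF l]]
      by (simp add: linform_sweedler[OF linform_mult(1)[OF l]] S_one)
  qed
qed

abbreviation u_inv :: 'h where "u_inv \<equiv> inverse_elem u"

lemma u_inverse: "u * u_inv = 1" "u_inv * u = 1"
proof -
  obtain v w where v: "v * u = 1" and w: "u * w = 1"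
    using u_left_inverse u_right_inverse by blast
  have "v = w" by (metis v w mult.assoc mult_1_left mult_1_right)
  then have "u * v = 1 \<and> v * u = 1" using v w by simp
  moreover have "b = v" if "u * b = 1 \<and> b * u = 1" for b
    using that v by (metis mult.assoc mult_1_left mult_1_right)
  ultimately have "u * u_inv = 1 \<and> u_inv * u = 1"
    unfolding inverse_elem_def by (rule theI2)
  then show "u * u_inv = 1" "u_inv * u = 1" by auto
qed

lemma S_squared: "S (S h) = u * h * u_inv"
  using S_S_u[of h] u_inverse by (metis mult.assoc mult_1_right)

lemma S_injective: "S a = S b \<Longrightarrow> a = b"
proof -
  assume "S a = S b"
  then have "u * a * u_inv = u * b * u_inv" by (simp flip: S_squared)
  then have "u_inv * (u * a * u_inv) * u = u_inv * (u * b * u_inv) * u" by simp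
  then show "a = b" using u_inverse by (metis mult.assoc mult_1_left mult_1_right)
qed

lemma S_surjective: "\<exists>a. S a = h"
proof
  show "S (S (u_inv * h * u)) = h"
    unfolding S_squared using u_inverse by (metis mult.assoc mult_1_left mult_1_right)
qed

section \<open>The coproduct of u\<close>

abbreviation uu :: "'h list list set" where "uu \<equiv> tensor 2 [[u, u]]"

lemma pure_closed [simp]: "tensor 2 [[a, b]] \<in> carrier (\<T> 2)"
  by (rule tensor_carrier) (simp add: tensor_words_def)

lemma pure_mult: "tensor 2 [[a, b]] \<star> tensor 2 [[c, d]] = tensor 2 [[a * c, b * d]]"
  by (rule tensor2_eqI) (auto simp: eval2_mult bilinear_form_eval2 bilinear_form_mult)

lemma pure_one: "tensor 2 [[1, 1]] = \<one>\<^bsub>\<T> 2\<^esub>"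
  by (rule tensor2_eqI) auto

text \<open>The left-hand side of the braid identity, read as an element: the crossing of the bundles puts \<open>\<Delta>(R_cap)\<close> behind the twist,
since \<open>f\<Delta>(S(R\<^sup>2)\<alpha>R\<^sup>1) = (S \<otimes> S)(\<Delta>\<^sup>c\<^sup>o\<^sup>p(R\<^sup>2))\<gamma>\<Delta>(R\<^sup>1)\<close>, and the full twist contributes \<open>R\<^sub>2\<^sub>1R\<close>.\<close>

lemma braided_\<gamma>_left:
  assumes B: "bilinear_form B"
  shows "(cap_form B \<lhd> assoc a4 b4 c4 \<lhd> assoc_inv (a4 \<bullet> b4) c4 d4
      \<lhd> braid (c4 \<bullet> d4) (a4 \<bullet> b4) \<lhd> braid d4 c4 \<lhd> braid c4 d4) (\<lambda>_. 1)
    = eval2 B (drinfeld_twist \<star> \<Delta> R_cap \<star> (flip R \<star> R))"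
proof -
  let ?ab = "a4 \<bullet> b4" and ?cd = "c4 \<bullet> d4"
  let ?Z = "\<lambda>v. cop_antipode (v ! 1) \<star> \<gamma> \<star> \<Delta> (v ! 0)"
  let ?T = "flip R \<star> R"
  define C where "C p q = sweedler R (\<lambda>v. eval2 (\<lambda>s t. B (s * p) (t * q)) (?Z v))" for p q
  have C: "bilinear_form C"
    unfolding C_def[abs_def] eval2_def by (intro bilinear_form_sweedler bilinear_form_mult B)
  have inner: "(\<gamma>_form B \<lhd> braid ?cd ?ab) ((\<lambda>_. 1)(D4 := q, C4 := p)) = C p q" for p q
  proof -
    have c: "leaves ?cd \<inter> leaves ?ab = {}" by auto
    show ?thesis
      unfolding tensor_act_2[OF R_closed(1)] C_def \<gamma>_pairing_eval[OF bilinear_form_mult(2)[OF B]] tree_act_commute[OF c]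
      by (simp add: \<gamma>_form_eval[OF B] mult.assoc)
  qed
  have C': "bilinear_form (\<lambda>a b. eval2 (\<lambda>c d. C (a * c) (b * d)) R)"
    "bilinear_form (\<lambda>c d. eval2 (\<lambda>a b. C (a * c) (b * d)) (flip R))"
    using bilinear_form_eval2[OF C] by auto
  have "(\<gamma>_form B \<lhd> braid ?cd ?ab \<lhd> braid d4 c4 \<lhd> braid c4 d4) (\<lambda>_. 1)
    = sweedler R (\<lambda>v. sweedler R (\<lambda>w. C (w ! 1 * v ! 0) (w ! 0 * v ! 1)))"
    using inner unfolding tensor_act_2[OF R_closed(1), of "d4"] tensor_act_2[OF R_closed(1), of "c4"]
    by (simp add: fun_upd_twist)
  also have "\<dots> = eval2 C ?T"
    using C by (simp add: eval2_mult_right bilinear_form_mult) (simp add: eval2_def)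
  also have "\<dots> = sweedler R (\<lambda>v. eval2 B (?Z v \<star> ?T))"
    using B by (simp add: eval2_mult_right[of _ ?T] C_def) (simp add: eval2_def C_def sweedler_swap[of ?T R])
  also have "\<dots> = sweedler R (\<lambda>v. eval2 B (drinfeld_twist \<star> \<Delta> (S (v ! 1) * \<alpha> * v ! 0) \<star> ?T))"
  proof -
    have "?Z v = drinfeld_twist \<star> \<Delta> (S (v ! 1) * \<alpha> * v ! 0)" for v
    proof -
      have "drinfeld_twist \<star> \<Delta> (S (v ! 1) * \<alpha> * v ! 0) = (drinfeld_twist \<star> \<Delta> (S (v ! 1))) \<star> \<Delta> \<alpha> \<star> \<Delta> (v ! 0)"
        by (simp add: \<Delta>_mult T2.m_assoc)
      also have "\<dots> = cop_antipode (v ! 1) \<star> (drinfeld_twist \<star> \<Delta> \<alpha>) \<star> \<Delta> (v ! 0)"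
        unfolding twist_\<Delta>_S by (simp add: T2.m_assoc)
      finally show ?thesis unfolding twist_\<Delta>_\<alpha> ..
    qed
    then show ?thesis by simp
  qed
  also have "\<dots> = eval2 B (drinfeld_twist \<star> \<Delta> R_cap \<star> ?T)"
    by (rule R_cap_form[OF linform_sandwich_\<Delta>[OF B]]) auto
  finally show ?thesis unfolding \<gamma>_form_def .
qed

text \<open>Each of the two remaining crossings turns its cap into \<open>R_cap = S(\<alpha>)u\<close>; moving both \<open>u\<close> to the right applies \<open>S\<^sup>2\<close> to the
factors that they pass and leaves \<open>(S \<otimes> S)(\<gamma>\<^sub>2\<^sub>1)\<close>.\<close>

lemma braided_\<gamma>_right:
  assumes B: "bilinear_form B"
  shows "(cap_form B \<lhd> braid c4 b4 \<lhd> braid d4 a4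
      \<lhd> assoc c4 d4 a4 \<lhd> assoc_inv (c4 \<bullet> d4) a4 b4) (\<lambda>_. 1)
    = eval2 B (map_both S (flip \<gamma>) \<star> uu)"
proof -
  have R_caps: "sweedler R (\<lambda>r. sweedler R (\<lambda>q. B (S (q ! 1 * a) * \<alpha> * (q ! 0 * b)) (S (r ! 1 * c) * \<alpha> * (r ! 0 * d))))
    = B (S (S b * \<alpha> * a) * u) (S (S d * \<alpha> * c) * u)" for a b c d
  proof -
    have *: "S x * R_cap * y = S (S y * \<alpha> * x) * u" for x y
      by (simp add: S_mult mult.assoc S_S_u S_\<alpha>_u[symmetric])
    have "sweedler R (\<lambda>q. B (S (q ! 1 * a) * \<alpha> * (q ! 0 * b)) z) = B (S a * R_cap * b) z" for z
      using R_cap_form[of "\<lambda>x. B (S a * x * b) z", OF linform_middle[OF bilinear_formD(2)[OF B]]] by (simp add: S_mult mult.assoc)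
    moreover have "sweedler R (\<lambda>r. B z (S (r ! 1 * c) * \<alpha> * (r ! 0 * d))) = B z (S c * R_cap * d)" for z
      using R_cap_form[of "\<lambda>x. B z (S c * x * d)", OF linform_middle[OF bilinear_formD(1)[OF B]]] by (simp add: S_mult mult.assoc)
    ultimately show ?thesis by (simp add: *)
  qed
  have bil: "bilinear_form (\<lambda>p q. B (S q * u) (S p * u))"
    using B by (auto simp: linear_simps)
  have "eval2 B (map_both S (flip \<gamma>) \<star> uu) = eval2 (\<lambda>p q. B (S q * u) (S p * u)) \<gamma>"
    using B by (simp add: eval2_mult bilinear_form_mult bilinear_form_endo[OF bilinear_form_mult(2)[OF B] S_endo])
  also have "\<dots> = sweedler \<Phi>_inv (\<lambda>x. sweedler (\<Delta> (x ! 0)) (\<lambda>v. sweedler \<Phi> (\<lambda>X.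
    B (S (S (X ! 0 * v ! 0) * \<alpha> * x ! 2) * u) (S (S (X ! 1 * v ! 1) * \<alpha> * (X ! 2 * x ! 1)) * u))))"
    unfolding eval2_\<gamma>[OF bil] sweedler_swap[where s = \<Phi> and t = \<Phi>_inv] sweedler_swap[where s = \<Phi> and t = "\<Delta> x" for x]
    by (simp add: mult.assoc)
  also have "\<dots> = (cap_form B \<lhd> braid c4 b4 \<lhd> braid d4 a4
      \<lhd> assoc c4 d4 a4 \<lhd> assoc_inv (c4 \<bullet> d4) a4 b4) (\<lambda>_. 1)"
    unfolding R_caps[symmetric] by (simp add: tensor_act_3 tensor_act_2 cap_form_def)
  finally show ?thesis ..
qed

lemma twist_\<Delta>_R_cap: "drinfeld_twist \<star> \<Delta> R_cap \<star> (flip R \<star> R) = map_both S (flip \<gamma>) \<star> uu"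
proof (rule tensor2_eqI)
  fix B assume B: "bilinear_form B"
  show "eval2 B (drinfeld_twist \<star> \<Delta> R_cap \<star> (flip R \<star> R)) = eval2 B (map_both S (flip \<gamma>) \<star> uu)"
    unfolding braided_\<gamma>_left[OF B, symmetric] braided_\<gamma>_right[OF B, symmetric]
    by (subst double_crossing_under_caps) (use B cap_form_invariant[OF B] in auto)
qed auto

lemma inverse_Units:
  assumes "x \<in> carrier (\<T> 2)" "y \<in> carrier (\<T> 2)" "x \<star> y = \<one>\<^bsub>\<T> 2\<^esub>" "y \<star> x = \<one>\<^bsub>\<T> 2\<^esub>"
  shows "x \<in> Units (\<T> 2)" "inv\<^bsub>\<T> 2\<^esub> x = y"
proof -
  show U: "x \<in> Units (\<T> 2)" using assms by (auto simp: Units_def)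
  show "inv\<^bsub>\<T> 2\<^esub> x = y"
    using assms U by (metis T2.Units_inv_closed T2.Units_l_inv T2.inv_unique)
qed

lemma flip_inverse: "flip drinfeld_twist \<in> Units (\<T> 2)" "inv\<^bsub>\<T> 2\<^esub> (flip drinfeld_twist) = flip twist_inv"
  using inverse_Units[of "flip drinfeld_twist" "flip twist_inv"] by (simp_all flip: flip_mult add: twist_inverse flip_one)

abbreviation monodromy :: "'h list list set" where "monodromy \<equiv> flip R \<star> R"

abbreviation inv_monodromy :: "'h list list set" where "inv_monodromy \<equiv> inv\<^bsub>\<T> 2\<^esub> monodromy"

lemma flip_R_Units: "flip R \<in> Units (\<T> 2)"
  using inverse_Units(1)[of "flip R" "flip R_inv"] R_unit by (simp flip: flip_mult add: flip_one)

lemma monodromy_Units: "monodromy \<in> Units (\<T> 2)"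
  by (rule T2.Units_m_closed[OF flip_R_Units R_unit])

lemma monodromy_inv_closed [simp]: "inv_monodromy \<in> carrier (\<T> 2)"
  using monodromy_Units by auto

lemma monodromy_inv: "monodromy \<star> inv_monodromy = \<one>\<^bsub>\<T> 2\<^esub>"
  "inv_monodromy \<star> monodromy = \<one>\<^bsub>\<T> 2\<^esub>"
  using monodromy_Units by auto

lemma flip_R_\<Delta>: "flip R \<star> flip (\<Delta> h) = \<Delta> h \<star> flip R"
  using arg_cong[OF R_\<Delta>[of h], of flip] by (simp add: flip_mult flip_flip)

lemma monodromy_commute: "monodromy \<star> \<Delta> h = \<Delta> h \<star> monodromy"
proof -
  have "monodromy \<star> \<Delta> h = flip R \<star> flip (\<Delta> h) \<star> R"
    by (simp add: T2.m_assoc R_\<Delta>[symmetric])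
  then show ?thesis by (simp add: flip_R_\<Delta> T2.m_assoc)
qed

lemma monodromy_inv_commute: "inv_monodromy \<star> \<Delta> h = \<Delta> h \<star> inv_monodromy"
proof -
  let ?Q = monodromy and ?q = "inv_monodromy"
  have "?q \<star> \<Delta> h = ?q \<star> (\<Delta> h \<star> (?Q \<star> ?q))"
    by (simp add: monodromy_inv)
  also have "\<dots> = ?q \<star> (\<Delta> h \<star> ?Q) \<star> ?q"
    by (simp only: T2.m_assoc T2.m_closed \<Delta>_carrier flip_closed R_closed monodromy_inv_closed)
  also have "\<dots> = ?q \<star> ?Q \<star> (\<Delta> h \<star> ?q)"
    unfolding monodromy_commute[symmetric]
    by (simp only: T2.m_assoc T2.m_closed \<Delta>_carrier flip_closed R_closed monodromy_inv_closed)
  finally show ?thesis by (simp add: monodromy_inv)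
qed

text \<open>Write \<open>1 = S(x\<^sup>2\<beta>S(x\<^sup>3)) S(\<alpha>) S\<^sup>2(x\<^sup>1)\<close>. Then \<open>U\<close> can be recovered from \<open>\<Delta>(S(\<alpha>))U\<close>: move \<open>\<Delta>(S\<^sup>2(x\<^sup>1))\<close> past \<open>U\<close>.\<close>

lemma intertwiners_equal:
  assumes c: "U \<in> carrier (\<T> 2)" "V \<in> carrier (\<T> 2)"
    and U: "\<And>h. U \<star> \<Delta> h = \<Delta> (S (S h)) \<star> U"
    and V: "\<And>h. V \<star> \<Delta> h = \<Delta> (S (S h)) \<star> V"
    and eq: "\<Delta> (S \<alpha>) \<star> U = \<Delta> (S \<alpha>) \<star> V"
  shows "U = V"
proof (rule tensor2_eqI[OF c])
  fix B assume B: "bilinear_form B"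
  have *: "eval2 B W = sweedler \<Phi>_inv (\<lambda>x. eval2 B (\<Delta> (S (x ! 1 * \<beta> * S (x ! 2))) \<star> (\<Delta> (S \<alpha>) \<star> W) \<star> \<Delta> (x ! 0)))"
    if W: "W \<in> carrier (\<T> 2)" "\<And>h. W \<star> \<Delta> h = \<Delta> (S (S h)) \<star> W" for W
  proof -
    have "linform (\<lambda>h. eval2 B (\<Delta> (S h) \<star> W))"
      using linform_endo[OF linform_sandwich_\<Delta>[OF B T2.one_closed W(1)] S_endo] by simp
    from antipode_\<Phi>_inv_form[OF this]
    have "eval2 B W = sweedler \<Phi>_inv (\<lambda>x. eval2 B (\<Delta> (S (S (x ! 0) * \<alpha> * x ! 1 * \<beta> * S (x ! 2))) \<star> W))"
      using W by (simp add: S_one \<Delta>_one)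
    moreover have "\<Delta> (S (S p * \<alpha> * q * \<beta> * S r)) \<star> W
      = \<Delta> (S (q * \<beta> * S r)) \<star> (\<Delta> (S \<alpha>) \<star> W) \<star> \<Delta> p" for p q r
      using W by (simp add: S_mult \<Delta>_mult T2.m_assoc)
    ultimately show ?thesis by simp
  qed
  show "eval2 B U = eval2 B V"
    unfolding *[OF c(1) U] *[OF c(2) V] eq ..
qed

lemma map_both_S_flip: "t \<in> carrier (\<T> 2) \<Longrightarrow> map_both S (flip t) = flip (map_both S t)"
  by (rule tensor2_eqI) (auto simp: bilinear_form_flip bilinear_form_endo S_endo
      bilinear_form_endo[OF bilinear_form_flip S_endo] bilinear_form_flip[OF bilinear_form_endo[OF _ S_endo]])

abbreviation twist_ratio :: "'h list list set" where "twist_ratio \<equiv> map_both S (flip drinfeld_twist)"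

abbreviation twist_ratio_inv :: "'h list list set" where "twist_ratio_inv \<equiv> map_both S (flip twist_inv)"

lemma map_both_S_one: "map_both S \<one>\<^bsub>\<T> 2\<^esub> = \<one>\<^bsub>\<T> 2\<^esub>"
  by (rule tensor2_eqI) (auto simp: bilinear_form_endo S_endo S_one)

lemma twist_ratio_inverse: "twist_ratio \<star> twist_ratio_inv = \<one>\<^bsub>\<T> 2\<^esub>"
  "twist_ratio_inv \<star> twist_ratio = \<one>\<^bsub>\<T> 2\<^esub>"
  by (simp_all flip: map_both_S_mult flip_mult add: twist_inverse flip_one map_both_S_one)

lemma twist_ratio_cop:
  "map_both S (map_both S (\<Delta> h)) \<in> carrier (\<T> 2)"
  "twist_ratio \<star> map_both S (map_both S (\<Delta> h)) = cop_antipode (S h) \<star> twist_ratio"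
proof -
  show "map_both S (map_both S (\<Delta> h)) \<in> carrier (\<T> 2)" by simp
  have "map_both S (\<Delta> h) = flip (cop_antipode h)"
    by (simp add: cop_antipode_def map_both_S_flip flip_flip)
  then have "twist_ratio \<star> map_both S (map_both S (\<Delta> h)) = map_both S (flip (cop_antipode h) \<star> flip drinfeld_twist)"
    by (simp add: map_both_S_mult)
  also have "flip (cop_antipode h) \<star> flip drinfeld_twist = flip (drinfeld_twist \<star> \<Delta> (S h))"
    by (simp add: flip_mult twist_\<Delta>_S)
  also have "map_both S \<dots> = cop_antipode (S h) \<star> twist_ratio"
    by (simp add: flip_mult map_both_S_mult cop_antipode_def)
  finally show "twist_ratio \<star> map_both S (map_both S (\<Delta> h)) = cop_antipode (S h) \<star> twist_ratio" .
qed

lemma uu_\<Delta>: "uu \<star> \<Delta> h = map_both S (map_both S (\<Delta> h)) \<star> uu"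
proof (rule tensor2_eqI)
  fix B assume B: "bilinear_form B"
  note bil = bilinear_form_mult(2)[OF B] bilinear_form_endo[OF bilinear_form_mult(2)[OF B] S_endo]
  show "eval2 B (uu \<star> \<Delta> h) = eval2 B (map_both S (map_both S (\<Delta> h)) \<star> uu)"
    using B bil by (simp add: eval2_mult bilinear_form_mult bilinear_form_eval2 S_S_u)
qed auto

lemma twist_inv_cop: "twist_inv \<star> cop_antipode h = \<Delta> (S h) \<star> twist_inv"
proof -
  have "twist_inv \<star> cop_antipode h = twist_inv \<star> (cop_antipode h \<star> drinfeld_twist) \<star> twist_inv"
    by (simp add: T2.m_assoc twist_inverse)
  also have "\<dots> = twist_inv \<star> drinfeld_twist \<star> \<Delta> (S h) \<star> twist_inv"
    unfolding twist_\<Delta>_S[symmetric] by (simp add: T2.m_assoc)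
  finally show ?thesis by (simp add: twist_inverse)
qed

lemma \<Delta>_u: "\<Delta> u = twist_inv \<star> twist_ratio \<star> uu \<star> inv_monodromy"
proof (rule intertwiners_equal)
  let ?q = "inv_monodromy"
  let ?U = "twist_inv \<star> twist_ratio \<star> uu \<star> ?q"
  note closed = T2.m_assoc T2.m_closed \<Delta>_carrier flip_closed twist_closed twist_inv_closed map_both_closed pure_closed
    monodromy_inv_closed cop_antipode_closed R_closed
  show "\<Delta> u \<star> \<Delta> h = \<Delta> (S (S h)) \<star> \<Delta> u" for h
    by (simp flip: \<Delta>_mult add: S_S_u)
  show "?U \<star> \<Delta> h = \<Delta> (S (S h)) \<star> ?U" for h
  proof -
    have "?U \<star> \<Delta> h = twist_inv \<star> twist_ratio \<star> (uu \<star> \<Delta> h) \<star> ?q"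
      by (simp only: closed monodromy_inv_commute)
    also have "\<dots> = twist_inv \<star> (twist_ratio \<star> map_both S (map_both S (\<Delta> h))) \<star> uu \<star> ?q"
      by (simp only: closed uu_\<Delta>)
    also have "\<dots> = (twist_inv \<star> cop_antipode (S h)) \<star> twist_ratio \<star> uu \<star> ?q"
      by (simp only: closed twist_ratio_cop)
    also have "\<dots> = \<Delta> (S (S h)) \<star> ?U"
      by (simp only: closed twist_inv_cop)
    finally show ?thesis .
  qed
  have "\<Delta> (S \<alpha>) \<star> ?U = (twist_inv \<star> cop_antipode \<alpha>) \<star> twist_ratio \<star> uu \<star> ?q"
    by (simp only: closed twist_inv_cop)
  also have "\<dots> = twist_inv \<star> (cop_antipode \<alpha> \<star> twist_ratio) \<star> uu \<star> ?q"
    by (simp only: closed)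
  also have "cop_antipode \<alpha> \<star> twist_ratio = map_both S (flip \<gamma>)"
    by (simp flip: twist_\<Delta>_\<alpha> add: cop_antipode_def map_both_S_mult flip_mult)
  also have "twist_inv \<star> map_both S (flip \<gamma>) \<star> uu \<star> ?q
    = twist_inv \<star> (map_both S (flip \<gamma>) \<star> uu) \<star> ?q"
    by (simp add: T2.m_assoc)
  also have "\<dots> = (twist_inv \<star> drinfeld_twist) \<star> \<Delta> R_cap \<star> (monodromy \<star> ?q)"
    unfolding twist_\<Delta>_R_cap[symmetric] by (simp only: closed)
  also have "\<dots> = \<Delta> (S \<alpha>) \<star> \<Delta> u"
    by (simp add: twist_inverse monodromy_inv S_\<alpha>_u flip: \<Delta>_mult)
  finally show "\<Delta> (S \<alpha>) \<star> \<Delta> u = \<Delta> (S \<alpha>) \<star> ?U" ..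
qed auto

section \<open>Ribbon elements\<close>

lemma S_squared_fixes_u: "S (S u) = u" "S (S u_inv) = u_inv"
  unfolding S_squared using u_inverse by (simp_all add: mult.assoc)

lemma S_u_inverse: "S u * S u_inv = 1" "S u_inv * S u = 1"
  using u_inverse by (simp_all flip: S_mult add: S_one)

text \<open>Solve \<open>S(R_inv_cap)u = \<alpha>\<close>, using that \<open>S\<close> is injective and \<open>S\<^sup>2\<close> is conjugation by \<open>u\<close>.\<close>

lemma R_inv_cap_eq: "R_inv_cap = S \<alpha> * S u_inv"
proof (rule S_injective)
  have "S R_inv_cap = \<alpha> * u_inv"
    using arg_cong[OF S_R_inv_cap_u, of "\<lambda>x. x * u_inv"] u_inverse by (simp add: mult.assoc)
  also have "\<alpha> * u_inv = S (S u_inv) * S (S \<alpha>)"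
    unfolding S_squared_fixes_u(2) S_squared using u_inverse by (metis mult.assoc mult_1_left)
  finally show "S R_inv_cap = S (S \<alpha> * S u_inv)" by (simp add: S_mult)
qed

lemma inv_monodromy_eq: "inv_monodromy = R_inv \<star> flip R_inv"
proof (rule inverse_Units(2))
  have c: "flip R \<star> flip R_inv = \<one>\<^bsub>\<T> 2\<^esub>" "flip R_inv \<star> flip R = \<one>\<^bsub>\<T> 2\<^esub>"
    "R \<star> R_inv = \<one>\<^bsub>\<T> 2\<^esub>" "R_inv \<star> R = \<one>\<^bsub>\<T> 2\<^esub>"
    using R_unit by (simp_all flip: flip_mult add: flip_one)
  have "monodromy \<star> (R_inv \<star> flip R_inv) = flip R \<star> (R \<star> R_inv) \<star> flip R_inv"
    by (simp only: T2.m_assoc T2.m_closed flip_closed R_closed)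
  then show "monodromy \<star> (R_inv \<star> flip R_inv) = \<one>\<^bsub>\<T> 2\<^esub>" unfolding c by (simp add: c)
  have "R_inv \<star> flip R_inv \<star> monodromy = R_inv \<star> (flip R_inv \<star> flip R) \<star> R"
    by (simp only: T2.m_assoc T2.m_closed flip_closed R_closed)
  then show "R_inv \<star> flip R_inv \<star> monodromy = \<one>\<^bsub>\<T> 2\<^esub>" unfolding c by (simp add: c)
qed auto

text \<open>Undoing both crossings of a full twist below a cap multiplies \<open>\<alpha>\<close> by \<open>(uS(u))\<^sup>-\<^sup>1\<close>. The factor \<open>R\<^sup>-\<^sup>1\<close> yields
\<open>R_inv_cap\<close>; the factor \<open>R\<^sub>2\<^sub>1\<^sup>-\<^sup>1\<close> is evaluated after applying \<open>S\<close>, which exchanges its components.\<close>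

lemma monodromy_cap:
  assumes l: "linform l"
  shows "eval2 (\<lambda>a b. l (S a * \<alpha> * b)) (inv_monodromy) = l (S u_inv * u_inv * \<alpha>)"
proof -
  define T where "T = sweedler R_inv (\<lambda>v. S (v ! 1) * R_inv_cap * v ! 0)"
  have T: "sweedler R_inv (\<lambda>v. l (S (v ! 1) * R_inv_cap * v ! 0)) = l T" if "linform l" for l
    using that by (simp add: T_def linform_sweedler)
  let ?W = "\<lambda>a b. l (S a * \<alpha> * b)"
  have W: "bilinear_form ?W" by (rule bilinear_form_cap[OF l])
  have "eval2 ?W (inv_monodromy) = eval2 (\<lambda>c d. eval2 (\<lambda>a b. ?W (a * d) (b * c)) R_inv) R_inv"
    using W by (simp add: inv_monodromy_eq eval2_mult_right bilinear_form_eval2(2)[OF W])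
  also have "\<dots> = l T"
    unfolding eval2_def using R_inv_cap_form[OF linform_middle[OF l], of "S d" c for c d] T[OF l]
    by (simp add: S_mult mult.assoc)
  also have "T = S u_inv * u_inv * \<alpha>"
  proof (rule S_injective, rule linform_separates)
    fix l assume l: "linform l"
    have "l (S T) = sweedler R_inv (\<lambda>v. l (S (v ! 0) * S R_inv_cap * S (S (v ! 1))))"
      using T[OF linform_mult(5)[OF l]] by (simp add: S_mult mult.assoc)
    also have "\<dots> = sweedler R_inv (\<lambda>v. l (S (v ! 0) * \<alpha> * v ! 1 * u_inv))"
    proof -
      have "S p * S R_inv_cap * S (S q) = S p * \<alpha> * q * u_inv" for p q
        unfolding S_squared using S_R_inv_cap_u by (metis mult.assoc)
      then show ?thesis by simp
    qed
    also have "\<dots> = l (R_inv_cap * u_inv)"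
      by (rule R_inv_cap_form[OF linform_mult(2)[OF l]])
    also have "R_inv_cap * u_inv = S (S u_inv * u_inv * \<alpha>)"
      by (simp add: R_inv_cap_eq S_mult S_squared_fixes_u mult.assoc)
    finally show "l (S T) = l (S (S u_inv * u_inv * \<alpha>))" .
  qed
  finally show ?thesis .
qed

lemma counit_monodromy:
  assumes l: "linform l"
  shows "eval2 (\<lambda>a b. \<epsilon> a * l b) (inv_monodromy) = l 1"
proof -
  let ?W = "\<lambda>l a b. \<epsilon> a * l b"
  have W: "bilinear_form (?W l)" if "linform l" for l
    using that linform_\<epsilon> by (auto simp: bilinear_form_def linform_def algebra_simps)
  have drop: "eval2 (?W l) (s \<star> t) = eval2 (?W l) s"
    if t: "\<And>l. linform l \<Longrightarrow> eval2 (?W l) t = l 1" and c: "s \<in> carrier (\<T> 2)" "t \<in> carrier (\<T> 2)" for s t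
  proof -
    have "eval2 (\<lambda>c d. ?W l (a * c) (b * d)) t = \<epsilon> a * l b" for a b
      using t[OF linform_mult(1)[OF l], of b] by (simp add: eval2_def \<epsilon>_mult mult.assoc sweedler_scale)
    then show ?thesis using c W[OF l] by (simp add: eval2_mult)
  qed
  have R: "eval2 (?W l) R = l 1" "eval2 (?W l) (flip R) = l 1" if "linform l" for l
    using counit_R_form[OF that] W[OF that] by (simp_all add: eval2_def[of _ R])
  let ?q = "inv_monodromy"
  have "eval2 (?W l) (?q \<star> flip R \<star> R) = eval2 (?W l) ?q"
    using R by (simp add: drop)
  moreover have "?q \<star> flip R \<star> R = \<one>\<^bsub>\<T> 2\<^esub>"
    using monodromy_inv(2) by (simp add: T2.m_assoc)
  ultimately show ?thesis using W[OF l] by (simp add: \<epsilon>_one)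
qed

text \<open>Compare the images of both sides of the formula for \<open>\<Delta>(\<nu>)\<close> under \<open>a \<otimes> b \<mapsto> S(a)\<alpha>b\<close>.\<close>

lemma S_fixes_ribbon:
  assumes central: "\<And>h. \<nu> * h = h * \<nu>" and \<Delta>\<nu>: "\<Delta> \<nu> = tensor 2 [[\<nu>, \<nu>]] \<star> inv_monodromy"
    and square: "\<nu>\<^sup>2 = u * S u"
  shows "S \<nu> = \<nu>"
proof -
  \<comment> \<open>\<open>\<kappa>\<close> is the inverse of \<open>\<nu>\<^sup>2 = uS(u)\<close>, so \<open>c = S(\<nu>)\<nu>\<kappa>\<close> below is \<open>S(\<nu>)\<nu>\<^sup>-\<^sup>1\<close>.\<close>
  define \<kappa> where "\<kappa> = S u_inv * u_inv"
  have sq: "\<nu> * \<nu> = u * S u" using square by (simp add: power2_eq_square)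
  have \<kappa>: "\<kappa> * (\<nu> * \<nu>) = 1" "\<nu> * \<nu> * \<kappa> = 1"
    unfolding \<kappa>_def sq using u_inverse S_u_inverse by (metis mult.assoc mult_1_left)+
  have \<kappa>_central: "\<kappa> * h = h * \<kappa>" for h
  proof -
    have "\<kappa> * h = \<kappa> * h * (\<nu> * \<nu> * \<kappa>)" using \<kappa> by simp
    also have "\<dots> = \<kappa> * (\<nu> * \<nu>) * h * \<kappa>" using central by (metis mult.assoc)
    finally show ?thesis using \<kappa> by simp
  qed
  have S_central: "S \<nu> * h = h * S \<nu>" for h
  proof -
    obtain g where "h = S g" using S_surjective by metis
    then show ?thesis using central[of g] by (simp flip: S_mult)
  qed
  define c where "c = S \<nu> * \<nu> * \<kappa>"
  have c_central: "c * h = h * c" for h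
    unfolding c_def using S_central central \<kappa>_central by (metis mult.assoc)
  have "\<epsilon> \<nu> = \<epsilon> \<nu> * \<epsilon> \<nu>"
  proof -
    have W: "bilinear_form (\<lambda>a b. \<epsilon> a * \<epsilon> b)"
      using linform_\<epsilon> by (auto simp: bilinear_form_def linform_def algebra_simps)
    have "\<epsilon> \<nu> = eval2 (\<lambda>a b. \<epsilon> a * \<epsilon> b) (\<Delta> \<nu>)"
      unfolding eval2_def by (rule counit_forms(2)[OF linform_\<epsilon>, symmetric])
    also have "\<dots> = eval2 (\<lambda>a b. \<epsilon> (\<nu> * a) * \<epsilon> (\<nu> * b)) (inv_monodromy)"
      unfolding \<Delta>\<nu> using W by (simp add: eval2_mult bilinear_form_eval2(1)[OF W])
    also have "\<dots> = \<epsilon> \<nu> * \<epsilon> \<nu> * eval2 (\<lambda>a b. \<epsilon> a * \<epsilon> b) (inv_monodromy)"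
      by (simp add: eval2_def \<epsilon>_mult sweedler_scale[symmetric] mult_ac)
    finally show ?thesis by (simp add: counit_monodromy[OF linform_\<epsilon>] \<epsilon>_one)
  qed
  moreover have "\<epsilon> \<nu> \<noteq> 0"
    using arg_cong[OF \<kappa>(2), of \<epsilon>] by (auto simp: \<epsilon>_mult \<epsilon>_one)
  ultimately have \<epsilon>\<nu>: "\<epsilon> \<nu> = 1" by simp
  have "c * \<alpha> = \<alpha>"
  proof (rule linform_separates)
    fix l assume l: "linform l"
    let ?W = "\<lambda>a b. l (S a * \<alpha> * b)"
    have W: "bilinear_form ?W" by (rule bilinear_form_cap[OF l])
    have "l \<alpha> = eval2 ?W (\<Delta> \<nu>)"
      using antipode_\<alpha>_form[OF l, of \<nu>] \<epsilon>\<nu> by (simp add: eval2_def)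
    also have "\<dots> = eval2 (\<lambda>a b. ?W (\<nu> * a) (\<nu> * b)) (inv_monodromy)"
      unfolding \<Delta>\<nu> using W by (simp add: eval2_mult bilinear_form_eval2(1)[OF W])
    also have "\<dots> = eval2 (\<lambda>a b. l (S \<nu> * \<nu> * (S a * \<alpha> * b))) (inv_monodromy)"
    proof -
      have "S (\<nu> * a) * \<alpha> * (\<nu> * b) = S \<nu> * \<nu> * (S a * \<alpha> * b)" for a b
        by (metis S_mult S_central central mult.assoc)
      then show ?thesis by simp
    qed
    also have "\<dots> = l (c * \<alpha>)"
      using monodromy_cap[OF linform_mult(1)[OF l], of "S \<nu> * \<nu>"] by (simp add: c_def \<kappa>_def mult.assoc)
    finally show "l (c * \<alpha>) = l \<alpha>" ..
  qed
  have "c = 1"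
  proof (rule linform_separates)
    fix l assume l: "linform l"
    have "c * (p * \<beta> * S q * \<alpha> * r) = p * \<beta> * S q * \<alpha> * r" for p q r
      using \<open>c * \<alpha> = \<alpha>\<close> c_central by (metis mult.assoc)
    then show "l c = l 1"
      using antipode_\<Phi>_form[OF linform_mult(1)[OF l], of c] antipode_\<Phi>_form[OF l] by simp
  qed
  then have "S \<nu> = S \<nu> * (\<nu> * \<nu> * \<kappa>)" using \<kappa> by simp
  also have "\<dots> = c * \<nu>"
    unfolding c_def using central by (metis mult.assoc)
  finally show ?thesis using \<open>c = 1\<close> by simp
qed

lemma R_set_alt: "R_set = {l. l\<^sup>2 = u_inv * S u \<and>
    \<Delta> l = tensor 2 [[l, l]] \<star> twist_ratio_inv \<star> drinfeld_twist \<and> (\<forall>h. l * S (S h) = h * l)}"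
  by (simp add: R_set_def flip_inverse)

text \<open>As \<open>ul = lu\<close>, the coproduct can be computed as \<open>\<Delta>(l)\<Delta>(u)\<close>, an order in which the twist factors are adjacent.\<close>

theorem u_mult_ribbon:
  assumes "l \<in> R_set"
  shows "u * l \<in> ribbon_elements"
proof -
  from assms have l: "l\<^sup>2 = u_inv * S u"
    "\<Delta> l = tensor 2 [[l, l]] \<star> twist_ratio_inv \<star> drinfeld_twist" "\<And>h. l * S (S h) = h * l"
    by (auto simp: R_set_alt)
  have lu: "l * u * h = h * (l * u)" for h
    using l(3)[of h] S_S_u[of h] by (metis mult.assoc)
  have ul: "u * l = l * u"
    using lu[of u] u_inverse by (metis mult.assoc mult_1_right)
  have central: "u * l * h = h * (u * l)" for h
    using lu by (simp add: ul)
  have \<Delta>: "\<Delta> (u * l) = tensor 2 [[u * l, u * l]] \<star> inv_monodromy"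
  proof -
    note closed = T2.m_assoc T2.m_closed flip_closed twist_closed twist_inv_closed map_both_closed pure_closed
      monodromy_inv_closed R_closed
    have "\<Delta> (u * l) = \<Delta> l \<star> \<Delta> u"
      by (simp add: ul \<Delta>_mult)
    also have "\<dots> = tensor 2 [[l, l]] \<star> (twist_ratio_inv \<star> ((drinfeld_twist \<star> twist_inv) \<star> twist_ratio))
      \<star> uu \<star> inv_monodromy"
      unfolding l(2) \<Delta>_u by (simp only: closed)
    also have "\<dots> = tensor 2 [[l, l]] \<star> uu \<star> inv_monodromy"
      by (simp add: twist_inverse twist_ratio_inverse)
    finally show ?thesis by (simp add: pure_mult ul)
  qed
  have square: "(u * l)\<^sup>2 = u * S u"
  proof -
    have "(u * l)\<^sup>2 = u * (u * l\<^sup>2)"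
      unfolding power2_eq_square by (metis ul mult.assoc)
    then show ?thesis unfolding l(1) using u_inverse by (metis mult.assoc mult_1_left)
  qed
  show ?thesis
    unfolding ribbon_elements_def using central \<Delta> square S_fixes_ribbon[OF central \<Delta> square] by simp
qed

text \<open>Again \<open>u\<^sup>-\<^sup>1\<nu> = \<nu>u\<^sup>-\<^sup>1\<close>, and in \<open>\<Delta>(\<nu>)\<Delta>(u\<^sup>-\<^sup>1)\<close> the factors \<open>Q\<^sup>-\<^sup>1\<close> and \<open>Q\<close> are adjacent.\<close>

theorem u_inv_mult_R_set:
  assumes "\<nu> \<in> ribbon_elements"
  shows "u_inv * \<nu> \<in> R_set"
proof -
  from assms have \<nu>: "\<And>h. \<nu> * h = h * \<nu>" "\<Delta> \<nu> = tensor 2 [[\<nu>, \<nu>]] \<star> inv_monodromy" "\<nu>\<^sup>2 = u * S u"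
    by (auto simp: ribbon_elements_def)
  note closed = T2.m_assoc T2.m_closed flip_closed twist_closed twist_inv_closed map_both_closed pure_closed
    monodromy_inv_closed R_closed \<Delta>_carrier
  let ?x = "monodromy \<star> tensor 2 [[u_inv, u_inv]] \<star> twist_ratio_inv \<star> drinfeld_twist"
  have "\<Delta> u \<star> ?x = \<one>\<^bsub>\<T> 2\<^esub>"
  proof -
    have "\<Delta> u \<star> ?x = twist_inv \<star> (twist_ratio \<star> ((uu \<star> ((inv_monodromy \<star> monodromy)
      \<star> tensor 2 [[u_inv, u_inv]])) \<star> twist_ratio_inv)) \<star> drinfeld_twist"
      unfolding \<Delta>_u by (simp only: closed)
    then show ?thesis
      by (simp add: monodromy_inv pure_mult u_inverse pure_one twist_ratio_inverse twist_inverse)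
  qed
  then have "\<Delta> u_inv \<star> (\<Delta> u \<star> ?x) = \<Delta> u_inv"
    by simp
  moreover have "\<Delta> u_inv \<star> (\<Delta> u \<star> ?x) = (\<Delta> u_inv \<star> \<Delta> u) \<star> ?x"
    by (simp only: closed)
  moreover have "\<Delta> u_inv \<star> \<Delta> u = \<one>\<^bsub>\<T> 2\<^esub>"
    by (simp flip: \<Delta>_mult add: u_inverse \<Delta>_one)
  ultimately have \<Delta>_u_inv: "\<Delta> u_inv = ?x" by simp
  have "\<Delta> (u_inv * \<nu>) = \<Delta> \<nu> \<star> \<Delta> u_inv"
    by (simp add: \<nu>(1)[symmetric] \<Delta>_mult)
  also have "\<dots> = (tensor 2 [[\<nu>, \<nu>]] \<star> ((inv_monodromy \<star> monodromy) \<star> tensor 2 [[u_inv, u_inv]]))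
    \<star> twist_ratio_inv \<star> drinfeld_twist"
    unfolding \<nu>(2) \<Delta>_u_inv by (simp only: closed)
  also have "\<dots> = tensor 2 [[u_inv * \<nu>, u_inv * \<nu>]] \<star> twist_ratio_inv \<star> drinfeld_twist"
    by (simp add: monodromy_inv pure_mult \<nu>(1)[symmetric])
  finally have "\<Delta> (u_inv * \<nu>) = tensor 2 [[u_inv * \<nu>, u_inv * \<nu>]] \<star> twist_ratio_inv \<star> drinfeld_twist" .
  moreover have "(u_inv * \<nu>)\<^sup>2 = u_inv * S u"
  proof -
    have "(u_inv * \<nu>)\<^sup>2 = u_inv * (u_inv * \<nu>\<^sup>2)"
      unfolding power2_eq_square by (metis \<nu>(1) mult.assoc)
    then show ?thesis unfolding \<nu>(3) using u_inverse by (metis mult.assoc mult_1_left)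
  qed
  moreover have "u_inv * \<nu> * S (S h) = h * (u_inv * \<nu>)" for h
    unfolding S_squared using \<nu>(1) u_inverse by (metis mult.assoc mult_1_left)
  ultimately show ?thesis by (simp add: R_set_alt)
qed

theorem u_mult_bij: "bij_betw (\<lambda>l. u * l) R_set ribbon_elements"
proof (rule bij_betwI)
  show "(\<lambda>l. u * l) \<in> R_set \<rightarrow> ribbon_elements" using u_mult_ribbon by auto
  show "(\<lambda>\<nu>. u_inv * \<nu>) \<in> ribbon_elements \<rightarrow> R_set" using u_inv_mult_R_set by auto
  show "u_inv * (u * l) = l" for l using u_inverse by (simp flip: mult.assoc)
  show "u * (u_inv * \<nu>) = \<nu>" for \<nu> using u_inverse by (simp flip: mult.assoc)
qed

end

theorem corollary3p2:
  fixes scale :: "'k::field \<Rightarrow> 'h::ring_1 \<Rightarrow> 'h"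
    and \<Delta> :: "'h \<Rightarrow> 'h list list set"
    and \<epsilon> :: "'h \<Rightarrow> 'k"
    and \<Phi> R :: "'h list list set"
    and S :: "'h \<Rightarrow> 'h"
    and \<alpha> \<beta> :: 'h
  assumes "quasitriangular_quasi_hopf_algebra scale \<Delta> \<epsilon> \<Phi> S \<alpha> \<beta> R"
  shows "bij_betw (\<lambda>l. quasitriangular_quasi_hopf_algebra.u scale \<Phi> S \<alpha> \<beta> R * l)
    (quasitriangular_quasi_hopf_algebra.R_set scale \<Delta> \<Phi> S \<alpha> \<beta> R)
    (quasitriangular_quasi_hopf_algebra.ribbon_elements scale \<Delta> \<Phi> S \<alpha> \<beta> R)"
  using quasitriangular_quasi_hopf_algebra.u_mult_bij[OF assms] .

end
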